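(* Let $g=[z^2,z^4;z^4,z]$, $C=\langle g\rangle\le\mathrm{SL}(2,8)$ and $f=[0,1;1,0]$. (a) Let $$D_1=\{\mathbb 1,\ [z^5,1;z^5,z^6],\ [z^4,z^2;1,z^2],\ [1,z;z^6,0],\ [0,z;z^6,z^2],\ [1,z^4;z^2,z^2],\ [z^3,z^5;z^3,1],\ [z^5,z^4;z^2,z^4],\ [z^2,0;0,z^5]\},$$ $D_2=D_1^g$, $D_3=D_1^{g^2}$, $$D_4=\{\mathbb 1,\ [z^5,0;z^6,z^2],\ [z,z^6;z^4,1],\ [z^5,z^2;z^5,0],\ [z^3,z^4;z^6,z^5],\ [1,1;z^3,z],\ [1,z;1,z^3],\ [z,z^2;1,z^5],\ [z,0;z,z^6]\},$$ $D_5=D_4^g$, $D_6=D_4^{g^2}$, and $\mathcal D=\{D_1,\dots,D_6\}$. Then $\mathbb{OU}:=\mathbb U_{C,\mathcal D}$ is an affine $\mathrm{SL}(2,8)$-unital. (b) Let $D_1'=D_1$, $D_2'=D_2$, $D_3'=D_3$, $D_4'=D_4^f$, $D_5'=(D_4')^g$, $D_6'=(D_4')^{g^2}$ and $\mathcal D'=\{D_1',\dots,D_6'\}$. Then $\mathbb{PU}:=\mathbb U_{C,\mathcal D'}$ is an affine $\mathrm{SL}(2,8)$-unital. Moreover, the full stabilizers of the point $\mathbb 1$ in $\mathrm{Aut}(\mathbb{OU})$ and $\mathrm{Aut}(\mathbb{PU})$, respectively, are $$\mathrm{Aut}(\mathbb{OU})_{\mathbb 1}=\mathrm{Aut}(\mathbb{PU})_{\mathbb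 1}=\langle\gamma_g\rangle\rtimes L=\langle\gamma_g\rangle\rtimes\langle\varphi\rangle\cong C_9\rtimes C_3,$$ and the full automorphism groups $$\mathrm{Aut}(\mathbb{OU})=\mathrm{Aut}(\mathbb{PU})=(\langle\gamma_g\rangle\rtimes L)\ltimes R$$ have index $2$ in $\mathrm{Aut}(\mathbb U_{C,\mathcal H})$.
   Context: Field and matrices: $\mathbb F_8^\times=\langle z\rangle$ with $z^3=z+1$. Write $[a,b;c,d]$ for the $2\times2$ matrix with rows $(a,b)$ and $(c,d)$; $\mathbb 1=[1,0;0,1]$. Let $\varphi:x\mapsto x^2$ be the Frobenius automorphism of $\mathbb F_8$, acting entrywise on matrices, $D\cdot\varphi$ the image of a set $D$ of matrices, and $L=\langle\varphi\rangle\cong C_3$. Maps act from the right. For $x\in\mathrm{SL}(2,8)$, $\gamma_x$ denotes conjugation $h\mapsto h^x:=x^{-1}hx$, and $D^x=x^{-1}Dx$ for subsets $D$. $C_n$ denotes a cyclic group of order $n$. Affine $\mathrm{SL}(2,8)$-unitals: Let $S\le\mathrm{SL}(2,8)$ be a subgroup of order $9$ and $T$ a Sylow $2$-subgroup of $\mathrm{SL}(2,8)$ (of order $8$; it has $9$ conjugates $T^h=h^{-1}Th$). Let $\mathcal D$ be a collection of subsets of $\mathrm{SL}(2,8)$, each containing $\mathbb 1$ and having exactly $9$ elements, such that: (Q) for each $D\in\mathcal D$ the map $(x,y)\mapsto xy^{-1}$ on pairs $(x,y)\in D\times D$ with $x\ne y$ is injective, i.e. $D^*:=\{xy^{-1}\mid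 x,y\in D,\ x\neq y\}$ has $72$ elements; (P) the system consisting of $S\setminus\{\mathbb 1\}$, all conjugates of $T\setminus\{\mathbb 1\}$ and all sets $D^*$ ($D\in\mathcal D$) is a partition of $\mathrm{SL}(2,8)\setminus\{\mathbb 1\}$. Then the incidence structure $\mathbb U_{S,\mathcal D}$ with point set $\mathrm{SL}(2,8)$, block set $\{Sx\mid x\in \mathrm{SL}(2,8)\}\cup\{T^hx\mid h,x\in \mathrm{SL}(2,8)\}\cup\{Dx\mid D\in\mathcal D,\ x\in \mathrm{SL}(2,8)\}$ and containment as incidence is called an affine $\mathrm{SL}(2,8)$-unital. Automorphisms: $\mathrm{Aut}(\mathbb U_{S,\mathcal D})$ is the group of bijections of the point set leaving the block set invariant. $R=\{\rho_h\mid h\in\mathrm{SL}(2,8)\}$, where $\rho_h$ is right multiplication by $h$. Classical affine unital of order $8$: $\mathbb U_{C,\mathcal H}$, where $C=\langle g\rangle$ and $\mathcal H=\{H_1,\dots,H_6\}$ with $H_1=\{\mathbb 1,[z^5,1;z^5,z^6],[z^4,z^2;1,z^2],[0,z;z^6,z^5],[z^3,z^6;z^4,z^5],[z^3,z;z^6,0],[1,z^2;1,z^6],[z^4,1;z^5,1],[z^5,0;0,z^2]\}$, $H_2=H_1\cdot\varphi$, $H_3=H_1\cdot\varphi^2$, $H_4=\{\mathbb 1,[z^5,0;z^6,z^2],[z,z^6;z^4,1],[1,z^5;z^6,z^5],[z,z^4;0,z^6],[z^5,z^2;z^4,z^4],[0,z^2;z^5,z^5],[0,z^4;z^3,z^4],[z^2,z^5;z^5,z^6]\}$,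 $H_5=H_4\cdot\varphi$, $H_6=H_4\cdot\varphi^2$. Its automorphism group is $\mathfrak A_C\ltimes R$, where $\mathfrak A_C$ is the group of all automorphisms $\alpha$ of the group $\mathrm{SL}(2,8)$ with $C\cdot\alpha=C$. *)

theory Defs
  imports
    "HOL-Analysis.Determinants"
    "HOL-Algebra.Bij"
    "HOL-Algebra.Coset"
    "HOL-Algebra.Generated_Groups"
    "HOL-Algebra.Elementary_Groups"
    "HOL-Algebra.Group_Action"
    "HOL-Computational_Algebra.Primes"
    "HOL-Library.Disjoint_Sets"
begin

section \<open>Group-theoretic notions\<close>

definition sylow_subgroup :: "nat \<Rightarrow> ('a, 'b) monoid_scheme \<Rightarrow> 'a set \<Rightarrow> bool" where
  "sylow_subgroup p G P \<longleftrightarrow> subgroup P G \<and> card P = p ^ multiplicity p (order G)"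

definition conj_by :: "('a, 'b) monoid_scheme \<Rightarrow> 'a \<Rightarrow> 'a \<Rightarrow> 'a" where
  "conj_by G x h = inv\<^bsub>G\<^esub> x \<otimes>\<^bsub>G\<^esub> h \<otimes>\<^bsub>G\<^esub> x"

definition conj_set :: "('a, 'b) monoid_scheme \<Rightarrow> 'a set \<Rightarrow> 'a \<Rightarrow> 'a set" where
  "conj_set G D x = conj_by G x ` D"

text \<open>
  The maps \<open>\<gamma>\<^sub>x\<close> and \<open>\<rho>\<^sub>h\<close> as elements of \<^const>\<open>BijGroup\<close>, whose elements are extensional
  functions.  The multiplication of \<^const>\<open>BijGroup\<close> is composition of functions written on
  the left, i.e. the opposite of the multiplication obtained when maps act from the right; generated
  subgroups, normality, complements, indices and isomorphism types are the same for both.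
\<close>

definition conj_map :: "('a, 'b) monoid_scheme \<Rightarrow> 'a \<Rightarrow> 'a \<Rightarrow> 'a" where
  "conj_map G x = restrict (conj_by G x) (carrier G)"

definition right_mult_map :: "('a, 'b) monoid_scheme \<Rightarrow> 'a \<Rightarrow> 'a \<Rightarrow> 'a" where
  "right_mult_map G h = (\<lambda>x\<in>carrier G. x \<otimes>\<^bsub>G\<^esub> h)"

definition internal_semidirect ::
    "('a, 'b) monoid_scheme \<Rightarrow> 'a set \<Rightarrow> 'a set \<Rightarrow> bool" where
  "internal_semidirect G N K \<longleftrightarrow>
     N \<lhd> G \<and> subgroup K G \<and> N \<inter> K = {\<one>\<^bsub>G\<^esub>} \<and> N <#>\<^bsub>G\<^esub> K = carrier G"

text \<open>Only meaningful when \<open>\<theta>\<close> is a homomorphism from \<open>K\<close> to \<^term>\<open>AutoGroup N\<close>.\<close>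

definition semidirect_product ::
    "('a, 'c) monoid_scheme \<Rightarrow> ('b, 'd) monoid_scheme \<Rightarrow> ('b \<Rightarrow> 'a \<Rightarrow> 'a) \<Rightarrow> ('a \<times> 'b) monoid" where
  "semidirect_product N K \<theta> =
     \<lparr>carrier = carrier N \<times> carrier K,
      mult = (\<lambda>(n, k) (n', k'). (n \<otimes>\<^bsub>N\<^esub> \<theta> k n', k \<otimes>\<^bsub>K\<^esub> k')),
      one = (\<one>\<^bsub>N\<^esub>, \<one>\<^bsub>K\<^esub>)\<rparr>"

definition subgroup_index :: "('a, 'b) monoid_scheme \<Rightarrow> 'a set \<Rightarrow> nat" where
  "subgroup_index G H = card (rcosets\<^bsub>G\<^esub> H)"


section \<open>Incidence structures with containment as incidence\<close>

record 'p incidence_structure =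
  points :: "'p set"
  blocks :: "'p set set"

definition Aut_group :: "'p incidence_structure \<Rightarrow> ('p \<Rightarrow> 'p) monoid" where
  "Aut_group U = BijGroup (points U)
     \<lparr>carrier := {\<alpha> \<in> Bij (points U). (\<lambda>B. \<alpha> ` B) ` blocks U = blocks U}\<rparr>"


section \<open>\<open>SL(2,F)\<close> and affine \<open>SL(2,8)\<close>-unitals\<close>

definition mat2 :: "'a::zero \<Rightarrow> 'a \<Rightarrow> 'a \<Rightarrow> 'a \<Rightarrow> 'a^2^2" where
  "mat2 a b c d = vector [vector [a, b], vector [c, d]]"

text \<open>This is \<open>SL(2,8)\<close> when the field type has exactly 8 elements.\<close>

definition SL2 :: "('a::field^2^2) monoid" where
  "SL2 = \<lparr>carrier = {A. det A = 1}, mult = (**), one = mat 1\<rparr>"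

definition frob_mat :: "'a::field^2^2 \<Rightarrow> 'a^2^2" where
  "frob_mat A = (\<chi> i j. (A $ i $ j)\<^sup>2)"

definition frob_map :: "'a::field^2^2 \<Rightarrow> 'a^2^2" where
  "frob_map = restrict frob_mat (carrier SL2)"

definition quotients :: "('a::field^2^2) set \<Rightarrow> ('a^2^2) set" where
  "quotients D = {x \<otimes>\<^bsub>SL2\<^esub> inv\<^bsub>SL2\<^esub> y | x y. x \<in> D \<and> y \<in> D \<and> x \<noteq> y}"

definition unital ::
    "('a::field^2^2) set \<Rightarrow> ('a^2^2) set \<Rightarrow> ('a^2^2) set set \<Rightarrow> ('a^2^2) incidence_structure" where
  "unital S T \<D> =
     \<lparr>points = carrier SL2,
      blocks = {S #>\<^bsub>SL2\<^esub> x | x. x \<in> carrier SL2}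
        \<union> {conj_set SL2 T h #>\<^bsub>SL2\<^esub> x | h x. h \<in> carrier SL2 \<and> x \<in> carrier SL2}
        \<union> {D #>\<^bsub>SL2\<^esub> x | D x. D \<in> \<D> \<and> x \<in> carrier SL2}\<rparr>"

text \<open>
  \<open>affine_SL28_unital S T \<D>\<close> says that \<open>S\<close>, \<open>T\<close> and \<open>\<D>\<close> satisfy the conditions under which
  \<open>unital S T \<D>\<close> is an affine \<open>SL(2,8)\<close>-unital; the last two conjuncts are the partition
  condition.  There the sets \<open>D\<^sup>*\<close> form a family indexed by \<open>\<D>\<close>, so distinct members of \<open>\<D>\<close> have
  distinct (hence disjoint) sets \<open>D\<^sup>*\<close>; a plain set of sets would not record this.
\<close>

definition affine_SL28_unital ::
    "('a::field^2^2) set \<Rightarrow> ('a^2^2) set \<Rightarrow> ('a^2^2) set set \<Rightarrow> bool" where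
  "affine_SL28_unital S T \<D> \<longleftrightarrow>
     CARD('a) = 8 \<and>
     subgroup S SL2 \<and> card S = 9 \<and>
     sylow_subgroup 2 SL2 T \<and>
     (\<forall>D\<in>\<D>. D \<subseteq> carrier SL2 \<and> \<one>\<^bsub>SL2\<^esub> \<in> D \<and> card D = 9) \<and>
     (\<forall>D\<in>\<D>. inj_on (\<lambda>(x, y). x \<otimes>\<^bsub>SL2\<^esub> inv\<^bsub>SL2\<^esub> y) {(x, y). x \<in> D \<and> y \<in> D \<and> x \<noteq> y}) \<and>
     partition_on (carrier SL2 - {\<one>\<^bsub>SL2\<^esub>})
       ({S - {\<one>\<^bsub>SL2\<^esub>}}
        \<union> {conj_set SL2 (T - {\<one>\<^bsub>SL2\<^esub>}) h | h. h \<in> carrier SL2}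
        \<union> quotients ` \<D>) \<and>
     inj_on quotients \<D>"


section \<open>The specific subsets; \<open>z\<close> is the chosen generator of the multiplicative group\<close>

definition g_mat :: "'a::field \<Rightarrow> 'a^2^2" where
  "g_mat z = mat2 (z^2) (z^4) (z^4) z"

definition f_mat :: "'a::field^2^2" where
  "f_mat = mat2 0 1 1 0"

definition C_grp :: "'a::field \<Rightarrow> ('a^2^2) set" where
  "C_grp z = generate SL2 {g_mat z}"

definition H1 :: "'a::field \<Rightarrow> ('a^2^2) set" where
  "H1 z =
     {\<one>\<^bsub>SL2\<^esub>, mat2 (z^5) 1 (z^5) (z^6),
      mat2 (z^4) (z^2) 1 (z^2), mat2 0 z (z^6) (z^5),
      mat2 (z^3) (z^6) (z^4) (z^5), mat2 (z^3) z (z^6) 0,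
      mat2 1 (z^2) 1 (z^6), mat2 (z^4) 1 (z^5) 1,
      mat2 (z^5) 0 0 (z^2)}"

definition H4 :: "'a::field \<Rightarrow> ('a^2^2) set" where
  "H4 z =
     {\<one>\<^bsub>SL2\<^esub>, mat2 (z^5) 0 (z^6) (z^2),
      mat2 z (z^6) (z^4) 1, mat2 1 (z^5) (z^6) (z^5),
      mat2 z (z^4) 0 (z^6), mat2 (z^5) (z^2) (z^4) (z^4),
      mat2 0 (z^2) (z^5) (z^5), mat2 0 (z^4) (z^3) (z^4),
      mat2 (z^2) (z^5) (z^5) (z^6)}"

definition H_family :: "'a::field \<Rightarrow> ('a^2^2) set set" where
  "H_family z =
     {H1 z, frob_mat ` H1 z, (frob_mat ^^ 2) ` H1 z,
      H4 z, frob_mat ` H4 z, (frob_mat ^^ 2) ` H4 z}"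

definition D1 :: "'a::field \<Rightarrow> ('a^2^2) set" where
  "D1 z =
     {\<one>\<^bsub>SL2\<^esub>, mat2 (z^5) 1 (z^5) (z^6),
      mat2 (z^4) (z^2) 1 (z^2), mat2 1 z (z^6) 0,
      mat2 0 z (z^6) (z^2), mat2 1 (z^4) (z^2) (z^2),
      mat2 (z^3) (z^5) (z^3) 1, mat2 (z^5) (z^4) (z^2) (z^4),
      mat2 (z^2) 0 0 (z^5)}"

definition D4 :: "'a::field \<Rightarrow> ('a^2^2) set" where
  "D4 z =
     {\<one>\<^bsub>SL2\<^esub>, mat2 (z^5) 0 (z^6) (z^2),
      mat2 z (z^6) (z^4) 1, mat2 (z^5) (z^2) (z^5) 0,
      mat2 (z^3) (z^4) (z^6) (z^5), mat2 1 1 (z^3) z,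
      mat2 1 z 1 (z^3), mat2 z (z^2) 1 (z^5),
      mat2 z 0 z (z^6)}"

definition D_family :: "'a::field \<Rightarrow> ('a^2^2) set set" where
  "D_family z =
     {D1 z, conj_set SL2 (D1 z) (g_mat z), conj_set SL2 (D1 z) (g_mat z [^]\<^bsub>SL2\<^esub> (2::nat)),
      D4 z, conj_set SL2 (D4 z) (g_mat z), conj_set SL2 (D4 z) (g_mat z [^]\<^bsub>SL2\<^esub> (2::nat))}"

definition D4' :: "'a::field \<Rightarrow> ('a^2^2) set" where
  "D4' z = conj_set SL2 (D4 z) f_mat"

definition D'_family :: "'a::field \<Rightarrow> ('a^2^2) set set" where
  "D'_family z =
     {D1 z, conj_set SL2 (D1 z) (g_mat z), conj_set SL2 (D1 z) (g_mat z [^]\<^bsub>SL2\<^esub> (2::nat)),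
      D4' z, conj_set SL2 (D4' z) (g_mat z), conj_set SL2 (D4' z) (g_mat z [^]\<^bsub>SL2\<^esub> (2::nat))}"

text \<open>
  The three unitals; \<open>T\<close> is a Sylow 2-subgroup of \<open>SL(2,8)\<close>, of which the structures depend only
  through its conjugacy class.
\<close>

definition OU :: "'a::field \<Rightarrow> ('a^2^2) set \<Rightarrow> ('a^2^2) incidence_structure" where
  "OU z T = unital (C_grp z) T (D_family z)"

definition PU :: "'a::field \<Rightarrow> ('a^2^2) set \<Rightarrow> ('a^2^2) incidence_structure" where
  "PU z T = unital (C_grp z) T (D'_family z)"

definition classical_unital :: "'a::field \<Rightarrow> ('a^2^2) set \<Rightarrow> ('a^2^2) incidence_structure" where
  "classical_unital z T = unital (C_grp z) T (H_family z)"

text \<open>The subgroups \<open>\<langle>\<gamma>\<^sub>g\<rangle>\<close>, \<open>L\<close> and \<open>R\<close> of the group of all permutations of \<open>SL(2,8)\<close>.\<close>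

definition Gamma_grp :: "'a::field \<Rightarrow> ('a^2^2 \<Rightarrow> 'a^2^2) set" where
  "Gamma_grp z = generate (BijGroup (carrier SL2)) {conj_map SL2 (g_mat z)}"

definition L_grp :: "('a::field^2^2 \<Rightarrow> 'a^2^2) set" where
  "L_grp = generate (BijGroup (carrier SL2)) {frob_map}"

definition R_grp :: "('a::field^2^2 \<Rightarrow> 'a^2^2) set" where
  "R_grp = right_mult_map SL2 ` carrier SL2"

definition point_stabilizer :: "'p incidence_structure \<Rightarrow> 'p \<Rightarrow> ('p \<Rightarrow> 'p) monoid" where
  "point_stabilizer U p = Aut_group U \<lparr>carrier := stabilizer (Aut_group U) (\<lambda>\<alpha>. \<alpha>) p\<rparr>"

end

theory Submission
  imports Defs "HOL-Algebra.Multiplicative_Group"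
begin

text \<open>
  The short blocks \<open>P x\<close> (\<open>P\<close> a Sylow 2-subgroup) are the blocks of size 8, so every automorphism
  preserves them.  Label \<open>P x\<close> by the pair \<open>(P, P\<^sup>x)\<close>.  Two short blocks have the same label iff they are
  equal or no short block meets both, hence automorphisms permute the labels, and they preserve the
  relation of differing in both coordinates.  An automorphism \<open>\<alpha>\<close> fixing \<open>1\<close> thus acts on the
  9 \<open>\<times>\<close> 9 grid of labels through a permutation of the Sylow subgroups, possibly composed with the
  swap of the coordinates.  As the labels of the short blocks through \<open>x\<close> are the graph of the
  faithful action of \<open>x\<close> on the Sylow subgroups, \<open>\<alpha>\<close> is an automorphism or an anti-automorphism of the group.

  Since \<open>C\<close> is the only subgroup among the blocks of size 9 and is not normal, anti-automorphisms are
  excluded and \<open>\<alpha>\<close> maps \<open>C\<close> to itself.  Conjugation by \<open>f\<close> and powers of Frobenius induce all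
  automorphisms of \<open>C\<close>, and an automorphism centralizing \<open>C\<close>, which is regular on the Sylow subgroups,
  is conjugation by an element of \<open>C\<close>.  So the stabilizer of \<open>1\<close> lies in a group of order 54, and it is
  determined by whether conjugation by \<open>f\<close> is an automorphism of the unital.
\<close>

section \<open>Geometries of cosets\<close>

text \<open>A search among the permutations of 504 points is out of reach, but the short blocks are
  the same in every affine SL(2,8)-unital, whatever the collection of 9-element sets is. The passage
  from permutations to group automorphisms therefore uses short blocks only, and the concrete sets
  enter through finite checks. The grid argument rests on the action of SL(2,8) on its 9 Sylow
  2-subgroups, that is, on the projective line over the field with 8 elements: it is faithful and
  two-transitive, and normalizers are visible in the incidence of short blocks. The automorphism
  group of the classical unital is not presupposed. Its family is also checked for (Q) and (P), so
  that the same bound on the stabilizer of 1 applies to it; conjugation by f preserves this unital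
  and neither of the other two, whence the index 2. The field is an arbitrary type with eight
  elements. Statements about particular matrices are evaluated on constructors and carried over by
  the bijection \<open>val8\<close>.\<close>

context group
begin

lemma inv_l_cancel [simp]:
  "x \<in> carrier G \<Longrightarrow> y \<in> carrier G \<Longrightarrow> inv x \<otimes> (x \<otimes> y) = y"
  by (simp flip: m_assoc)

lemma inv_r_cancel [simp]:
  "x \<in> carrier G \<Longrightarrow> y \<in> carrier G \<Longrightarrow> x \<otimes> (inv x \<otimes> y) = y"
  by (simp flip: m_assoc)

lemma conj_by_closed [simp]: "x \<in> carrier G \<Longrightarrow> h \<in> carrier G \<Longrightarrow> conj_by G x h \<in> carrier G"
  by (simp add: conj_by_def)

lemma conj_by_one [simp]: "h \<in> carrier G \<Longrightarrow> conj_by G \<one> h = h"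
  by (simp add: conj_by_def)

lemma conj_by_conj_by:
  "\<lbrakk>x \<in> carrier G; y \<in> carrier G; h \<in> carrier G\<rbrakk> \<Longrightarrow> conj_by G y (conj_by G x h) = conj_by G (x \<otimes> y) h"
  by (simp add: conj_by_def inv_mult_group m_assoc)

lemma conj_by_mult:
  "\<lbrakk>x \<in> carrier G; h \<in> carrier G; k \<in> carrier G\<rbrakk>
     \<Longrightarrow> conj_by G x (h \<otimes> k) = conj_by G x h \<otimes> conj_by G x k"
  by (simp add: conj_by_def m_assoc)

lemma conj_set_closed:
  "D \<subseteq> carrier G \<Longrightarrow> x \<in> carrier G \<Longrightarrow> conj_set G D x \<subseteq> carrier G"
  by (auto simp: conj_set_def)

lemma conj_set_conj_set:
  "\<lbrakk>D \<subseteq> carrier G; x \<in> carrier G; y \<in> carrier G\<rbrakk>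
     \<Longrightarrow> conj_set G (conj_set G D x) y = conj_set G D (x \<otimes> y)"
  unfolding conj_set_def image_image by (rule image_cong) (auto simp: conj_by_conj_by)

lemma conj_set_one: "D \<subseteq> carrier G \<Longrightarrow> conj_set G D \<one> = D"
  by (force simp: conj_set_def)

lemma conj_set_inv_eq:
  assumes "D \<subseteq> carrier G" "x \<in> carrier G" "conj_set G D x = E"
  shows "conj_set G E (inv x) = D"
  using assms by (auto simp: conj_set_conj_set conj_set_one)

end

text \<open>Only incidence with members of \<open>L\<close> enters, so every bijection permuting
  \<open>L\<close> preserves the relation. Distinct intersecting members of \<open>L\<close> are
  never parallel: a common point is joined to itself by either of them.\<close>

definition parallel :: "'a set set \<Rightarrow> 'a set \<Rightarrow> 'a set \<Rightarrow> bool" where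
  "parallel L l m \<longleftrightarrow> l = m \<or> \<not> (\<exists>x\<in>l. \<exists>y\<in>m. \<exists>k\<in>L. x \<in> k \<and> y \<in> k)"

text \<open>Two short blocks P x and Q x through x have labels (P, P^x) and (Q, Q^x), which differ
  in both coordinates if P and Q differ. Intersecting representatives of the two parallel classes
  thus express that the labels share no coordinate.\<close>

definition opposite :: "'a set set \<Rightarrow> 'a set \<Rightarrow> 'a set \<Rightarrow> bool" where
  "opposite L l m \<longleftrightarrow>
     (\<exists>l'\<in>L. \<exists>m'\<in>L. parallel L l' l \<and> parallel L m' m \<and> l' \<noteq> m' \<and> l' \<inter> m' \<noteq> {})"

lemma parallel_image:
  assumes inj: "inj_on \<alpha> S" and sub: "\<forall>l\<in>L. l \<subseteq> S" and im: "(`) \<alpha> ` L = L"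
    and l: "l \<in> L" and m: "m \<in> L"
  shows "parallel L (\<alpha> ` l) (\<alpha> ` m) \<longleftrightarrow> parallel L l m"
proof -
  have mem: "\<alpha> x \<in> \<alpha> ` k \<longleftrightarrow> x \<in> k" if "x \<in> S" "k \<in> L" for x k
    using inj sub that by (meson inj_on_image_mem_iff)
  have coll: "(\<exists>k\<in>L. \<alpha> x \<in> k \<and> \<alpha> y \<in> k) \<longleftrightarrow> (\<exists>k\<in>L. x \<in> k \<and> y \<in> k)" if "x \<in> S" "y \<in> S" for x y
  proof -
    have "(\<exists>k\<in>L. \<alpha> x \<in> k \<and> \<alpha> y \<in> k) \<longleftrightarrow> (\<exists>k\<in>(`) \<alpha> ` L. \<alpha> x \<in> k \<and> \<alpha> y \<in> k)"
      using im by simp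
    also have "\<dots> \<longleftrightarrow> (\<exists>k\<in>L. x \<in> k \<and> y \<in> k)"
      using mem that by auto
    finally show ?thesis .
  qed
  have "\<alpha> ` l = \<alpha> ` m \<longleftrightarrow> l = m"
    using inj sub l m by (meson inj_on_image_eq_iff)
  moreover have "(\<exists>x\<in>l. \<exists>y\<in>m. \<exists>k\<in>L. \<alpha> x \<in> k \<and> \<alpha> y \<in> k) \<longleftrightarrow> (\<exists>x\<in>l. \<exists>y\<in>m. \<exists>k\<in>L. x \<in> k \<and> y \<in> k)"
    using coll bspec[OF sub l] bspec[OF sub m] by (meson subsetD)
  ultimately show ?thesis
    unfolding parallel_def by simp
qed

lemma opposite_image:
  assumes inj: "inj_on \<alpha> S" and sub: "\<forall>l\<in>L. l \<subseteq> S" and im: "(`) \<alpha> ` L = L"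
    and l: "l \<in> L" and m: "m \<in> L"
  shows "opposite L (\<alpha> ` l) (\<alpha> ` m) \<longleftrightarrow> opposite L l m"
proof -
  note par = parallel_image[OF inj sub im]
  have eq: "\<alpha> ` k = \<alpha> ` k' \<longleftrightarrow> k = k'" and int: "\<alpha> ` k \<inter> \<alpha> ` k' = {} \<longleftrightarrow> k \<inter> k' = {}"
    if "k \<in> L" "k' \<in> L" for k k'
    using inj sub that by (meson inj_on_image_eq_iff)
      (metis inj_on_image_Int[OF inj bspec[OF sub that(1)] bspec[OF sub that(2)]] image_is_empty)
  have "opposite L (\<alpha> ` l) (\<alpha> ` m) \<longleftrightarrow>
     (\<exists>l'\<in>(`) \<alpha> ` L. \<exists>m'\<in>(`) \<alpha> ` L. parallel L l' (\<alpha> ` l) \<and> parallel L m' (\<alpha> ` m) \<and> l' \<noteq> m' \<and> l' \<inter> m' \<noteq> {})"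
    unfolding opposite_def im ..
  also have "\<dots> \<longleftrightarrow> opposite L l m"
    unfolding opposite_def using par l m eq int by auto
  finally show ?thesis .
qed

text \<open>The assumptions are properties of the Sylow 2-subgroups of SL(2,8).
  \<open>PP_norm\<close> links normalizers with incidence: outside P, the elements y normalizing P
  are those whose coset y P misses the union of \<open>PP\<close>. In SL(2,8) this union is the set
  of elements of trace 0. \<open>PP_third\<close> leaves room to move between labels without
  touching the diagonal.\<close>

locale coset_geometry = group G for G (structure) +
  fixes PP :: "'a set set"
  assumes PP_subgroup: "P \<in> PP \<Longrightarrow> subgroup P G"
    and PP_conj: "P \<in> PP \<Longrightarrow> x \<in> carrier G \<Longrightarrow> conj_set G P x \<in> PP"
    and PP_norm: "P \<in> PP \<Longrightarrow> y \<in> carrier G \<Longrightarrow> y \<notin> P \<Longrightarrow>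
      conj_set G P y = P \<longleftrightarrow> (\<forall>u\<in>P. y \<otimes> inv u \<notin> \<Union>PP)"
    and PP_trans2: "\<lbrakk>P \<in> PP; P' \<in> PP; P \<noteq> P'; Q \<in> PP; Q' \<in> PP; Q \<noteq> Q'\<rbrakk> \<Longrightarrow>
      \<exists>x\<in>carrier G. conj_set G P x = Q \<and> conj_set G P' x = Q'"
    and PP_faithful: "x \<in> carrier G \<Longrightarrow> (\<And>P. P \<in> PP \<Longrightarrow> conj_set G P x = P) \<Longrightarrow> x = \<one>"
    and PP_self_norm: "\<lbrakk>P \<in> PP; Q \<in> PP; \<And>y. y \<in> Q \<Longrightarrow> conj_set G P y = P\<rbrakk> \<Longrightarrow> Q = P"
    and PP_third: "\<exists>R\<in>PP. R \<noteq> P \<and> R \<noteq> Q"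
begin

definition lines :: "'a set set" where
  "lines = {P #> x | P x. P \<in> PP \<and> x \<in> carrier G}"

text \<open>In a block P x the quotients a b^-1 form P and the quotients a^-1 b form P^x, so both
  coordinates of the label are read off without choosing a representative x.\<close>

definition source :: "'a set \<Rightarrow> 'a set" where
  "source l = {a \<otimes> inv b | a b. a \<in> l \<and> b \<in> l}"

definition target :: "'a set \<Rightarrow> 'a set" where
  "target l = {inv a \<otimes> b | a b. a \<in> l \<and> b \<in> l}"

lemma PP_sub: "P \<in> PP \<Longrightarrow> P \<subseteq> carrier G"
  using PP_subgroup subgroup.subset by blast

lemma PP_mem [simp]: "P \<in> PP \<Longrightarrow> p \<in> P \<Longrightarrow> p \<in> carrier G"
  using PP_sub by blast

lemma line_sub: "l \<in> lines \<Longrightarrow> l \<subseteq> carrier G"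
  unfolding lines_def using PP_sub r_coset_subset_G by blast

lemma linesI: "P \<in> PP \<Longrightarrow> x \<in> carrier G \<Longrightarrow> P #> x \<in> lines"
  by (auto simp: lines_def)

lemma PP_line: "P \<in> PP \<Longrightarrow> P \<in> lines"
  using linesI[of P \<one>] PP_sub coset_mult_one by fastforce

lemma source_coset:
  assumes "P \<in> PP" "x \<in> carrier G" shows "source (P #> x) = P"
proof -
  interpret P: subgroup P G using PP_subgroup assms by blast
  have *: "(p \<otimes> x) \<otimes> inv (q \<otimes> x) = p \<otimes> inv q" if "p \<in> P" "q \<in> P" for p q
    using that assms by (simp add: inv_mult_group m_assoc)
  show ?thesis
  proof
    show "source (P #> x) \<subseteq> P"
      unfolding source_def r_coset_def using * by auto
    show "P \<subseteq> source (P #> x)"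
    proof
      fix p assume "p \<in> P"
      then have "p = (p \<otimes> x) \<otimes> inv (\<one> \<otimes> x)" using *[of p \<one>] by simp
      with \<open>p \<in> P\<close> show "p \<in> source (P #> x)"
        unfolding source_def r_coset_def using P.one_closed by blast
    qed
  qed
qed

lemma target_coset:
  assumes "P \<in> PP" "x \<in> carrier G" shows "target (P #> x) = conj_set G P x"
proof -
  interpret P: subgroup P G using PP_subgroup assms by blast
  have *: "inv (p \<otimes> x) \<otimes> (q \<otimes> x) = conj_by G x (inv p \<otimes> q)" if "p \<in> P" "q \<in> P" for p q
    using that assms by (simp add: conj_by_def inv_mult_group m_assoc)
  show ?thesis
  proof
    show "target (P #> x) \<subseteq> conj_set G P x"
      unfolding target_def r_coset_def conj_set_def using * by auto
    show "conj_set G P x \<subseteq> target (P #> x)"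
    proof
      fix h assume "h \<in> conj_set G P x"
      then obtain p where p: "p \<in> P" "h = conj_by G x p" by (auto simp: conj_set_def)
      then have "h = inv (\<one> \<otimes> x) \<otimes> (p \<otimes> x)" using *[of \<one> p] by simp
      with p(1) show "h \<in> target (P #> x)"
        unfolding target_def r_coset_def using P.one_closed by blast
    qed
  qed
qed

lemma line_source:
  assumes "l \<in> lines" "x \<in> l"
  shows "source l \<in> PP" "l = source l #> x" "target l = conj_set G (source l) x"
proof -
  obtain P y where P: "P \<in> PP" "y \<in> carrier G" "l = P #> y"
    using assms by (auto simp: lines_def)
  have l: "l = P #> x"
    using P assms(2) PP_subgroup repr_independence by blast
  have x: "x \<in> carrier G"
    using assms line_sub by blast
  show "source l \<in> PP" "l = source l #> x" "target l = conj_set G (source l) x"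
    using source_coset[OF P(1) x] target_coset[OF P(1) x] l P by auto
qed

lemma line_nonempty: "l \<in> lines \<Longrightarrow> \<exists>x. x \<in> l"
  unfolding lines_def using PP_subgroup rcos_self by blast

lemma target_PP: "l \<in> lines \<Longrightarrow> target l \<in> PP"
  by (metis line_nonempty line_source PP_conj line_sub subsetD)

lemma line_through_one: "l \<in> lines \<Longrightarrow> \<one> \<in> l \<Longrightarrow> l \<in> PP \<and> source l = l \<and> target l = l"
  using line_source[of l \<one>] PP_sub coset_mult_one conj_set_one by fastforce

lemma PP_source_target: "P \<in> PP \<Longrightarrow> source P = P \<and> target P = P"
  using line_through_one PP_line PP_subgroup subgroup.one_closed by blast

lemma collinear_iff:
  assumes "x \<in> carrier G" "y \<in> carrier G"
  shows "(\<exists>k\<in>lines. x \<in> k \<and> y \<in> k) \<longleftrightarrow> x \<otimes> inv y \<in> \<Union>PP"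
proof
  assume "\<exists>k\<in>lines. x \<in> k \<and> y \<in> k"
  then obtain k where k: "k \<in> lines" "x \<in> k" "y \<in> k" by blast
  then have "x \<otimes> inv y \<in> source k" by (auto simp: source_def)
  then show "x \<otimes> inv y \<in> \<Union>PP" using line_source(1)[OF k(1,2)] by blast
next
  assume "x \<otimes> inv y \<in> \<Union>PP"
  then obtain P where P: "P \<in> PP" "x \<otimes> inv y \<in> P" by blast
  then have "x \<in> P #> y"
    unfolding r_coset_def using assms by (auto intro!: bexI[of _ "x \<otimes> inv y"] simp: m_assoc)
  moreover have "y \<in> P #> y"
    using P PP_subgroup rcos_self assms by blast
  ultimately show "\<exists>k\<in>lines. x \<in> k \<and> y \<in> k"
    using linesI P assms by blast
qed

text \<open>Write the blocks as P x and Q y and put w = y x^-1. The points u x and v y lie on a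
  common short block iff v w u^-1 lies in the union of \<open>PP\<close>. If this never happens,
  \<open>PP_norm\<close> shows that v w normalizes P for every v in Q. With v = 1 it follows that w,
  and then all of Q, normalizes P, whence Q = P.\<close>

lemma parallel_iff:
  assumes l: "l \<in> lines" and m: "m \<in> lines"
  shows "parallel lines l m \<longleftrightarrow> source l = source m \<and> target l = target m"
proof -
  obtain x y where x: "x \<in> l" and y: "y \<in> m"
    using l m line_nonempty by blast
  define P where "P = source l"
  define Q where "Q = source m"
  have xy [simp]: "x \<in> carrier G" "y \<in> carrier G"
    using l m x y line_sub by blast+
  have P: "P \<in> PP" "l = P #> x" "target l = conj_set G P x"
    unfolding P_def using line_source[OF l x] by auto
  have Q: "Q \<in> PP" "m = Q #> y" "target m = conj_set G Q y"
    unfolding Q_def using line_source[OF m y] by auto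
  interpret P: subgroup P G using PP_subgroup P(1) .
  interpret Q: subgroup Q G using PP_subgroup Q(1) .
  define w where "w = y \<otimes> inv x"
  have w [simp]: "w \<in> carrier G" by (simp add: w_def)
  have tgt: "conj_set G P x = conj_set G P y \<longleftrightarrow> conj_set G P w = P"
  proof
    assume "conj_set G P x = conj_set G P y"
    then have "conj_set G (conj_set G P y) (inv x) = P"
      using P.subset by (metis conj_set_inv_eq xy(1))
    then show "conj_set G P w = P"
      using P.subset by (simp add: w_def conj_set_conj_set)
  next
    assume "conj_set G P w = P"
    then have "conj_set G P x = conj_set G P (w \<otimes> x)"
      using conj_set_conj_set[OF P.subset w xy(1)] by simp
    then show "conj_set G P x = conj_set G P y"
      by (simp add: w_def m_assoc)
  qed
  have eq: "(v \<otimes> y) \<otimes> inv (u \<otimes> x) = (v \<otimes> w) \<otimes> inv u" if "v \<in> Q" "u \<in> P" for u v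
    using that by (simp add: w_def inv_mult_group m_assoc)
  have nocoll: "\<not> (\<exists>x\<in>l. \<exists>y\<in>m. \<exists>k\<in>lines. x \<in> k \<and> y \<in> k) \<longleftrightarrow>
      (\<forall>u\<in>P. \<forall>v\<in>Q. (v \<otimes> w) \<otimes> inv u \<notin> \<Union>PP)"
  proof -
    have "(\<exists>k\<in>lines. u \<otimes> x \<in> k \<and> v \<otimes> y \<in> k) \<longleftrightarrow> (v \<otimes> w) \<otimes> inv u \<in> \<Union>PP"
      if "u \<in> P" "v \<in> Q" for u v
      using collinear_iff[of "v \<otimes> y" "u \<otimes> x"] that eq[OF that(2,1)] by auto
    then show ?thesis
      unfolding P(2) Q(2) r_coset_def by auto
  qed
  show ?thesis
  proof
    assume "parallel lines l m"
    then consider "l = m" | "\<forall>u\<in>P. \<forall>v\<in>Q. (v \<otimes> w) \<otimes> inv u \<notin> \<Union>PP"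
      unfolding parallel_def nocoll by blast
    then show "source l = source m \<and> target l = target m"
    proof cases
      case 2
      have fixP: "conj_set G P (v \<otimes> w) = P" if v: "v \<in> Q" for v
      proof -
        \<comment> \<open>Otherwise u = v w is admissible in \<open>2\<close> and gives the quotient
          1, which lies in every member of \<open>PP\<close>.\<close>
        have "v \<otimes> w \<notin> P"
        proof
          assume "v \<otimes> w \<in> P"
          then have "\<one> \<notin> \<Union>PP" using 2 v by (metis P.mem_carrier r_inv)
          then show False using P(1) P.one_closed by blast
        qed
        then show ?thesis
          using PP_norm[OF P(1), of "v \<otimes> w"] 2 v by simp
      qed
      from fixP[OF Q.one_closed] have Pw: "conj_set G P w = P" by simp
      have "conj_set G P v = P" if "v \<in> Q" for v
      proof -
        have v: "v \<in> carrier G" using that by simp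
        have "conj_set G (conj_set G P v) w = P"
          by (rule trans[OF conj_set_conj_set[OF P.subset v w] fixP[OF that]])
        then show ?thesis
          by (rule trans[OF conj_set_inv_eq[OF conj_set_closed[OF P.subset v] w, symmetric]
                conj_set_inv_eq[OF P.subset w Pw]])
      qed
      then have QP: "Q = P" using PP_self_norm P(1) Q(1) by blast
      moreover have "target l = target m"
        unfolding P(3) Q(3) QP using tgt Pw by blast
      ultimately show ?thesis
        by (simp only: P_def Q_def)
    qed simp
  next
    assume *: "source l = source m \<and> target l = target m"
    then have QP: "Q = P" by (simp only: P_def Q_def)
    have "conj_set G P x = conj_set G P y" using * P(3) Q(3) QP by simp
    then have Pw: "conj_set G P w = P" using tgt by blast
    show "parallel lines l m"
    proof (cases "w \<in> P")
      case True
      have "P #> y = P #> x"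
      proof -
        have "y = w \<otimes> x" by (simp add: w_def m_assoc)
        then have "y \<in> P #> x" using True by (auto simp: r_coset_def)
        then show ?thesis using repr_independence PP_subgroup P(1) by (metis xy(1))
      qed
      then show ?thesis using P(2) Q(2) QP by (simp add: parallel_def)
    next
      case False
      have "(v \<otimes> w) \<otimes> inv u \<notin> \<Union>PP" if "u \<in> P" "v \<in> P" for u v
      proof -
        have "v \<otimes> w \<notin> P"
          using False that by (metis P.m_inv_closed P.m_closed P.mem_carrier w inv_solve_left)
        moreover have "conj_set G P v = P"
          using that PP_source_target[OF P(1)] target_coset[OF P(1), of v] P.rcos_const[OF is_group, of v]
          by simp
        then have "conj_set G P (v \<otimes> w) = P"
          using Pw that P.subset by (metis conj_set_conj_set P.mem_carrier w)
        ultimately show ?thesis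
          using PP_norm[OF P(1), of "v \<otimes> w"] that by auto
      qed
      then show ?thesis
        unfolding parallel_def nocoll QP by blast
    qed
  qed
qed

text \<open>Distinct blocks through a point x have distinct sources and, conjugating by x, distinct
  targets. Conversely, two-transitivity supplies an x that takes the two sources to the two targets;
  the cosets of the sources by x then meet in x and have the given labels.\<close>

lemma opposite_iff:
  assumes l: "l \<in> lines" and m: "m \<in> lines"
  shows "opposite lines l m \<longleftrightarrow> source l \<noteq> source m \<and> target l \<noteq> target m"
proof
  assume "opposite lines l m"
  then obtain l' m' x where *: "l' \<in> lines" "m' \<in> lines" "parallel lines l' l" "parallel lines m' m"
      "l' \<noteq> m'" "x \<in> l'" "x \<in> m'"
    unfolding opposite_def by blast
  have x: "x \<in> carrier G" using * line_sub by blast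
  note l' = line_source[OF *(1,6)] and m' = line_source[OF *(2,7)]
  have "source l' \<noteq> source m'"
    using l'(2) m'(2) *(5) by metis
  moreover have "target l' \<noteq> target m'"
  proof
    assume "target l' = target m'"
    then have "conj_set G (source l') x = conj_set G (source m') x"
      using l'(3) m'(3) by simp
    then have "source l' = source m'"
      using conj_set_inv_eq[OF PP_sub[OF l'(1)] x] conj_set_inv_eq[OF PP_sub[OF m'(1)] x] by metis
    then show False using \<open>source l' \<noteq> source m'\<close> by blast
  qed
  ultimately show "source l \<noteq> source m \<and> target l \<noteq> target m"
    using * l m parallel_iff by metis
next
  assume ne: "source l \<noteq> source m \<and> target l \<noteq> target m"
  have PP: "source l \<in> PP" "source m \<in> PP" "target l \<in> PP" "target m \<in> PP"
    using l m target_PP line_nonempty line_source(1) by blast+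
  then obtain x where x: "x \<in> carrier G" "conj_set G (source l) x = target l" "conj_set G (source m) x = target m"
    using PP_trans2[of "source l" "source m" "target l" "target m"] ne by blast
  let ?l = "source l #> x" and ?m = "source m #> x"
  have "?l \<in> lines" "?m \<in> lines" using linesI PP x by auto
  moreover have "parallel lines ?l l" "parallel lines ?m m"
    using parallel_iff l m calculation source_coset target_coset PP x by auto
  moreover have "?l \<noteq> ?m"
    using source_coset PP x ne by metis
  moreover have "x \<in> ?l \<inter> ?m"
    using rcos_self PP_subgroup PP x by blast
  ultimately show "opposite lines l m"
    unfolding opposite_def by blast
qed

text \<open>Away from the diagonal, the labels \<open>(source l, target l)\<close> form a rook graph; an automorphism of
  it that preserves the diagonal either preserves or swaps the coordinates.\<close>

theorem line_automorphism:
  assumes bij: "bij_betw \<alpha> (carrier G) (carrier G)"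
    and im: "(`) \<alpha> ` lines = lines"
    and one: "\<alpha> \<one> = \<one>"
  shows "(\<forall>x\<in>carrier G. \<forall>y\<in>carrier G. \<alpha> (x \<otimes> y) = \<alpha> x \<otimes> \<alpha> y) \<or>
         (\<forall>x\<in>carrier G. \<forall>y\<in>carrier G. \<alpha> (x \<otimes> y) = \<alpha> y \<otimes> \<alpha> x)"
proof -
  have inj: "inj_on \<alpha> (carrier G)" using bij by (simp add: bij_betw_def)
  have closed: "\<alpha> x \<in> carrier G" if "x \<in> carrier G" for x
    using bij that by (auto simp: bij_betw_def)
  have im': "\<alpha> ` l \<in> lines" if "l \<in> lines" for l using im that by blast
  have sub: "\<forall>l\<in>lines. l \<subseteq> carrier G" using line_sub by blast
  note par = parallel_image[OF inj sub im] and opp = opposite_image[OF inj sub im]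
  have \<sigma>: "\<alpha> ` P \<in> PP" if "P \<in> PP" for P
    using line_through_one[OF im'[OF PP_line[OF that]]] one subgroup.one_closed[OF PP_subgroup[OF that]]
    by (metis image_eqI)
  have \<sigma>_inj: "\<alpha> ` P = \<alpha> ` Q \<longleftrightarrow> P = Q" if "P \<in> PP" "Q \<in> PP" for P Q
    using inj PP_sub that by (meson inj_on_image_eq_iff)
  have \<sigma>_surj: "\<exists>P\<in>PP. \<alpha> ` P = Q" if Q: "Q \<in> PP" for Q
  proof -
    obtain l where l: "l \<in> lines" "\<alpha> ` l = Q"
      using im PP_line[OF Q] by (metis imageE)
    obtain x where "x \<in> l" "\<alpha> x = \<alpha> \<one>"
      using l one subgroup.one_closed[OF PP_subgroup[OF Q]] by force
    then have "\<one> \<in> l"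
      using inj line_sub[OF l(1)] by (metis inj_onD one_closed subsetD)
    then show ?thesis using line_through_one l by blast
  qed
  have src: "source l \<in> PP" "target l \<in> PP" if "l \<in> lines" for l
    using that target_PP line_nonempty line_source(1) by blast+
  have dichotomy: "(source (\<alpha> ` l) = \<alpha> ` source l \<and> target (\<alpha> ` l) = \<alpha> ` target l) \<or>
      (source (\<alpha> ` l) = \<alpha> ` target l \<and> target (\<alpha> ` l) = \<alpha> ` source l)"
    if l: "l \<in> lines" and ne: "source l \<noteq> target l" for l
  proof -
    \<comment> \<open>The block R through 1 has label (R, R), so being opposite to it tests whether
      R occurs as a coordinate. Comparison with the images shows that the unordered pair of
      coordinates is preserved.\<close>
    have *: "source (\<alpha> ` l) = \<alpha> ` R \<or> target (\<alpha> ` l) = \<alpha> ` R \<longleftrightarrow> source l = R \<or> target l = R"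
      if R: "R \<in> PP" for R
      using opp[OF l PP_line[OF R]] opposite_iff[OF l PP_line[OF R]]
        opposite_iff[OF im'[OF l] im'[OF PP_line[OF R]]] PP_source_target[OF R] PP_source_target[OF \<sigma>[OF R]]
      by metis
    have "\<alpha> ` source l \<noteq> \<alpha> ` target l" using \<sigma>_inj src[OF l] ne by blast
    then show ?thesis
      using *[OF src(1)[OF l]] *[OF src(2)[OF l]] by metis
  qed
  define straight where "straight = (\<lambda>l. source (\<alpha> ` l) = \<alpha> ` source l \<and> target (\<alpha> ` l) = \<alpha> ` target l)"
  \<comment> \<open>If l kept and m swapped its coordinates, the images, not being opposite, would
    force the source of one of l, m to equal the target of the other. Together with the shared
    coordinate this puts l or m on the diagonal.\<close>
  have same_source: "straight m"
    if "l \<in> lines" "m \<in> lines" "source l \<noteq> target l" "source m \<noteq> target m" "straight l"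
       "source l = source m \<or> target l = target m" for l m
  proof (rule ccontr)
    assume "\<not> straight m"
    then have m: "source (\<alpha> ` m) = \<alpha> ` target m" "target (\<alpha> ` m) = \<alpha> ` source m"
      using dichotomy[OF that(2,4)] straight_def by auto
    have "\<not> opposite lines (\<alpha> ` l) (\<alpha> ` m)"
      using opp[OF that(1,2)] opposite_iff[OF that(1,2)] that(6) by blast
    then have "\<alpha> ` source l = \<alpha> ` target m \<or> \<alpha> ` target l = \<alpha> ` source m"
      using opposite_iff[OF im'[OF that(1)] im'[OF that(2)]] m that(5) straight_def by auto
    then have "source l = target m \<or> target l = source m"
      using \<sigma>_inj src that by metis
    then show False using that by metis
  qed
  have ex_line: "\<exists>l\<in>lines. source l = P \<and> target l = Q" if PQ: "P \<in> PP" "Q \<in> PP" "P \<noteq> Q" for P Q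
  proof -
    obtain x where x: "x \<in> carrier G" "conj_set G P x = Q" using PP_trans2[of P Q Q P] PQ by blast
    then have "source (P #> x) = P \<and> target (P #> x) = Q"
      using source_coset[OF PQ(1)] target_coset[OF PQ(1)] by simp
    then show ?thesis using linesI[OF PQ(1) x(1)] by blast
  qed
  have step: "straight m" if st: "straight l" and l: "l \<in> lines" and m: "m \<in> lines"
      and nl: "source l \<noteq> target l" and nm: "source m \<noteq> target m" for l m
  proof -
    \<comment> \<open>From label (P, Q) to label (P', Q') one passes through (P, R) and (P', R),
      changing one coordinate at a time. As R differs from P and P', no label on the way is
      diagonal.\<close>
    obtain R where R: "R \<in> PP" "R \<noteq> source l" "R \<noteq> source m"
      using PP_third[of "source l" "source m"] by blast
    obtain l1 where l1: "l1 \<in> lines" "source l1 = source l" "target l1 = R"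
      using ex_line[OF src(1)[OF l] R(1) R(2)[symmetric]] by blast
    obtain l2 where l2: "l2 \<in> lines" "source l2 = source m" "target l2 = R"
      using ex_line[OF src(1)[OF m] R(1) R(3)[symmetric]] by blast
    have "straight l1" using same_source[OF l l1(1) nl _ st] l1 R by auto
    then have "straight l2" using same_source[OF l1(1) l2(1)] l1 l2 R by auto
    then show ?thesis using same_source[OF l2(1) m _ nm] l2 R by auto
  qed
  have diag: "source (\<alpha> ` l) = \<alpha> ` source l \<and> target (\<alpha> ` l) = \<alpha> ` source l"
    if l: "l \<in> lines" and eq: "source l = target l" for l
  proof -
    have P: "source l \<in> PP" using src l by blast
    \<comment> \<open>A diagonal label (P, P) is also the label of the block P through 1, whose
      image is again a member of \<open>PP\<close>.\<close>
    have "parallel lines l (source l)"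
      using parallel_iff[OF l PP_line[OF P]] PP_source_target[OF P] eq by simp
    then have "parallel lines (\<alpha> ` l) (\<alpha> ` source l)"
      using par[OF l PP_line[OF P]] by blast
    then show ?thesis
      using parallel_iff[OF im'[OF l] im'[OF PP_line[OF P]]] PP_source_target[OF \<sigma>[OF P]] by simp
  qed
  have rel: "conj_set G (source (\<alpha> ` (P #> x))) (\<alpha> x) = target (\<alpha> ` (P #> x))"
    if "P \<in> PP" "x \<in> carrier G" for P x
    using line_source(3)[OF im'[OF linesI[OF that]], of "\<alpha> x"] rcos_self[OF that(2) PP_subgroup[OF that(1)]]
    by simp
  show ?thesis
  proof (cases "\<forall>l\<in>lines. source l \<noteq> target l \<longrightarrow> straight l")
    case True
    \<comment> \<open>The label of the image of P x says that the image of x conjugates the image of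
      P to the image of P^x. Products can now be compared through their action on \<open>PP\<close>,
      which is faithful.\<close>
    have act: "conj_set G (\<alpha> ` P) (\<alpha> x) = \<alpha> ` conj_set G P x" if "P \<in> PP" "x \<in> carrier G" for P x
      using rel[OF that] True diag linesI[OF that] source_coset[OF that] target_coset[OF that]
      unfolding straight_def by metis
    have "\<alpha> (x \<otimes> y) = \<alpha> x \<otimes> \<alpha> y" if x: "x \<in> carrier G" and y: "y \<in> carrier G" for x y
    proof -
      have "conj_set G Q ((\<alpha> x \<otimes> \<alpha> y) \<otimes> inv (\<alpha> (x \<otimes> y))) = Q" if Q: "Q \<in> PP" for Q
      proof -
        obtain P where P: "P \<in> PP" "\<alpha> ` P = Q" using \<sigma>_surj[OF Q] by blast
        have "conj_set G Q (\<alpha> x \<otimes> \<alpha> y) = conj_set G (conj_set G Q (\<alpha> x)) (\<alpha> y)"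
          using conj_set_conj_set PP_sub Q closed x y by simp
        also have "\<dots> = \<alpha> ` conj_set G P (x \<otimes> y)"
          using P x y act PP_conj conj_set_conj_set PP_sub by metis
        also have "\<dots> = conj_set G Q (\<alpha> (x \<otimes> y))"
          using act[OF P(1), of "x \<otimes> y"] P(2) x y by simp
        finally show ?thesis
          using conj_set_inv_eq[OF PP_sub[OF Q], of "\<alpha> (x \<otimes> y)"] closed x y Q PP_sub
          by (simp flip: conj_set_conj_set)
      qed
      then have "(\<alpha> x \<otimes> \<alpha> y) \<otimes> inv (\<alpha> (x \<otimes> y)) = \<one>"
        using PP_faithful closed x y by simp
      then show ?thesis
        using closed x y by (simp add: inv_solve_right')
    qed
    then show ?thesis by blast
  next
    case False
    then have twisted: "\<not> straight l" if "l \<in> lines" "source l \<noteq> target l" for l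
      using step that by blast
    \<comment> \<open>With swapped labels the image of x takes the image of P^x back to that of P.
      This reversal of direction is what reverses products.\<close>
    have act: "conj_set G (\<alpha> ` conj_set G P x) (\<alpha> x) = \<alpha> ` P" if "P \<in> PP" "x \<in> carrier G" for P x
      using rel[OF that] twisted diag dichotomy linesI[OF that] source_coset[OF that] target_coset[OF that]
      unfolding straight_def by metis
    have "\<alpha> (x \<otimes> y) = \<alpha> y \<otimes> \<alpha> x" if x: "x \<in> carrier G" and y: "y \<in> carrier G" for x y
    proof -
      have "conj_set G Q (inv (\<alpha> (x \<otimes> y)) \<otimes> (\<alpha> y \<otimes> \<alpha> x)) = Q" if Q: "Q \<in> PP" for Q
      proof -
        obtain P where P: "P \<in> PP" "\<alpha> ` P = Q" using \<sigma>_surj[OF Q] by blast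
        define R where "R = \<alpha> ` conj_set G P (x \<otimes> y)"
        have R: "R \<in> PP" using \<sigma> PP_conj P x y by (simp add: R_def)
        have "conj_set G R (\<alpha> (x \<otimes> y)) = Q"
          using act[OF P(1), of "x \<otimes> y"] x y P by (simp add: R_def)
        then have "conj_set G Q (inv (\<alpha> (x \<otimes> y))) = R"
          using conj_set_inv_eq[OF PP_sub[OF R]] closed x y by simp
        moreover have "conj_set G R (\<alpha> y) = \<alpha> ` conj_set G P x"
          using act[OF PP_conj[OF P(1) x] y] P x y PP_sub by (simp add: R_def conj_set_conj_set)
        moreover have "conj_set G (\<alpha> ` conj_set G P x) (\<alpha> x) = Q"
          using act[OF P(1) x] P by simp
        ultimately show ?thesis
          using PP_sub[OF Q] PP_sub[OF R] closed x y by (simp flip: conj_set_conj_set)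
      qed
      then have "inv (\<alpha> (x \<otimes> y)) \<otimes> (\<alpha> y \<otimes> \<alpha> x) = \<one>"
        using PP_faithful closed x y by simp
      then show ?thesis
        using closed x y by (metis inv_r_cancel m_closed r_one)
    qed
    then show ?thesis by blast
  qed
qed

text \<open>The image of \<open>P0\<close> is its conjugate by some c in C. As C is commutative and
  fixed pointwise, every conjugate of \<open>P0\<close> by an element of C, hence every member of
  \<open>PP\<close>, is mapped to its conjugate by c. Then c \<alpha>(x) and x c act alike on
  \<open>PP\<close>, and faithfulness determines \<alpha>(x).\<close>

lemma automorphism_fixing_regular:
  assumes bij: "bij_betw \<alpha> (carrier G) (carrier G)"
    and hom: "\<And>x y. x \<in> carrier G \<Longrightarrow> y \<in> carrier G \<Longrightarrow> \<alpha> (x \<otimes> y) = \<alpha> x \<otimes> \<alpha> y"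
    and PP: "\<And>P. P \<in> PP \<Longrightarrow> \<alpha> ` P \<in> PP"
    and C: "C \<subseteq> carrier G" "\<And>c. c \<in> C \<Longrightarrow> \<alpha> c = c"
    and comm: "\<And>c d. c \<in> C \<Longrightarrow> d \<in> C \<Longrightarrow> c \<otimes> d = d \<otimes> c"
    and trans: "P0 \<in> PP" "\<And>P. P \<in> PP \<Longrightarrow> \<exists>c\<in>C. P = conj_set G P0 c"
  shows "\<exists>c\<in>C. \<forall>x\<in>carrier G. \<alpha> x = conj_by G c x"
proof -
  have closed: "\<alpha> x \<in> carrier G" if "x \<in> carrier G" for x
    using bij that by (auto simp: bij_betw_def)
  have "\<alpha> \<in> hom G G" using hom closed by (auto simp: hom_def)
  then interpret \<alpha>: group_hom G G \<alpha> by unfold_locales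
  have conj: "\<alpha> (conj_by G x h) = conj_by G (\<alpha> x) (\<alpha> h)" if "x \<in> carrier G" "h \<in> carrier G" for x h
    using that by (simp add: conj_by_def)
  have conj_im: "\<alpha> ` conj_set G D x = conj_set G (\<alpha> ` D) (\<alpha> x)" if "D \<subseteq> carrier G" "x \<in> carrier G" for D x
    using that conj unfolding conj_set_def image_image by (intro image_cong) auto
  obtain c where c: "c \<in> C" "\<alpha> ` P0 = conj_set G P0 c" using trans(2) PP trans(1) by blast
  have cG: "c \<in> carrier G" using c C by blast
  have \<alpha>P: "\<alpha> ` P = conj_set G P c" if P: "P \<in> PP" for P
  proof -
    obtain d where d: "d \<in> C" "P = conj_set G P0 d" using trans(2)[OF P] by blast
    then have dG: "d \<in> carrier G" using C by blast
    have "\<alpha> ` P = conj_set G (conj_set G P0 c) d"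
      using conj_im[OF PP_sub[OF trans(1)] dG] d C(2) c by simp
    also have "\<dots> = conj_set G (conj_set G P0 d) c"
      using conj_set_conj_set[OF PP_sub[OF trans(1)]] dG cG comm[OF c(1) d(1)] by simp
    finally show ?thesis using d by simp
  qed
  have "\<alpha> x = conj_by G c x" if x: "x \<in> carrier G" for x
  proof -
    have "conj_set G P ((c \<otimes> \<alpha> x) \<otimes> inv (x \<otimes> c)) = P" if P: "P \<in> PP" for P
    proof -
      have "conj_set G P (c \<otimes> \<alpha> x) = conj_set G (\<alpha> ` P) (\<alpha> x)"
        using \<alpha>P[OF P] conj_set_conj_set[OF PP_sub[OF P] cG closed[OF x]] by simp
      also have "\<dots> = \<alpha> ` conj_set G P x"
        using conj_im[OF PP_sub[OF P] x] by simp
      also have "\<dots> = conj_set G P (x \<otimes> c)"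
        using \<alpha>P[OF PP_conj[OF P x]] conj_set_conj_set[OF PP_sub[OF P] x cG] by simp
      finally show ?thesis
        using conj_set_inv_eq[OF PP_sub[OF P], of "x \<otimes> c"] closed x cG P PP_sub
        by (simp flip: conj_set_conj_set)
    qed
    then have "(c \<otimes> \<alpha> x) \<otimes> inv (x \<otimes> c) = \<one>"
      using PP_faithful closed x cG by simp
    then have "c \<otimes> \<alpha> x = x \<otimes> c"
      using closed x cG by (simp add: inv_solve_right')
    then show ?thesis
      using closed x cG by (metis conj_by_def inv_l_cancel m_assoc inv_closed)
  qed
  then show ?thesis using c by blast
qed

end

section \<open>A table model of the field with eight elements\<close>

text \<open>\<open>Zi\<close> stands for \<open>z ^ i\<close>; \<open>incr8\<close> adds \<open>1\<close>, and \<open>z ^ i + y = z ^ i * (1 + z ^ (7 - i) * y)\<close>.\<close>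

datatype f8 = Zero | Z0 | Z1 | Z2 | Z3 | Z4 | Z5 | Z6

fun shift8 :: "f8 \<Rightarrow> f8" where
  "shift8 Zero = Zero" | "shift8 Z0 = Z1" | "shift8 Z1 = Z2" | "shift8 Z2 = Z3"
| "shift8 Z3 = Z4" | "shift8 Z4 = Z5" | "shift8 Z5 = Z6" | "shift8 Z6 = Z0"

fun incr8 :: "f8 \<Rightarrow> f8" where
  "incr8 Zero = Z0" | "incr8 Z0 = Zero" | "incr8 Z1 = Z3" | "incr8 Z2 = Z6"
| "incr8 Z3 = Z1" | "incr8 Z4 = Z5" | "incr8 Z5 = Z4" | "incr8 Z6 = Z2"

fun mul8 :: "f8 \<Rightarrow> f8 \<Rightarrow> f8" where
  "mul8 Zero y = Zero"
| "mul8 Z0 y = y"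
| "mul8 Z1 y = shift8 y"
| "mul8 Z2 y = shift8 (shift8 y)"
| "mul8 Z3 y = shift8 (shift8 (shift8 y))"
| "mul8 Z4 y = shift8 (shift8 (shift8 (shift8 y)))"
| "mul8 Z5 y = shift8 (shift8 (shift8 (shift8 (shift8 y))))"
| "mul8 Z6 y = shift8 (shift8 (shift8 (shift8 (shift8 (shift8 y)))))"

fun add8 :: "f8 \<Rightarrow> f8 \<Rightarrow> f8" where
  "add8 Zero y = y"
| "add8 Z0 y = incr8 y"
| "add8 Z1 y = mul8 Z1 (incr8 (mul8 Z6 y))"
| "add8 Z2 y = mul8 Z2 (incr8 (mul8 Z5 y))"
| "add8 Z3 y = mul8 Z3 (incr8 (mul8 Z4 y))"
| "add8 Z4 y = mul8 Z4 (incr8 (mul8 Z3 y))"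
| "add8 Z5 y = mul8 Z5 (incr8 (mul8 Z2 y))"
| "add8 Z6 y = mul8 Z6 (incr8 (mul8 Z1 y))"

type_synonym m8 = "f8 \<times> f8 \<times> f8 \<times> f8"

fun mulM :: "m8 \<Rightarrow> m8 \<Rightarrow> m8" where
  "mulM (a, b, c, d) (a', b', c', d') =
     (add8 (mul8 a a') (mul8 b c'), add8 (mul8 a b') (mul8 b d'),
      add8 (mul8 c a') (mul8 d c'), add8 (mul8 c b') (mul8 d d'))"

text \<open>The adjugate, without signs because the characteristic is 2; for determinant 1 it is the
  inverse.\<close>

fun adjM :: "m8 \<Rightarrow> m8" where "adjM (a, b, c, d) = (d, b, c, a)"
fun detM :: "m8 \<Rightarrow> f8" where "detM (a, b, c, d) = add8 (mul8 a d) (mul8 b c)"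
fun traceM :: "m8 \<Rightarrow> f8" where "traceM (a, b, c, d) = add8 a d"
fun frobM :: "m8 \<Rightarrow> m8" where "frobM (a, b, c, d) = (mul8 a a, mul8 b b, mul8 c c, mul8 d d)"
definition conjM :: "m8 \<Rightarrow> m8 \<Rightarrow> m8" where "conjM x h = mulM (adjM x) (mulM h x)"

definition idM :: m8 where "idM = (Z0, Zero, Zero, Z0)"
definition gM :: m8 where "gM = (Z2, Z4, Z4, Z1)"
definition fM :: m8 where "fM = (Zero, Z0, Z0, Zero)"

definition all8 :: "f8 list" where "all8 = [Zero, Z0, Z1, Z2, Z3, Z4, Z5, Z6]"

definition H1M :: "m8 list" where
  "H1M = [idM, (Z5, Z0, Z5, Z6), (Z4, Z2, Z0, Z2), (Zero, Z1, Z6, Z5), (Z3, Z6, Z4, Z5),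
     (Z3, Z1, Z6, Zero), (Z0, Z2, Z0, Z6), (Z4, Z0, Z5, Z0), (Z5, Zero, Zero, Z2)]"
definition H4M :: "m8 list" where
  "H4M = [idM, (Z5, Zero, Z6, Z2), (Z1, Z6, Z4, Z0), (Z0, Z5, Z6, Z5), (Z1, Z4, Zero, Z6),
     (Z5, Z2, Z4, Z4), (Zero, Z2, Z5, Z5), (Zero, Z4, Z3, Z4), (Z2, Z5, Z5, Z6)]"
definition D1M :: "m8 list" where
  "D1M = [idM, (Z5, Z0, Z5, Z6), (Z4, Z2, Z0, Z2), (Z0, Z1, Z6, Zero), (Zero, Z1, Z6, Z2),
     (Z0, Z4, Z2, Z2), (Z3, Z5, Z3, Z0), (Z5, Z4, Z2, Z4), (Z2, Zero, Zero, Z5)]"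
definition D4M :: "m8 list" where
  "D4M = [idM, (Z5, Zero, Z6, Z2), (Z1, Z6, Z4, Z0), (Z5, Z2, Z5, Zero), (Z3, Z4, Z6, Z5),
     (Z0, Z0, Z3, Z1), (Z0, Z1, Z0, Z3), (Z1, Z2, Z0, Z5), (Z1, Zero, Z1, Z6)]"

definition CM :: "m8 list" where "CM = map (\<lambda>n. (mulM gM ^^ n) idM) [0..<9]"

definition HfM :: "m8 list list" where
  "HfM = [H1M, map frobM H1M, map frobM (map frobM H1M), H4M, map frobM H4M, map frobM (map frobM H4M)]"
definition orbit3 :: "m8 list \<Rightarrow> m8 list list" where
  "orbit3 D = [D, map (conjM gM) D, map (conjM (mulM gM gM)) D]"
definition DfM :: "m8 list list" where "DfM = orbit3 D1M @ orbit3 D4M"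
definition DfM' :: "m8 list list" where "DfM' = orbit3 D1M @ orbit3 (map (conjM fM) D4M)"

text \<open>\<open>code_simp\<close> evaluates both arguments of \<open>\<and>\<close>, \<open>\<or>\<close> and \<open>\<longrightarrow>\<close>, and it simplifies the
  bodies of abstractions before they are applied.  The checks below therefore branch with \<open>if\<close> only
  and iterate partially applied constants instead of abstractions.\<close>

fun any :: "('a \<Rightarrow> bool) \<Rightarrow> 'a list \<Rightarrow> bool" where
  "any P [] = False"
| "any P (x # xs) = (if P x then True else any P xs)"

fun every :: "('a \<Rightarrow> bool) \<Rightarrow> 'a list \<Rightarrow> bool" where
  "every P [] = True"
| "every P (x # xs) = (if P x then every P xs else False)"

fun elem :: "m8 \<Rightarrow> m8 list \<Rightarrow> bool" where
  "elem x [] = False"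
| "elem x (y # ys) = (if fst x = fst y then if snd x = snd y then True else elem x ys else elem x ys)"

definition sl8_4 :: "(m8 \<Rightarrow> bool) \<Rightarrow> f8 \<Rightarrow> f8 \<Rightarrow> f8 \<Rightarrow> f8 \<Rightarrow> bool" where
  "sl8_4 P a b c d = (if detM (a, b, c, d) = Z0 then P (a, b, c, d) else True)"
definition sl8_3 :: "(m8 \<Rightarrow> bool) \<Rightarrow> f8 \<Rightarrow> f8 \<Rightarrow> f8 \<Rightarrow> bool" where
  "sl8_3 P a b c = every (sl8_4 P a b c) all8"
definition sl8_2 :: "(m8 \<Rightarrow> bool) \<Rightarrow> f8 \<Rightarrow> f8 \<Rightarrow> bool" where
  "sl8_2 P a b = every (sl8_3 P a b) all8"
definition sl8_1 :: "(m8 \<Rightarrow> bool) \<Rightarrow> f8 \<Rightarrow> bool" where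
  "sl8_1 P a = every (sl8_2 P a) all8"
definition every_sl8 :: "(m8 \<Rightarrow> bool) \<Rightarrow> bool" where
  "every_sl8 P = every (sl8_1 P) all8"

text \<open>The entries of \<open>wit F h\<close> are the reasons for \<open>h\<close> to lie in a part of the partition: membership
  in \<open>C\<close>, trace \<open>0\<close> (a conjugate of \<open>T\<close>), or a factorisation \<open>h = (h y) y\<^sup>-\<^sup>1\<close> with \<open>y\<close> and \<open>h y\<close> in
  some \<open>D\<close> of \<open>F\<close>.  Together, (Q) and (P) say that every \<open>h \<noteq> 1\<close> has exactly one.\<close>

fun hits :: "m8 \<Rightarrow> m8 list \<Rightarrow> m8 list \<Rightarrow> (m8 list \<times> m8) list" where
  "hits h D [] = []"
| "hits h D (y # ys) = (if elem (mulM h y) D then (D, y) # hits h D ys else hits h D ys)"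

fun witD :: "m8 list list \<Rightarrow> m8 \<Rightarrow> (m8 list \<times> m8) list" where
  "witD [] h = []"
| "witD (D # F) h = hits h D D @ witD F h"

text \<open>The empty list marks the two kinds of part that do not come from F; no base list is
  empty, since it contains 1. For h other than 1 the second components h and 1 keep the two marks
  apart. A single entry excludes overlapping parts as well as two factorisations within one
  D.\<close>

definition wit :: "m8 list list \<Rightarrow> m8 \<Rightarrow> (m8 list \<times> m8) list" where
  "wit F h = (if elem h CM then [([], h)] else []) @ (if traceM h = Zero then [([], idM)] else [])
     @ witD F h"

fun is_single :: "'a list \<Rightarrow> bool" where
  "is_single [] = False" | "is_single [x] = True" | "is_single (x # y # ys) = False"

definition part1 :: "m8 list list \<Rightarrow> m8 \<Rightarrow> bool" where
  "part1 F h = (if h = idM then True else is_single (wit F h))"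

definition partM :: "m8 list list \<Rightarrow> bool" where
  "partM F = every_sl8 (part1 F)"

definition shift_in :: "m8 list \<Rightarrow> m8 \<Rightarrow> m8 \<Rightarrow> bool" where
  "shift_in D' y d = elem (mulM d y) D'"
definition shift_to :: "m8 list \<Rightarrow> m8 list \<Rightarrow> m8 \<Rightarrow> bool" where
  "shift_to D D' y = every (shift_in D' y) D"
text \<open>An automorphism need only send a member of the family to a right translate of a member.
  The maps in question fix 1, so the image of D contains 1 and the translating y lies in D' itself;
  this limits the search to the entries of D'.\<close>

definition shift_eq :: "m8 list \<Rightarrow> m8 list \<Rightarrow> bool" where
  "shift_eq D D' = any (shift_to D D') D'"
definition shift_mem :: "m8 list list \<Rightarrow> m8 list \<Rightarrow> bool" where
  "shift_mem F D = any (shift_eq D) F"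
definition closedM :: "(m8 \<Rightarrow> m8) \<Rightarrow> m8 list list \<Rightarrow> bool" where
  "closedM h F = every (shift_mem F) (map (map h) F)"

section \<open>The group \<open>SL(2,8)\<close> and its Sylow 2-subgroups\<close>

lemma mat2_nth [simp]:
  "mat2 a b c d $ 1 $ 1 = a" "mat2 a b c d $ 1 $ 2 = b"
  "mat2 a b c d $ 2 $ 1 = c" "mat2 a b c d $ 2 $ 2 = d"
  by (simp_all add: mat2_def)

lemma mat2_eq_iff [simp]:
  "mat2 a b c d = mat2 a' b' c' d' \<longleftrightarrow> a = a' \<and> b = b' \<and> c = c' \<and> d = d'"
  by (metis mat2_nth)

lemma mat2_cases: obtains a b c d where "A = mat2 a b c d"
proof
  show "A = mat2 (A $ 1 $ 1) (A $ 1 $ 2) (A $ 2 $ 1) (A $ 2 $ 2)"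
    by (simp add: vec_eq_iff forall_2)
qed

lemma mat2_mult [simp]:
  "mat2 a b c d ** mat2 a' b' c' d' =
     mat2 (a * a' + b * c') (a * b' + b * d') (c * a' + d * c') (c * b' + d * (d' :: 'a :: semiring_1))"
  by (simp add: vec_eq_iff forall_2 matrix_matrix_mult_def sum_2)

lemma det_mat2 [simp]: "det (mat2 a b c d) = a * d - b * (c :: 'a :: comm_ring_1)"
  by (simp add: det_2)

lemma mat_1_eq_mat2: "mat 1 = mat2 1 0 0 (1 :: 'a :: zero_neq_one)"
  by (simp add: vec_eq_iff forall_2 mat_def)

lemma frob_mat2 [simp]: "frob_mat (mat2 a b c d) = mat2 (a\<^sup>2) (b\<^sup>2) (c\<^sup>2) (d\<^sup>2)"
  by (simp add: frob_mat_def vec_eq_iff forall_2)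

lemma trace_mat2 [simp]: "trace (mat2 a b c d) = a + d"
  by (simp add: trace_def sum_2)

lemma carrier_SL2 [simp]: "A \<in> carrier SL2 \<longleftrightarrow> det A = 1"
  by (simp add: SL2_def)

lemma mult_SL2 [simp]: "A \<otimes>\<^bsub>SL2\<^esub> B = A ** B"
  by (simp add: SL2_def)

lemma one_SL2: "\<one>\<^bsub>SL2\<^esub> = mat2 1 0 0 1"
  by (simp add: SL2_def mat_1_eq_mat2)

lemma group_SL2: "group (SL2 :: ('a::field^2^2) monoid)"
proof (rule groupI)
  fix A :: "'a^2^2" assume A: "A \<in> carrier SL2"
  obtain a b c d where [simp]: "A = mat2 a b c d" by (rule mat2_cases)
  have "mat2 d (-b) (-c) a \<otimes>\<^bsub>SL2\<^esub> A = \<one>\<^bsub>SL2\<^esub>" "mat2 d (-b) (-c) a \<in> carrier SL2"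
    using A by (simp_all add: one_SL2 algebra_simps)
  then show "\<exists>B\<in>carrier SL2. B \<otimes>\<^bsub>SL2\<^esub> A = \<one>\<^bsub>SL2\<^esub>" by blast
qed (auto simp: det_mul matrix_mul_assoc SL2_def)

interpretation SL2: group "SL2 :: ('a::field^2^2) monoid"
  by (rule group_SL2)

lemma inv_SL2 [simp]:
  assumes "a * d - b * c = (1 :: 'a :: field)"
  shows "inv\<^bsub>SL2\<^esub> (mat2 a b c d) = mat2 d (-b) (-c) a"
  by (rule SL2.inv_equality) (use assms in \<open>simp_all add: one_SL2 algebra_simps\<close>)

fun val8 :: "'a::field \<Rightarrow> f8 \<Rightarrow> 'a" where
  "val8 z Zero = 0"
| "val8 z Z0 = 1"
| "val8 z Z1 = z"
| "val8 z Z2 = z ^ 2"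
| "val8 z Z3 = z ^ 3"
| "val8 z Z4 = z ^ 4"
| "val8 z Z5 = z ^ 5"
| "val8 z Z6 = z ^ 6"

fun valM :: "'a::field \<Rightarrow> m8 \<Rightarrow> 'a^2^2" where
  "valM z (a, b, c, d) = mat2 (val8 z a) (val8 z b) (val8 z c) (val8 z d)"

definition unipotent :: "('a::field^2^2) set" where
  "unipotent = range (\<lambda>t. mat2 1 t 0 1)"

text \<open>A concrete description by conjugation of the upper unitriangular group. That a Sylow
  2-subgroup in the sense of orders belongs to it is \<open>sylow_in_sylows\<close>.\<close>

definition sylows :: "('a::field^2^2) set set" where
  "sylows = conj_set SL2 unipotent ` carrier SL2"

lemma every_iff [simp]: "every P xs \<longleftrightarrow> (\<forall>x\<in>set xs. P x)"
  by (induction xs) auto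

lemma any_iff [simp]: "any P xs \<longleftrightarrow> (\<exists>x\<in>set xs. P x)"
  by (induction xs) auto

lemma elem_iff [simp]: "elem x xs \<longleftrightarrow> x \<in> set xs"
  by (induction xs) (auto simp: prod_eq_iff)

lemma set_all8 [simp]: "set all8 = UNIV"
  using f8.exhaust by (auto simp: all8_def)

lemma every_sl8_iff [simp]: "every_sl8 P \<longleftrightarrow> (\<forall>m. detM m = Z0 \<longrightarrow> P m)"
  by (auto simp: every_sl8_def sl8_1_def sl8_2_def sl8_3_def sl8_4_def)

section \<open>Arithmetic of the field with eight elements and transfer to the table model\<close>

locale f8_field =
  fixes z :: "'a::field"
  assumes card: "CARD('a) = 8"
    and z3: "z ^ 3 = z + 1"
    and gen: "{x::'a. x \<noteq> 0} = range (\<lambda>k::nat. z ^ k)"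
begin

lemma finite_field [simp]: "finite (UNIV :: 'a set)"
  using card card_ge_0_finite by force

text \<open>Translation by \<open>1\<close> permutes the field, so its eight elements sum to themselves plus \<open>8\<close>.\<close>

lemma two_eq_0: "(2::'a) = 0"
proof -
  have "(\<Sum>x\<in>UNIV. x + 1) = (\<Sum>x\<in>UNIV. (x::'a))"
    by (rule sum.reindex_bij_witness[of _ "\<lambda>x. x - 1" "\<lambda>x. x + 1"]) auto
  then have "of_nat CARD('a) = (0::'a)"
    by (simp add: sum.distrib)
  then have "(2::'a) ^ 3 = 0" by (simp add: card del: power_eq_0_iff)
  then show ?thesis by (simp only: power_eq_0_iff)
qed

lemma add_self [simp]: "(x::'a) + x = 0"
  using two_eq_0 by (metis mult_2 mult_zero_left)

lemma uminus_eq [simp]: "- (x::'a) = x"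
  using add_self by (metis add_eq_0_iff)

lemma minus_eq [simp]: "(x::'a) - y = x + y"
  by (metis diff_conv_add_uminus uminus_eq)

lemma add_self_left [simp]: "(x::'a) + (x + y) = y"
  by (simp flip: add.assoc)

lemma add_eq_0 [simp]: "(x::'a) + y = 0 \<longleftrightarrow> x = y"
  by (metis add_eq_0_iff uminus_eq)

lemma power2_add: "((x::'a) + y)\<^sup>2 = x\<^sup>2 + y\<^sup>2"
  by (simp add: power2_sum two_eq_0)

lemma sq_inj [simp]: "(x::'a)\<^sup>2 = y\<^sup>2 \<longleftrightarrow> x = y"
  by (metis add_eq_0 power2_add zero_eq_power2)

lemma sq_eq_1 [simp]: "(x::'a)\<^sup>2 = 1 \<longleftrightarrow> x = 1"
  using sq_inj[of x 1] by simp

lemma z4: "z ^ 4 = z ^ 2 + z" and z5: "z ^ 5 = z ^ 2 + z + 1" and z6: "z ^ 6 = z ^ 2 + 1"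
  and z7: "z ^ 7 = 1"
proof -
  show 4: "z ^ 4 = z ^ 2 + z"
    using z3 by (simp add: eval_nat_numeral algebra_simps)
  have "z ^ 5 = z * z ^ 4" by (simp add: eval_nat_numeral)
  then show 5: "z ^ 5 = z ^ 2 + z + 1"
    using 4 z3 by (simp add: algebra_simps eval_nat_numeral)
  have "z ^ 6 = z * z ^ 5" by (simp add: eval_nat_numeral)
  also have "\<dots> = z ^ 3 + z ^ 2 + z" unfolding 5 by (simp add: algebra_simps eval_nat_numeral)
  finally show 6: "z ^ 6 = z ^ 2 + 1"
    unfolding z3 by (simp add: algebra_simps)
  have "z ^ 7 = z * z ^ 6" by (simp add: eval_nat_numeral)
  also have "\<dots> = z ^ 3 + z" unfolding 6 by (simp add: algebra_simps eval_nat_numeral)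
  finally show "z ^ 7 = 1" unfolding z3 by (simp add: algebra_simps)
qed

lemma val8_shift8: "val8 z (shift8 x) = z * val8 z x"
  using z7 by (cases x) (simp_all add: eval_nat_numeral)

lemma val8_incr8: "val8 z (incr8 x) = 1 + val8 z x"
  by (cases x) (simp_all add: z3 z4 z5 z6 algebra_simps)

lemma val8_mul8 [simp]: "val8 z (mul8 x y) = val8 z x * val8 z y"
  by (cases x) (simp_all add: val8_shift8 eval_nat_numeral mult.assoc)

lemma z_pow_mult:  "z ^ m * (z ^ n * x) = z ^ (m + n) * x"
  by (simp add: power_add mult.assoc)

lemma val8_add8 [simp]: "val8 z (add8 x y) = val8 z x + val8 z y"
proof -
  have *: "z ^ m * (1 + z ^ n * x) = z ^ m + x" if "m + n = 7" for m n x
    using that z7 by (simp add: distrib_left z_pow_mult)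
  have **: "z * (1 + z ^ 6 * x) = z + x"  "z ^ 6 * (1 + z * x) = z ^ 6 + x" for x
    using *[of 1 6 x] *[of 6 1 x] by simp_all
  show ?thesis
    by (cases x) (simp_all add: val8_incr8 * ** del: mul8.simps)
qed

lemma surj_val8: "surj (val8 z)"
proof -
  have "\<exists>c. val8 z c = x" for x
  proof (cases "x = 0")
    case True
    then show ?thesis by (metis val8.simps(1))
  next
    case False
    then obtain k where "x = z ^ k" using gen by blast
    also have "\<dots> = (z ^ 7) ^ (k div 7) * z ^ (k mod 7)"
      by (metis mult_div_mod_eq power_add power_mult)
    finally have x: "x = z ^ (k mod 7)" by (simp add: z7)
    have "k mod 7 < 7" by simp
    then consider "k mod 7 = 0" | "k mod 7 = 1" | "k mod 7 = 2" | "k mod 7 = 3"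
      | "k mod 7 = 4" | "k mod 7 = 5" | "k mod 7 = 6" by linarith
    then show ?thesis
      using x by cases (metis val8.simps power_0 power_one_right)+
  qed
  then show ?thesis by (metis surjI)
qed

text \<open>A surjection from a type with at most eight elements onto one with eight is injective,
  so the powers of z need not be told apart by hand.\<close>

lemma bij_val8: "bij (val8 z)"
proof -
  have UNIV: "(UNIV :: f8 set) = set all8" by simp
  have "card (UNIV :: f8 set) \<le> 8"
    unfolding UNIV using card_length[of all8] by (simp add: all8_def)
  moreover have "finite (UNIV :: f8 set)" unfolding UNIV by (rule finite_set)
  ultimately have "inj (val8 z)"
    using surj_val8 card by (intro eq_card_imp_inj_on) (auto intro: antisym card_image_le[of UNIV "val8 z", simplified surj_val8 card])
  then show ?thesis using surj_val8 by (simp add: bij_def)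
qed

lemma val8_eq [simp]: "val8 z x = val8 z y \<longleftrightarrow> x = y"
  using bij_val8 by (meson bij_def inj_eq)

lemma val8_eq_0 [simp]: "val8 z x = 0 \<longleftrightarrow> x = Zero"
  using val8_eq[of x Zero] by simp

lemma val8_eq_1 [simp]: "val8 z x = 1 \<longleftrightarrow> x = Z0"
  using val8_eq[of x Z0] by (simp del: val8_eq)

lemma valM_eq [simp]: "valM z x = valM z y \<longleftrightarrow> x = y"
  by (cases x; cases y) auto

lemma surj_valM: "\<exists>m. A = valM z m"
proof -
  obtain a b c d where "A = mat2 a b c d" by (rule mat2_cases)
  moreover obtain a' b' c' d' where "a = val8 z a'" "b = val8 z b'" "c = val8 z c'" "d = val8 z d'"
    using surj_val8 by (meson surjE)
  ultimately show ?thesis by (intro exI[of _ "(a', b', c', d')"]) simp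
qed

lemma valM_det [simp]: "det (valM z m) = 1 \<longleftrightarrow> detM m = Z0"
  by (cases m) (simp flip: val8_mul8 val8_add8)

lemma valM_trace [simp]: "trace (valM z m) = 0 \<longleftrightarrow> traceM m = Zero"
  by (cases m) (simp del: add_eq_0 flip: val8_add8)

lemma valM_mul: "valM z (mulM x y) = valM z x ** valM z y"
  by (cases x; cases y) simp

lemma valM_one [simp]: "valM z idM = \<one>\<^bsub>SL2\<^esub>"
  by (simp add: idM_def one_SL2)

lemma valM_inv [simp]: "detM x = Z0 \<Longrightarrow> inv\<^bsub>SL2\<^esub> (valM z x) = valM z (adjM x)"
  using valM_det[of x] by (cases x) (simp del: valM_det)

lemma valM_frob: "valM z (frobM x) = frob_mat (valM z x)"
  by (cases x) (simp add: power2_eq_square)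

lemma valM_conj: "detM x = Z0 \<Longrightarrow> valM z (conjM x h) = conj_by SL2 (valM z x) (valM z h)"
  by (simp add: conjM_def conj_by_def valM_mul matrix_mul_assoc)

lemma valM_g: "valM z gM = g_mat z" and valM_f: "valM z fM = f_mat"
  by (simp_all add: gM_def g_mat_def fM_def f_mat_def)

lemma det_g [simp]: "detM gM = Z0" and det_f [simp]: "detM fM = Z0"
  by code_simp+

lemma valM_sets:
  "valM z ` set H1M = H1 z" "valM z ` set H4M = H4 z"
  "valM z ` set D1M = D1 z" "valM z ` set D4M = D4 z"
  by (simp_all add: H1M_def H1_def H4M_def H4_def D1M_def D1_def D4M_def D4_def)

end

section \<open>Conjugates of subsets in an abstract group\<close>

context group
begin

lemma conj_set_eq_iff:
  assumes "D \<subseteq> carrier G" "x \<in> carrier G" "y \<in> carrier G"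
  shows "conj_set G D x = conj_set G D y \<longleftrightarrow> conj_set G D (x \<otimes> inv y) = D"
proof
  assume "conj_set G D x = conj_set G D y"
  then have "conj_set G (conj_set G D x) (inv y) = conj_set G (conj_set G D y) (inv y)" by (rule arg_cong)
  then show "conj_set G D (x \<otimes> inv y) = D"
    using assms by (simp add: conj_set_conj_set conj_set_one)
next
  assume "conj_set G D (x \<otimes> inv y) = D"
  then have "conj_set G (conj_set G D (x \<otimes> inv y)) y = conj_set G D y" by (rule arg_cong)
  then show "conj_set G D x = conj_set G D y"
    using assms by (simp add: conj_set_conj_set m_assoc)
qed

lemma conj_by_hom: "x \<in> carrier G \<Longrightarrow> conj_by G x \<in> hom G G"
  by (simp add: hom_def conj_by_mult)

lemma subgroup_conj_set:
  assumes "subgroup H G" "x \<in> carrier G"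
  shows "subgroup (conj_set G H x) G"
proof -
  interpret h: group_hom G G "conj_by G x"
    using conj_by_hom[OF assms(2)] by unfold_locales
  show ?thesis unfolding conj_set_def using assms(1) by (rule h.subgroup_img_is_subgroup)
qed

lemma inj_on_conj_by: "x \<in> carrier G \<Longrightarrow> inj_on (conj_by G x) (carrier G)"
  by (rule inj_on_inverseI[of _ "conj_by G (inv x)"]) (simp add: conj_by_conj_by)

lemma bij_betw_conj_by: "x \<in> carrier G \<Longrightarrow> bij_betw (conj_by G x) (carrier G) (carrier G)"
  by (rule bij_betw_byWitness[where f' = "conj_by G (inv x)"]) (auto simp: conj_by_conj_by)

lemma card_conj_set: "D \<subseteq> carrier G \<Longrightarrow> x \<in> carrier G \<Longrightarrow> card (conj_set G D x) = card D"
  unfolding conj_set_def using inj_on_conj_by by (meson card_image inj_on_subset)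

end

lemma trace_conj_SL2:
  assumes "x \<in> carrier SL2" "h \<in> carrier SL2"
  shows "trace (conj_by SL2 x h) = trace (h :: 'a::field^2^2)"
proof -
  have "trace (conj_by SL2 x h) = trace ((h ** x) ** inv\<^bsub>SL2\<^esub> x)"
    unfolding conj_by_def mult_SL2 by (metis matrix_mul_assoc trace_mul_sym)
  also have "(h ** x) ** inv\<^bsub>SL2\<^esub> x = h"
    using SL2.m_assoc[of h x "inv\<^bsub>SL2\<^esub> x"] assms by (metis SL2.inv_closed SL2.r_inv SL2.r_one mult_SL2)
  finally show ?thesis .
qed

section \<open>Conjugates of the unitriangular group as points of the projective line\<close>

context f8_field
begin

lemma unipotent_sub: "unipotent \<subseteq> carrier (SL2 :: ('a^2^2) monoid)"
  by (auto simp: unipotent_def)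

lemma unipotent_iff [simp]: "mat2 a b c (d::'a) \<in> unipotent \<longleftrightarrow> a = 1 \<and> c = 0 \<and> d = 1"
  by (auto simp: unipotent_def)

lemma card_unipotent: "card (unipotent :: ('a^2^2) set) = 8"
  unfolding unipotent_def using card_image[of "\<lambda>t::'a. mat2 1 t 0 1" UNIV] card by (simp add: inj_on_def)

text \<open>Only the bottom row (r, s) of the conjugating matrix survives: beyond the identity the
  result is t times the column (s, r) multiplied by the row (r, s). The conjugates of the
  unitriangular group thus correspond to projective points (r : s).\<close>

lemma conj_unipotent:
  assumes "p * s + q * r = (1::'a)"
  shows "conj_by SL2 (mat2 p q r s) (mat2 1 t 0 1) =
     mat2 (1 + t * r * s) (t * s\<^sup>2) (t * r\<^sup>2) (1 + t * r * s)"
proof -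
  have ps: "s * p = 1 + q * r" "p * s = 1 + q * r" using assms by (metis add.commute add_self_left mult.commute)+
  show ?thesis
    using assms by (simp add: conj_by_def power2_eq_square distrib_left distrib_right ps mult_ac add_ac)
qed

lemma conj_set_unipotent:
  assumes "p * s + q * r = (1::'a)"
  shows "conj_set SL2 unipotent (mat2 p q r s) =
     range (\<lambda>t. mat2 (1 + t * r * s) (t * s\<^sup>2) (t * r\<^sup>2) (1 + t * r * s))"
  unfolding conj_set_def unipotent_def image_image using conj_unipotent[OF assms] by simp

lemma subgroup_unipotent: "subgroup unipotent (SL2 :: ('a^2^2) monoid)"
proof (rule SL2.subgroupI)
  show "unipotent \<noteq> ({} :: ('a^2^2) set)" by (auto simp: unipotent_def)
qed (use unipotent_sub in \<open>auto simp: unipotent_def\<close>)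

lemma conj_unipotent_eq_iff:
  assumes "p * s + q * r = (1::'a)"
  shows "conj_set SL2 unipotent (mat2 p q r s) = unipotent \<longleftrightarrow> r = 0"
proof
  assume eq: "conj_set SL2 unipotent (mat2 p q r s) = unipotent"
  \<comment> \<open>The conjugate of the element with t = 1 has lower left entry r^2, which vanishes
    only for r = 0.\<close>
  have "mat2 (1 + 1 * r * s) (1 * s\<^sup>2) (1 * r\<^sup>2) (1 + 1 * r * s) \<in> conj_set SL2 unipotent (mat2 p q r s)"
    unfolding conj_set_unipotent[OF assms] by blast
  then have "mat2 (1 + 1 * r * s) (1 * s\<^sup>2) (1 * r\<^sup>2) (1 + 1 * r * s) \<in> unipotent"
    unfolding eq .
  then show "r = 0" by simp
next
  assume r: "r = 0"
  then have s: "s \<noteq> 0" using assms by auto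
  have "\<exists>t. mat2 1 u 0 1 = mat2 1 (t * s\<^sup>2) 0 1" for u
    using s by (intro exI[of _ "u / s\<^sup>2"]) simp
  then show "conj_set SL2 unipotent (mat2 p q r s) = unipotent"
    unfolding conj_set_unipotent[OF assms] using r by (auto simp: unipotent_def image_iff)
qed

lemma carrier_mat2: "mat2 a b c (d::'a) \<in> carrier SL2 \<longleftrightarrow> a * d + b * c = 1"
  by simp

text \<open>Two matrices yield the same conjugate iff their bottom rows are the same projective
  point. The quantity compared, c d' + d c', is the lower left entry of the first matrix times the
  inverse of the second, and by \<open>conj_unipotent_eq_iff\<close> it must vanish.\<close>

lemma conj_unipotent_eq_conj_iff:
  assumes "a * d + b * c = (1::'a)" "a' * d' + b' * c' = 1"
  shows "conj_set SL2 unipotent (mat2 a b c d) = conj_set SL2 unipotent (mat2 a' b' c' d') \<longleftrightarrow> c * d' = d * c'"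
proof -
  let ?x = "mat2 (a * d' + b * c') (a * b' + b * a') (c * d' + d * c') (c * b' + d * a')"
  have x: "mat2 a b c d \<in> carrier SL2" "mat2 a' b' c' d' \<in> carrier SL2"
    unfolding carrier_mat2 using assms by auto
  have eq: "mat2 a b c d \<otimes>\<^bsub>SL2\<^esub> inv\<^bsub>SL2\<^esub> (mat2 a' b' c' d') = ?x"
    using assms by simp
  have "?x \<in> carrier SL2"
    unfolding eq[symmetric] by (rule SL2.m_closed[OF x(1) SL2.inv_closed[OF x(2)]])
  then have det: "(a * d' + b * c') * (c * b' + d * a') + (a * b' + b * a') * (c * d' + d * c') = 1"
    unfolding carrier_mat2 .
  show ?thesis
    unfolding SL2.conj_set_eq_iff[OF unipotent_sub x] eq conj_unipotent_eq_iff[OF det] by simp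
qed

lemma sylowsE:
  assumes "P \<in> (sylows :: ('a^2^2) set set)"
  obtains p q r s where "p * s + q * r = 1" "P = conj_set SL2 unipotent (mat2 p q r s)"
proof -
  obtain h where h: "h \<in> carrier SL2" "P = conj_set SL2 unipotent h" using assms by (auto simp: sylows_def)
  obtain p q r s where "h = mat2 p q r s" by (rule mat2_cases)
  then show thesis using that h by simp
qed

lemma sylowsI: "p * s + q * r = (1::'a) \<Longrightarrow> conj_set SL2 unipotent (mat2 p q r s) \<in> sylows"
  by (simp add: sylows_def)

lemma Union_sylows: "\<Union>sylows = {h \<in> carrier SL2. trace (h :: 'a^2^2) = 0}"
proof
  show "\<Union>sylows \<subseteq> {h \<in> carrier SL2. trace (h :: 'a^2^2) = 0}"
  proof
    fix h :: "'a^2^2" assume "h \<in> \<Union>sylows"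
    then obtain x u where x: "x \<in> carrier SL2" "u \<in> unipotent" "h = conj_by SL2 x u"
      by (auto simp: sylows_def conj_set_def)
    then have u: "u \<in> carrier SL2" using unipotent_sub by blast
    then have "h \<in> carrier SL2" using x SL2.conj_by_closed by blast
    moreover have "trace h = trace u"
      unfolding x(3) by (rule trace_conj_SL2[OF x(1) u])
    moreover have "trace u = 0" using x(2) by (auto simp: unipotent_def)
    ultimately show "h \<in> {h \<in> carrier SL2. trace h = 0}" by simp
  qed
next
  show "{h \<in> carrier SL2. trace (h :: 'a^2^2) = 0} \<subseteq> \<Union>sylows"
  proof
    fix h :: "'a^2^2" assume h: "h \<in> {h \<in> carrier SL2. trace h = 0}"
    obtain a b c d where h_eq: "h = mat2 a b c d" by (rule mat2_cases)
    with h have da: "d = a" and det: "a * a + b * c = 1" by auto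
    have bc: "b * c = (1 + a)\<^sup>2"
      using det by (metis add.commute add_self_left power2_add power2_eq_square mult_1)
    \<comment> \<open>These are the entries in \<open>conj_unipotent\<close>. If b is nonzero, s = 1
      and t = b are possible and r is forced to be (1 + a) / b; the equation for c is then the
      determinant condition. If b = 0, the projective point is (1 : 0).\<close>
    have "\<exists>p q r s t. p * s + q * r = 1 \<and> a = 1 + t * r * s \<and> b = t * s\<^sup>2 \<and> c = t * r\<^sup>2"
    proof (cases "b = 0")
      case True
      then have "a = 1" using bc by auto
      then have "0 * 0 + 1 * 1 = (1::'a) \<and> a = 1 + c * 1 * 0 \<and> b = c * 0\<^sup>2 \<and> c = c * 1\<^sup>2"
        using True by simp
      then show ?thesis by blast
    next
      case False
      then have "c = b * ((1 + a) / b)\<^sup>2"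
        using bc by (simp add: power2_eq_square field_simps)
      then have "1 * 1 + 0 * ((1 + a) / b) = 1 \<and> a = 1 + b * ((1 + a) / b) * 1 \<and> b = b * 1\<^sup>2 \<and> c = b * ((1 + a) / b)\<^sup>2"
        using False by simp
      then show ?thesis by blast
    qed
    then obtain p q r s t where *: "p * s + q * r = 1" "a = 1 + t * r * s" "b = t * s\<^sup>2" "c = t * r\<^sup>2"
      by blast
    then have "h \<in> conj_set SL2 unipotent (mat2 p q r s)"
      unfolding conj_set_unipotent[OF *(1)] h_eq da by blast
    then show "h \<in> \<Union>sylows" using sylowsI[OF *(1)] by blast
  qed
qed

text \<open>The reference pair is the upper unitriangular group and its conjugate by f, with
  projective points (0 : 1) and (1 : 0). The matrix x is assembled from the bottom row of P and the
  bottom row of P' placed on top, the latter divided by e to obtain determinant 1; multiplication by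
  f exchanges the two rows.\<close>

lemma ex_conj_pair:
  assumes "P \<in> sylows" "P' \<in> (sylows :: ('a^2^2) set set)" "P \<noteq> P'"
  shows "\<exists>x\<in>carrier SL2. conj_set SL2 unipotent x = P \<and> conj_set SL2 unipotent (f_mat ** x) = P'"
proof -
  obtain p q r s where P: "p * s + q * r = 1" "P = conj_set SL2 unipotent (mat2 p q r s)"
    using assms sylowsE by metis
  obtain p' q' r' s' where P': "p' * s' + q' * r' = 1" "P' = conj_set SL2 unipotent (mat2 p' q' r' s')"
    using assms sylowsE by metis
  define e where "e = r' * s + s' * r"
  have e: "e \<noteq> 0"
    using assms(3) conj_unipotent_eq_conj_iff[OF P(1) P'(1)] P P' by (auto simp: e_def mult.commute)
  let ?x = "mat2 (r' / e) (s' / e) r s"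
  have x: "(r' / e) * s + (s' / e) * r = 1"
    using e by (simp add: e_def flip: add_divide_distrib)
  then have x': "r * (s' / e) + s * (r' / e) = 1" by (simp add: mult.commute add.commute)
  have "conj_set SL2 unipotent ?x = P"
    using conj_unipotent_eq_conj_iff[OF x P(1)] P by (simp add: mult.commute)
  moreover have "conj_set SL2 unipotent (f_mat ** ?x) = P'"
    using conj_unipotent_eq_conj_iff[OF x' P'(1)] P' by (simp add: f_mat_def mult.commute)
  moreover have "?x \<in> carrier SL2" using x by simp
  ultimately show ?thesis by blast
qed

lemma f_closed [simp]: "(f_mat :: 'a^2^2) \<in> carrier SL2"
  by (simp add: f_mat_def)

lemma coset_geometry_sylows: "coset_geometry SL2 (sylows :: ('a^2^2) set set)"
proof (intro coset_geometry.intro coset_geometry_axioms.intro group_SL2)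
  fix P :: "('a^2^2) set" assume "P \<in> sylows"
  then show "subgroup P SL2"
    using SL2.subgroup_conj_set subgroup_unipotent by (auto simp: sylows_def)
next
  fix P :: "('a^2^2) set" and x assume P: "P \<in> sylows" and x: "x \<in> carrier (SL2 :: ('a^2^2) monoid)"
  then obtain h where h: "h \<in> carrier SL2" "P = conj_set SL2 unipotent h" by (auto simp: sylows_def)
  have "conj_set SL2 P x = conj_set SL2 unipotent (h \<otimes>\<^bsub>SL2\<^esub> x)"
    unfolding h(2) by (rule SL2.conj_set_conj_set[OF unipotent_sub h(1) x])
  then show "conj_set SL2 P x \<in> sylows"
    unfolding sylows_def using SL2.m_closed[OF h(1) x] by blast
next
  fix P :: "('a^2^2) set" and y assume P: "P \<in> sylows" and y: "y \<in> carrier SL2" "y \<notin> P"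
  obtain h where h: "h \<in> carrier SL2" "P = conj_set SL2 unipotent h" using P by (auto simp: sylows_def)
  define w where "w = conj_by SL2 (inv\<^bsub>SL2\<^esub> h) y"
  have w: "w \<in> carrier SL2" using y h by (simp add: w_def del: carrier_SL2)
  have yw: "y = conj_by SL2 h w"
    using y h by (simp add: w_def SL2.conj_by_conj_by del: carrier_SL2 mult_SL2)
  have wU: "w \<notin> unipotent" using y(2) yw h by (auto simp: conj_set_def)
  obtain a b c d where w_eq: "w = mat2 a b c d" by (rule mat2_cases)
  have det: "a * d + b * c = 1" using w w_eq by simp
  have "conj_set SL2 P y = P \<longleftrightarrow> conj_set SL2 unipotent (h \<otimes>\<^bsub>SL2\<^esub> y) = conj_set SL2 unipotent h"
    using SL2.conj_set_conj_set[OF unipotent_sub] h y by simp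
  also have "\<dots> \<longleftrightarrow> conj_set SL2 unipotent w = unipotent"
  proof -
    have "(h \<otimes>\<^bsub>SL2\<^esub> y) \<otimes>\<^bsub>SL2\<^esub> inv\<^bsub>SL2\<^esub> h = w"
      using h y by (simp add: w_def conj_by_def del: mult_SL2 carrier_SL2)
    then show ?thesis
      using SL2.conj_set_eq_iff[OF unipotent_sub SL2.m_closed[OF h(1) y(1)] h(1)] by simp
  qed
  also have "\<dots> \<longleftrightarrow> c = 0"
    using conj_unipotent_eq_iff[OF det] w_eq by simp
  \<comment> \<open>The expression is the trace of w times the inverse of the unipotent matrix with
    parameter t. For c = 0 it is the constant a + d, nonzero because w is not unipotent; for c
    nonzero it has a root t.\<close>
  also have "\<dots> \<longleftrightarrow> (\<forall>t. a + d + c * t \<noteq> 0)"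
  proof
    assume c: "c = 0"
    have "a + d \<noteq> 0"
    proof
      assume "a + d = 0"
      then have "d = a" by simp
      then have "a = 1" using det c by (simp flip: power2_eq_square)
      then show False using wU w_eq c \<open>d = a\<close> by simp
    qed
    then show "\<forall>t. a + d + c * t \<noteq> 0" using c by simp
  next
    assume *: "\<forall>t. a + d + c * t \<noteq> 0"
    show "c = 0"
    proof (rule ccontr)
      assume "c \<noteq> 0"
      then show False using *[rule_format, of "(a + d) / c"] by simp
    qed
  qed
  also have "\<dots> \<longleftrightarrow> (\<forall>u\<in>P. y \<otimes>\<^bsub>SL2\<^esub> inv\<^bsub>SL2\<^esub> u \<notin> \<Union>sylows)"
  proof -
    have tr: "y \<otimes>\<^bsub>SL2\<^esub> inv\<^bsub>SL2\<^esub> (conj_by SL2 h (mat2 1 t 0 1)) \<in> \<Union>sylows \<longleftrightarrow> a + d + c * t = 0" for t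
    proof -
      have u: "mat2 1 t 0 1 \<in> carrier SL2" by simp
      have "inv\<^bsub>SL2\<^esub> (conj_by SL2 h (mat2 1 t 0 1)) = conj_by SL2 h (inv\<^bsub>SL2\<^esub> (mat2 1 t 0 1))"
        using h u by (simp add: conj_by_def SL2.inv_mult_group SL2.m_assoc del: mult_SL2 carrier_SL2 inv_SL2)
      then have "y \<otimes>\<^bsub>SL2\<^esub> inv\<^bsub>SL2\<^esub> (conj_by SL2 h (mat2 1 t 0 1)) = conj_by SL2 h (w \<otimes>\<^bsub>SL2\<^esub> inv\<^bsub>SL2\<^esub> (mat2 1 t 0 1))"
        using SL2.conj_by_mult[OF h(1) w SL2.inv_closed[OF u]] yw by simp
      moreover have "trace (w \<otimes>\<^bsub>SL2\<^esub> inv\<^bsub>SL2\<^esub> (mat2 1 t 0 1)) = a + d + c * t"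
        by (simp add: w_eq add_ac)
      ultimately show ?thesis
        unfolding Union_sylows
        using trace_conj_SL2[OF h(1), of "w \<otimes>\<^bsub>SL2\<^esub> inv\<^bsub>SL2\<^esub> (mat2 1 t 0 1)"]
          SL2.conj_by_closed[OF h(1), of "w \<otimes>\<^bsub>SL2\<^esub> inv\<^bsub>SL2\<^esub> (mat2 1 t 0 1)"]
          SL2.m_closed[OF w SL2.inv_closed[OF u]] by auto
    qed
    have "u \<in> P \<longleftrightarrow> (\<exists>t. u = conj_by SL2 h (mat2 1 t 0 1))" for u
      unfolding h(2) conj_set_def unipotent_def by auto
    then show ?thesis using tr by metis
  qed
  finally show "conj_set SL2 P y = P \<longleftrightarrow> (\<forall>u\<in>P. y \<otimes>\<^bsub>SL2\<^esub> inv\<^bsub>SL2\<^esub> u \<notin> \<Union>sylows)" .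
next
  fix P P' Q Q' :: "('a^2^2) set"
  assume *: "P \<in> sylows" "P' \<in> sylows" "P \<noteq> P'" "Q \<in> sylows" "Q' \<in> sylows" "Q \<noteq> Q'"
  obtain x where x: "x \<in> carrier SL2" "conj_set SL2 unipotent x = P" "conj_set SL2 unipotent (f_mat ** x) = P'"
    using ex_conj_pair * by blast
  obtain y where y: "y \<in> carrier SL2" "conj_set SL2 unipotent y = Q" "conj_set SL2 unipotent (f_mat ** y) = Q'"
    using ex_conj_pair * by blast
  let ?w = "inv\<^bsub>SL2\<^esub> x \<otimes>\<^bsub>SL2\<^esub> y"
  have "?w \<in> carrier SL2" using x y by (simp del: mult_SL2 carrier_SL2)
  moreover have "conj_set SL2 P ?w = Q"
    unfolding x(2)[symmetric] y(2)[symmetric]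
    using x(1) y(1) by (simp add: SL2.conj_set_conj_set[OF unipotent_sub] del: mult_SL2 carrier_SL2)
  moreover have "conj_set SL2 P' ?w = Q'"
    unfolding x(3)[symmetric] y(3)[symmetric] mult_SL2[symmetric]
    using x(1) y(1) f_closed by (simp add: SL2.conj_set_conj_set[OF unipotent_sub] SL2.m_assoc del: mult_SL2 carrier_SL2)
  ultimately show "\<exists>x\<in>carrier SL2. conj_set SL2 P x = Q \<and> conj_set SL2 P' x = Q'"
    by blast
next
  fix x :: "'a^2^2" assume x: "x \<in> carrier SL2" and fixes_all: "\<And>P. P \<in> sylows \<Longrightarrow> conj_set SL2 P x = P"
  obtain a b c d where x_eq: "x = mat2 a b c d" by (rule mat2_cases)
  have det: "a * d + b * c = 1" using x x_eq by simp
  have *: "(r * a + s * c) * s = (r * b + s * d) * r"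
    if "p * s + q * r = 1" for p q r s
  proof -
    have "conj_set SL2 (conj_set SL2 unipotent (mat2 p q r s)) x = conj_set SL2 unipotent (mat2 p q r s)"
      using fixes_all sylowsI that by blast
    then have eq: "conj_set SL2 unipotent (mat2 p q r s ** x) = conj_set SL2 unipotent (mat2 p q r s)"
      using SL2.conj_set_conj_set[OF unipotent_sub _ x, of "mat2 p q r s"] that by simp
    have "mat2 p q r s \<otimes>\<^bsub>SL2\<^esub> x \<in> carrier SL2"
      using SL2.m_closed[OF _ x, of "mat2 p q r s"] that by simp
    then show ?thesis
      using eq conj_unipotent_eq_conj_iff[OF _ that] by (simp add: x_eq)
  qed
  \<comment> \<open>The bottom rows (0, 1), (1, 0) and (1, 1) are tested: a matrix fixing three
    projective points is scalar, and determinant 1 in characteristic 2 leaves only the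
    identity.\<close>
  have "c = 0" using *[of 1 1 0 0] by simp
  moreover have "b = 0" using *[of 0 0 1 1] by simp
  moreover have "a = d" using *[of 1 1 0 1] \<open>c = 0\<close> \<open>b = 0\<close> det by auto
  ultimately show "x = \<one>\<^bsub>SL2\<^esub>"
    using det by (simp add: x_eq one_SL2 flip: power2_eq_square)
next
  fix P Q :: "('a^2^2) set"
  assume P: "P \<in> sylows" and Q: "Q \<in> sylows" and *: "\<And>y. y \<in> Q \<Longrightarrow> conj_set SL2 P y = P"
  show "Q = P"
  proof (rule ccontr)
    assume "Q \<noteq> P"
    then obtain x where x: "x \<in> carrier SL2" "conj_set SL2 unipotent x = P" "conj_set SL2 unipotent (f_mat ** x) = Q"
      using ex_conj_pair[OF P Q] by blast
    \<comment> \<open>In the reference pair the second group contains the lower unitriangular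
      \<open>?v\<close>, whose lower left entry 1 prevents it from normalizing the first.
      Conjugation by x carries this over to Q and P.\<close>
    let ?v = "conj_by SL2 f_mat (mat2 1 1 0 (1::'a))"
    have v: "?v = mat2 1 0 1 (1::'a)"
      using conj_unipotent[of 0 0 1 1 1] by (simp add: f_mat_def)
    then have vG: "?v \<in> carrier SL2" by (simp add: v)
    have "conj_by SL2 x ?v \<in> Q"
    proof -
      have "conj_by SL2 x ?v = conj_by SL2 (f_mat \<otimes>\<^bsub>SL2\<^esub> x) (mat2 1 1 0 1)"
        unfolding mult_SL2[symmetric] by (rule SL2.conj_by_conj_by[OF f_closed x(1)]) simp
      then show ?thesis unfolding x(3)[symmetric] conj_set_def by (auto simp: image_iff)
    qed
    then have "conj_set SL2 P (conj_by SL2 x ?v) = P" by (rule *)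
    moreover have "x \<otimes>\<^bsub>SL2\<^esub> conj_by SL2 x ?v = ?v \<otimes>\<^bsub>SL2\<^esub> x"
      using x(1) vG by (simp add: conj_by_def SL2.m_assoc del: mult_SL2 carrier_SL2)
    ultimately have "conj_set SL2 unipotent (?v \<otimes>\<^bsub>SL2\<^esub> x) = conj_set SL2 unipotent x"
      using SL2.conj_set_conj_set[OF unipotent_sub x(1) SL2.conj_by_closed[OF x(1) vG]] x(2) by simp
    then have "conj_set SL2 unipotent ((?v \<otimes>\<^bsub>SL2\<^esub> x) \<otimes>\<^bsub>SL2\<^esub> inv\<^bsub>SL2\<^esub> x) = unipotent"
      using SL2.conj_set_eq_iff[OF unipotent_sub SL2.m_closed[OF vG x(1)] x(1)] by blast
    then have "conj_set SL2 unipotent ?v = unipotent"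
      using x(1) vG by (simp add: SL2.m_assoc del: mult_SL2 carrier_SL2)
    then show False
      unfolding v using conj_unipotent_eq_iff[of 1 1 0 1] by simp
  qed
next
  fix P Q :: "('a^2^2) set"
  \<comment> \<open>The projective points (0 : 1), (1 : 0) and (1 : 1) give three different groups,
    so one of them avoids both P and Q.\<close>
  let ?A = "conj_set SL2 unipotent (mat2 1 0 0 1) :: ('a^2^2) set" and ?B = "conj_set SL2 unipotent (mat2 0 1 1 0) :: ('a^2^2) set"
    and ?C = "conj_set SL2 unipotent (mat2 1 0 1 1) :: ('a^2^2) set"
  have "?A \<in> sylows" "?B \<in> sylows" "?C \<in> sylows" by (rule sylowsI; simp)+
  moreover have "?A \<noteq> ?B" "?A \<noteq> ?C" "?B \<noteq> ?C"
    using conj_unipotent_eq_conj_iff[of 1 1 0 0 0 0 1 1] conj_unipotent_eq_conj_iff[of 1 1 0 0 1 1 0 1]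
      conj_unipotent_eq_conj_iff[of 0 0 1 1 1 1 0 1] by auto
  ultimately show "\<exists>R\<in>sylows. R \<noteq> P \<and> R \<noteq> Q" by metis
qed

end

section \<open>Split metacyclic groups\<close>

context group
begin

lemma pow_eq_iff_mod:
  assumes "a \<in> carrier G"
  shows "a [^] (i::nat) = a [^] j \<longleftrightarrow> i mod ord a = j mod ord a"
proof -
  have "a [^] i = a [^] j \<longleftrightarrow> a [^] int i = a [^] int j"
    by (simp add: int_pow_int)
  also have "\<dots> \<longleftrightarrow> int i mod int (ord a) = int j mod int (ord a)"
    using int_pow_eq[OF assms] by (metis mod_eq_dvd_iff)
  also have "\<dots> \<longleftrightarrow> i mod ord a = j mod ord a"
    by (metis of_nat_eq_iff zmod_int)
  finally show ?thesis .
qed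

lemma generate_singleton_eq:
  assumes "a \<in> carrier G" "ord a > 0"
  shows "generate G {a} = (\<lambda>k::nat. a [^] k) ` {..<ord a}"
proof -
  have "a [^] k \<in> (\<lambda>k::nat. a [^] k) ` {..<ord a}" for k :: nat
    using pow_eq_iff_mod[OF assms(1), of k "k mod ord a"] assms(2) by (intro image_eqI[of _ _ "k mod ord a"]) auto
  then show ?thesis using generate_pow_nat[OF assms(1)] assms(2) by auto
qed

lemma generate_singleton_iff:
  assumes "a \<in> carrier G" "ord a > 0"
  shows "x \<in> generate G {a} \<longleftrightarrow> (\<exists>k::nat. x = a [^] k)"
  using generate_pow_nat[OF assms(1)] assms(2) by auto

lemma generate_singleton_iso:
  assumes a: "a \<in> carrier G" and n: "ord a > 0"
  shows "G\<lparr>carrier := generate G {a}\<rparr> \<cong> integer_mod_group (ord a)"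
proof -
  let ?h = "\<lambda>x. a [^] nat x"
  have "?h ` {0..<int (ord a)} = (\<lambda>k::nat. a [^] k) ` (nat ` {0..<int (ord a)})"
    by (simp add: image_image)
  also have "nat ` {0..<int (ord a)} = {..<ord a}"
    by (auto simp: image_iff intro!: bexI[of _ "int _"])
  finally have im: "?h ` {0..<int (ord a)} = generate G {a}"
    using generate_singleton_eq[OF assms] by simp
  have "inj_on ?h {0..<int (ord a)}"
  proof (rule inj_onI)
    fix x y assume "x \<in> {0..<int (ord a)}" "y \<in> {0..<int (ord a)}" "a [^] nat x = a [^] nat y"
    moreover from this have "nat x = nat y" using pow_eq_iff_mod[OF a, of "nat x" "nat y"] by (simp add: nat_less_iff)
    ultimately show "x = y" by (simp add: eq_nat_nat_iff)
  qed
  moreover have "a [^] nat ((x + y) mod int (ord a)) = a [^] nat x \<otimes> a [^] nat y"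
    if "0 \<le> x" "0 \<le> y" for x y
  proof -
    have "nat ((x + y) mod int (ord a)) = (nat x + nat y) mod ord a"
      using that by (simp add: nat_mod_distrib nat_add_distrib)
    then show ?thesis
      using pow_eq_iff_mod[OF a, of "(nat x + nat y) mod ord a" "nat x + nat y"] a by (simp add: nat_pow_mult)
  qed
  ultimately have "?h \<in> iso (integer_mod_group (ord a)) (G\<lparr>carrier := generate G {a}\<rparr>)"
    using im n by (auto simp: iso_def hom_def bij_betw_def carrier_integer_mod_group)
  then show ?thesis
    using group.iso_sym[OF group_integer_mod_group] is_isoI by blast
qed

end

text \<open>Conjugation by b^k on the cyclic group generated by a, seen on exponents when b a = a^r
  b: multiplication by r^k modulo n. The restriction to the carrier makes it an element of
  \<open>AutoGroup\<close>.\<close>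

definition residue_scale :: "nat \<Rightarrow> nat \<Rightarrow> nat \<Rightarrow> int \<Rightarrow> int" where
  "residue_scale n r k = (\<lambda>y\<in>carrier (integer_mod_group n). int ((r ^ k * nat y) mod n))"

text \<open>The inverse of multiplication by r^k is multiplication by r^(m - k), because r^m is 1
  modulo n.\<close>

lemma residue_scale_in_auto:
  assumes n: "n > 0" and r: "r ^ m mod n = 1 mod n" and k: "k \<le> m"
  shows "residue_scale n r k \<in> auto (integer_mod_group n)"
proof -
  let ?C = "carrier (integer_mod_group n)"
  have C: "?C = {0..<int n}" using n by (simp add: carrier_integer_mod_group)
  have inv: "residue_scale n r l (residue_scale n r k' y) = y" if "k' + l = m" "y \<in> ?C" for k' l y
  proof -
    have y: "nat y < n" "int (nat y) = y" "0 \<le> y" using that C by auto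
    have "(r ^ l * ((r ^ k' * nat y) mod n)) mod n = (r ^ l * (r ^ k' * nat y)) mod n"
      by (rule mod_mult_right_eq)
    also have "\<dots> = (r ^ m * nat y) mod n" by (simp add: mult.assoc mult.left_commute power_add flip: that(1))
    also have "\<dots> = ((r ^ m mod n) * nat y) mod n" by (simp only: mod_mult_left_eq)
    also have "\<dots> = nat y" unfolding r by (simp only: mod_mult_left_eq mult_1 mod_less[OF y(1)])
    finally show ?thesis using that(2) y n by (simp add: residue_scale_def C nat_less_iff)
  qed
  have closed: "residue_scale n r l y \<in> ?C" if "y \<in> ?C" for l y
    using that n by (simp add: residue_scale_def C)
  have "bij_betw (residue_scale n r k) ?C ?C"
    by (rule bij_betw_byWitness[where f' = "residue_scale n r (m - k)"]) (use inv closed k in auto)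
  moreover have "residue_scale n r k \<in> extensional ?C"
    by (simp add: residue_scale_def)
  moreover have "residue_scale n r k ((x + y) mod int n) = (residue_scale n r k x + residue_scale n r k y) mod int n"
    if "x \<in> ?C" "y \<in> ?C" for x y
  proof -
    have "nat ((x + y) mod int n) = (nat x + nat y) mod n"
      using that C by (simp add: nat_mod_distrib nat_add_distrib)
    moreover have "(x + y) mod int n \<in> ?C" using n by (simp add: C)
    ultimately show ?thesis
      using that by (simp add: residue_scale_def mod_mult_right_eq mod_add_eq distrib_left flip: of_nat_add of_nat_mod zmod_int)
  qed
  ultimately show ?thesis
    using closed by (auto simp: auto_def Bij_def hom_def)
qed

text \<open>Exponents of r are added modulo m, which is harmless because r^m is 1 modulo n.\<close>

lemma residue_scale_hom:
  assumes n: "n > 0" and m: "m > 0" and r: "r ^ m mod n = 1 mod n"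
  shows "(\<lambda>k. residue_scale n r (nat k)) \<in> hom (integer_mod_group m) (AutoGroup (integer_mod_group n))"
proof (rule homI)
  fix k assume "k \<in> carrier (integer_mod_group m)"
  then have "nat k \<le> m" using m by (auto simp: carrier_integer_mod_group)
  then show "residue_scale n r (nat k) \<in> carrier (AutoGroup (integer_mod_group n))"
    using residue_scale_in_auto[OF n r] by (simp add: AutoGroup_def)
next
  fix k l assume k: "k \<in> carrier (integer_mod_group m)" and l: "l \<in> carrier (integer_mod_group m)"
  then have kl: "nat k \<le> m" "nat l \<le> m" "0 \<le> k" "0 \<le> l" using m by (auto simp: carrier_integer_mod_group)
  have "nat ((k + l) mod int m) = (nat k + nat l) mod m"
    using kl by (simp add: nat_mod_distrib nat_add_distrib)
  moreover have r_mod: "r ^ (e mod m) mod n = r ^ e mod n" for e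
  proof -
    have "r ^ e mod n = ((r ^ m) ^ (e div m) * r ^ (e mod m)) mod n"
      by (metis mult_div_mod_eq power_add power_mult)
    also have "\<dots> = ((r ^ m mod n) ^ (e div m) * r ^ (e mod m)) mod n"
      by (metis mod_mult_left_eq power_mod)
    also have "\<dots> = r ^ (e mod m) mod n"
      unfolding r by (metis mod_mult_left_eq power_mod power_one mult_1)
    finally show ?thesis by simp
  qed
  ultimately have "residue_scale n r (nat ((k + l) mod int m)) y = residue_scale n r (nat k) (residue_scale n r (nat l) y)"
    if y: "y \<in> carrier (integer_mod_group n)" for y
  proof -
    have "(r ^ ((nat k + nat l) mod m) * nat y) mod n = (r ^ (nat k + nat l) * nat y) mod n"
      by (metis mod_mult_left_eq r_mod)
    then show ?thesis
      using y n \<open>nat ((k + l) mod int m) = _\<close>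
      by (simp add: residue_scale_def carrier_integer_mod_group mod_mult_right_eq power_add mult.assoc)
  qed
  moreover have "residue_scale n r e \<in> Bij (carrier (integer_mod_group n))" if "e \<le> m" for e
    using residue_scale_in_auto[OF n r that] by (simp add: auto_def)
  ultimately show "residue_scale n r (nat (k \<otimes>\<^bsub>integer_mod_group m\<^esub> l)) =
      residue_scale n r (nat k) \<otimes>\<^bsub>AutoGroup (integer_mod_group n)\<^esub> residue_scale n r (nat l)"
    using kl by (auto simp: AutoGroup_def BijGroup_def compose_def residue_scale_def fun_eq_iff)
qed

context group
begin

context
  fixes a b and r :: nat
  assumes a: "a \<in> carrier G" and b: "b \<in> carrier G"
    and ord_a: "ord a > 0" and ord_b: "ord b > 0"
    and rel: "b \<otimes> a = a [^] r \<otimes> b"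
    and triv: "generate G {a} \<inter> generate G {b} = {\<one>}"
begin

text \<open>Moving one b to the right past a^x multiplies the exponent of a by r; k factors b
  contribute r^k.\<close>

lemma metacyclic_commute: "b [^] (k::nat) \<otimes> a [^] (x::nat) = a [^] (r ^ k * x) \<otimes> b [^] k"
proof (induction k arbitrary: x)
  case 0
  then show ?case using a by simp
next
  case (Suc k)
  have 1: "b \<otimes> a [^] (x::nat) = a [^] (r * x) \<otimes> b" for x
  proof (induction x)
    case 0
    then show ?case using b by simp
  next
    case (Suc x)
    have "b \<otimes> a [^] Suc x = (b \<otimes> a [^] x) \<otimes> a" using a b by (simp add: m_assoc)
    also have "\<dots> = a [^] (r * x) \<otimes> (b \<otimes> a)" unfolding Suc using a b by (simp add: m_assoc)
    also have "\<dots> = a [^] (r * Suc x) \<otimes> b" unfolding rel using a b by (simp add: nat_pow_mult add.commute flip: m_assoc)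
    finally show ?case .
  qed
  have "b [^] Suc k \<otimes> a [^] x = b [^] k \<otimes> (b \<otimes> a [^] x)" using a b by (simp add: m_assoc)
  also have "\<dots> = (b [^] k \<otimes> a [^] (r * x)) \<otimes> b" unfolding 1 using a b by (simp add: m_assoc)
  also have "\<dots> = a [^] (r ^ Suc k * x) \<otimes> b [^] Suc k" unfolding Suc using a b by (simp add: m_assoc mult_ac)
  finally show ?case .
qed

lemma metacyclic_iff: "x \<in> generate G {a} <#> generate G {b} \<longleftrightarrow> (\<exists>(i::nat) (j::nat). x = a [^] i \<otimes> b [^] j)"
proof -
  have "y \<in> generate G {a} \<longleftrightarrow> (\<exists>i::nat. y = a [^] i)" "y \<in> generate G {b} \<longleftrightarrow> (\<exists>i::nat. y = b [^] i)" for y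
    using generate_singleton_iff a b ord_a ord_b by blast+
  then show ?thesis unfolding set_mult_def by (simp only: UN_iff singleton_iff bex_simps Bex_def) blast
qed

lemma metacyclic_subgroup: "subgroup (generate G {a} <#> generate G {b}) G"
proof (rule subgroupI)
  show "generate G {a} <#> generate G {b} \<subseteq> carrier G"
  proof
    fix x assume "x \<in> generate G {a} <#> generate G {b}"
    then obtain i j :: nat where "x = a [^] i \<otimes> b [^] j" using metacyclic_iff by blast
    then show "x \<in> carrier G" using a b by simp
  qed
  show "generate G {a} <#> generate G {b} \<noteq> {}"
    using metacyclic_iff by blast
next
  fix x assume "x \<in> generate G {a} <#> generate G {b}"
  then obtain i j :: nat where x: "x = a [^] i \<otimes> b [^] j" using metacyclic_iff by blast
  \<comment> \<open>Finite order turns inverses of powers into powers with natural exponents, to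
    which the commutation rule applies.\<close>
  have "inv (c [^] k) \<in> generate G {c}" if "c \<in> carrier G" "ord c > 0" for c and k :: nat
    using that generate_singleton_iff generate_is_subgroup[of "{c}"] by (intro subgroup.m_inv_closed) auto
  then obtain i' j' :: nat where "inv (a [^] i) = a [^] i'" "inv (b [^] j) = b [^] j'"
    using a b ord_a ord_b generate_singleton_iff by metis
  then have "inv x = b [^] j' \<otimes> a [^] i'" using x a b by (simp add: inv_mult_group)
  then show "inv x \<in> generate G {a} <#> generate G {b}"
    using metacyclic_commute metacyclic_iff by auto
next
  fix x y assume "x \<in> generate G {a} <#> generate G {b}" "y \<in> generate G {a} <#> generate G {b}"
  then obtain i j k l :: nat where xy: "x = a [^] i \<otimes> b [^] j" "y = a [^] k \<otimes> b [^] l"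
    using metacyclic_iff by metis
  have "x \<otimes> y = a [^] i \<otimes> (b [^] j \<otimes> a [^] k) \<otimes> b [^] l" using xy a b by (simp add: m_assoc)
  also have "\<dots> = a [^] (i + r ^ j * k) \<otimes> b [^] (j + l)"
    unfolding metacyclic_commute using a b by (simp add: m_assoc flip: nat_pow_mult)
  finally show "x \<otimes> y \<in> generate G {a} <#> generate G {b}" using metacyclic_iff by blast
qed

lemma metacyclic_internal_semidirect:
  "internal_semidirect (G\<lparr>carrier := generate G {a} <#> generate G {b}\<rparr>) (generate G {a}) (generate G {b})"
proof -
  let ?K = "generate G {a} <#> generate G {b}"
  interpret K: subgroup ?K G by (rule metacyclic_subgroup)
  interpret GK: group "G\<lparr>carrier := ?K\<rparr>" by (rule K.subgroup_is_group) (rule is_group)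
  have sub_a: "generate G {a} \<subseteq> ?K"
  proof
    fix x assume "x \<in> generate G {a}"
    then obtain i :: nat where "x = a [^] i \<otimes> b [^] (0::nat)" using generate_singleton_iff a ord_a by auto
    then show "x \<in> ?K" using metacyclic_iff by blast
  qed
  have sub_b: "generate G {b} \<subseteq> ?K"
  proof
    fix x assume "x \<in> generate G {b}"
    then obtain i :: nat where "x = a [^] (0::nat) \<otimes> b [^] i" using generate_singleton_iff b ord_b by auto
    then show "x \<in> ?K" using metacyclic_iff by blast
  qed
  have "generate G {a} \<lhd> G\<lparr>carrier := ?K\<rparr>"
  proof (rule GK.normal_invI)
    show "subgroup (generate G {a}) (G\<lparr>carrier := ?K\<rparr>)"
      using subgroup_incl[OF generate_is_subgroup metacyclic_subgroup sub_a] a by simp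
  next
    fix x h assume x: "x \<in> carrier (G\<lparr>carrier := ?K\<rparr>)" and h: "h \<in> generate G {a}"
    obtain i j k :: nat where xh: "x = a [^] i \<otimes> b [^] j" "h = a [^] k"
      using x h metacyclic_iff generate_singleton_iff a ord_a by auto
    have "x \<otimes> h \<otimes> inv x = a [^] i \<otimes> (b [^] j \<otimes> a [^] k) \<otimes> inv (b [^] j) \<otimes> inv (a [^] i)"
      using xh a b by (simp add: inv_mult_group m_assoc)
    also have "\<dots> = a [^] (r ^ j * k)"
    proof -
      have "a [^] i \<otimes> (a [^] (r ^ j * k) \<otimes> b [^] j) \<otimes> inv (b [^] j) \<otimes> inv (a [^] i) =
          (a [^] i \<otimes> a [^] (r ^ j * k)) \<otimes> inv (a [^] i)"
        using a b by (simp add: m_assoc)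
      also have "a [^] i \<otimes> a [^] (r ^ j * k) = a [^] (r ^ j * k) \<otimes> a [^] i"
        using a by (simp add: nat_pow_mult add.commute)
      finally show ?thesis unfolding metacyclic_commute using a by (simp add: m_assoc)
    qed
    finally have "x \<otimes> h \<otimes> inv x \<in> generate G {a}"
      using generate_singleton_iff a ord_a by blast
    then show "x \<otimes>\<^bsub>G\<lparr>carrier := ?K\<rparr>\<^esub> h \<otimes>\<^bsub>G\<lparr>carrier := ?K\<rparr>\<^esub> inv\<^bsub>G\<lparr>carrier := ?K\<rparr>\<^esub> x \<in> generate G {a}"
      using m_inv_consistent[OF metacyclic_subgroup] x by simp
  qed
  moreover have "subgroup (generate G {b}) (G\<lparr>carrier := ?K\<rparr>)"
    using subgroup_incl[OF generate_is_subgroup metacyclic_subgroup sub_b] b by simp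
  ultimately show ?thesis
    using triv by (simp add: internal_semidirect_def set_mult_def)
qed

lemma metacyclic_iso:
  "\<exists>\<theta>\<in>hom (integer_mod_group (ord b)) (AutoGroup (integer_mod_group (ord a))).
     G\<lparr>carrier := generate G {a} <#> generate G {b}\<rparr>
       \<cong> semidirect_product (integer_mod_group (ord a)) (integer_mod_group (ord b)) \<theta>"
proof -
  let ?K = "generate G {a} <#> generate G {b}" and ?n = "ord a" and ?m = "ord b"
  let ?S = "semidirect_product (integer_mod_group ?n) (integer_mod_group ?m) (\<lambda>k. residue_scale ?n r (nat k))"
  have Cn: "carrier (integer_mod_group ?n) = {0..<int ?n}" "carrier (integer_mod_group ?m) = {0..<int ?m}"
    using ord_a ord_b by (simp_all add: carrier_integer_mod_group)
  \<comment> \<open>Moving b to the power of its order, which is 1, past a leaves a unchanged; this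
    yields r^m = 1 modulo n, the condition for \<open>residue_scale\<close> to be an action of the
    residues modulo m.\<close>
  have "a [^] (r ^ ?m) = a [^] (1::nat)"
    using metacyclic_commute[of ?m 1] a b by simp
  then have "r ^ ?m mod ?n = 1 mod ?n" using pow_eq_iff_mod[OF a] by blast
  from residue_scale_hom[OF ord_a ord_b this]
  have \<theta>: "(\<lambda>k. residue_scale ?n r (nat k)) \<in> hom (integer_mod_group ?m) (AutoGroup (integer_mod_group ?n))" .
  define \<psi> where "\<psi> = (\<lambda>(x, k). a [^] nat x \<otimes> b [^] nat k)"
  have red: "c [^] (e mod ord c) = c [^] e" if "c \<in> carrier G" for c and e :: nat
    using pow_eq_iff_mod[OF that] by simp
  have hom: "\<psi> (p \<otimes>\<^bsub>?S\<^esub> q) = \<psi> p \<otimes> \<psi> q" if "p \<in> carrier ?S" "q \<in> carrier ?S" for p q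
  proof -
    obtain x k y l where pq: "p = (x, k)" "q = (y, l)" by (cases p; cases q)
    have nn: "0 \<le> x" "0 \<le> y" "0 \<le> k" "0 \<le> l" and yC: "y \<in> carrier (integer_mod_group ?n)"
      using that pq by (auto simp: semidirect_product_def Cn)
    have 1: "nat ((x + residue_scale ?n r (nat k) y) mod int ?n) = (nat x + (r ^ nat k * nat y) mod ?n) mod ?n"
      using nn yC by (simp add: residue_scale_def nat_mod_distrib nat_add_distrib)
    have 2: "nat ((k + l) mod int ?m) = (nat k + nat l) mod ?m"
      using nn by (simp add: nat_mod_distrib nat_add_distrib)
    have "\<psi> (p \<otimes>\<^bsub>?S\<^esub> q) = a [^] (nat x + r ^ nat k * nat y) \<otimes> b [^] (nat k + nat l)"
      using red[OF a] red[OF b] a by (simp add: \<psi>_def pq semidirect_product_def 1 2 mod_add_right_eq)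
    also have "\<dots> = a [^] nat x \<otimes> (b [^] nat k \<otimes> a [^] nat y) \<otimes> b [^] nat l"
      unfolding metacyclic_commute using a b by (simp add: m_assoc flip: nat_pow_mult)
    also have "\<dots> = \<psi> p \<otimes> \<psi> q" using a b by (simp add: \<psi>_def pq m_assoc)
    finally show ?thesis .
  qed
  have im: "\<psi> ` carrier ?S = ?K"
  proof
    show "\<psi> ` carrier ?S \<subseteq> ?K" using metacyclic_iff by (auto simp: \<psi>_def semidirect_product_def)
    show "?K \<subseteq> \<psi> ` carrier ?S"
    proof
      fix x assume "x \<in> ?K"
      then obtain i j :: nat where "x = a [^] i \<otimes> b [^] j" using metacyclic_iff by blast
      then have "x = \<psi> (int (i mod ?n), int (j mod ?m))" using red a b by (simp add: \<psi>_def del: of_nat_mod)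
      moreover have "(int (i mod ?n), int (j mod ?m)) \<in> carrier ?S"
        using ord_a ord_b by (simp add: semidirect_product_def Cn)
      ultimately show "x \<in> \<psi> ` carrier ?S" by blast
    qed
  qed
  have inj: "inj_on \<psi> (carrier ?S)"
  proof (rule inj_onI)
    fix p q assume p: "p \<in> carrier ?S" and q: "q \<in> carrier ?S" and eq: "\<psi> p = \<psi> q"
    obtain x k y l where pq: "p = (x, k)" "q = (y, l)" by (cases p; cases q)
    have mem: "a [^] nat x \<in> generate G {a}" "a [^] nat y \<in> generate G {a}"
        "b [^] nat k \<in> generate G {b}" "b [^] nat l \<in> generate G {b}"
      using generate_singleton_iff a b ord_a ord_b by blast+
    interpret A: subgroup "generate G {a}" G using generate_is_subgroup a by simp
    interpret B: subgroup "generate G {b}" G using generate_is_subgroup b by simp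
    \<comment> \<open>Equal products are rearranged so that powers of a stand on one side and powers
      of b on the other; the common value lies in both cyclic subgroups and is trivial.\<close>
    have "inv (a [^] nat y) \<otimes> a [^] nat x = b [^] nat l \<otimes> inv (b [^] nat k)"
    proof -
      have "a [^] nat x = a [^] nat y \<otimes> b [^] nat l \<otimes> inv (b [^] nat k)"
        using eq a b by (simp add: \<psi>_def pq inv_solve_right)
      then show ?thesis using a b by (simp add: m_assoc)
    qed
    moreover have "inv (a [^] nat y) \<otimes> a [^] nat x \<in> generate G {a}" "b [^] nat l \<otimes> inv (b [^] nat k) \<in> generate G {b}"
      using mem by simp_all
    ultimately have *: "inv (a [^] nat y) \<otimes> a [^] nat x = \<one>" "b [^] nat l \<otimes> inv (b [^] nat k) = \<one>"
      using triv by auto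
    then have "a [^] nat x = a [^] nat y"
      using a by (metis inv_r_cancel nat_pow_closed r_one)
    moreover have "b [^] nat l = b [^] nat k"
      using *(2) b by (metis inv_equality inv_inv nat_pow_closed inv_closed)
    ultimately show "p = q"
      using p q pow_eq_iff_mod[OF a] pow_eq_iff_mod[OF b] by (auto simp: pq semidirect_product_def Cn)
  qed
  have "\<psi> \<in> iso ?S (G\<lparr>carrier := ?K\<rparr>)"
    using hom im inj by (auto simp: iso_def hom_def bij_betw_def)
  moreover have "bij_betw \<psi> (carrier ?S) ?K" using im inj by (simp add: bij_betw_def)
  ultimately have "inv_into (carrier ?S) \<psi> \<in> iso (G\<lparr>carrier := ?K\<rparr>) ?S"
  proof -
    have cl: "p \<otimes>\<^bsub>?S\<^esub> q \<in> carrier ?S" if "p \<in> carrier ?S" "q \<in> carrier ?S" for p q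
      using that ord_a ord_b by (auto simp: semidirect_product_def Cn)
    let ?f = "inv_into (carrier ?S) \<psi>"
    have "?f (x \<otimes> y) = ?f x \<otimes>\<^bsub>?S\<^esub> ?f y" if "x \<in> ?K" "y \<in> ?K" for x y
    proof -
      have xy: "\<psi> (?f x) = x" "\<psi> (?f y) = y" "?f x \<in> carrier ?S" "?f y \<in> carrier ?S"
        using that im by (auto simp: f_inv_into_f inv_into_into)
      then have "x \<otimes> y = \<psi> (?f x \<otimes>\<^bsub>?S\<^esub> ?f y)" using hom by metis
      then show ?thesis using inv_into_f_f[OF inj cl[OF xy(3,4)]] by simp
    qed
    then show ?thesis
      using bij_betw_inv_into[OF \<open>bij_betw \<psi> (carrier ?S) ?K\<close>]
      by (auto simp: iso_def hom_def bij_betw_def)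
  qed
  then show ?thesis using \<theta> is_isoI by blast
qed

end

end

section \<open>The partition condition\<close>

definition base_list :: "m8 list \<Rightarrow> bool" where
  "base_list D = (if elem idM D then if distinct D then if length D = 9 then every (\<lambda>m. detM m = Z0) D else False else False else False)"

text \<open>The lower left entry of h c^-1 vanishes iff h and c conjugate the upper unitriangular
  group to the same subgroup. \<open>CM_transitive\<close> thus says that C is transitive on the
  conjugates.\<close>

definition moves_to :: "m8 \<Rightarrow> m8 \<Rightarrow> bool" where
  "moves_to h c = (fst (snd (snd (mulM h (adjM c)))) = Zero)"
definition some_moves :: "m8 list \<Rightarrow> m8 \<Rightarrow> bool" where
  "some_moves Cs h = any (moves_to h) Cs"

lemma base_list_CM: "base_list CM" by code_simp
lemma gM_pow_9: "mulM gM ((mulM gM ^^ 8) idM) = idM" by code_simp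
text \<open>The power g^3 is not upper triangular and hence does not normalize the upper
  unitriangular group. This shows that conjugation by g has order 9, not merely g itself.\<close>

lemma gM_pow_3: "fst (snd (snd ((mulM gM ^^ 3) idM))) \<noteq> Zero" by code_simp
lemma CM_transitive: "every_sl8 (some_moves CM)" by code_simp
text \<open>The exponent 7 has order 3 modulo 9; together with 8, which is -1, it generates all
  units modulo 9.\<close>

lemma frobM_gM: "frobM gM = (mulM gM ^^ 7) idM" by code_simp
text \<open>Conjugation by f exchanges the rows and the columns; as g is symmetric, the result is
  the adjugate of g, which is its inverse g^8.\<close>

lemma conjM_fM_gM: "conjM fM gM = (mulM gM ^^ 8) idM" by code_simp
text \<open>The conjugating matrix is the unitriangular one with entry z; it is the witness used to
  exclude anti-automorphisms.\<close>

lemma CM_not_normal: "\<not> elem (conjM (Z0, Z1, Zero, Z0) gM) CM" by code_simp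

lemma base_list_iff: "base_list D \<longleftrightarrow> idM \<in> set D \<and> distinct D \<and> length D = 9 \<and> (\<forall>m\<in>set D. detM m = Z0)"
  by (auto simp: base_list_def)

lemma in_set_hits: "(D', y) \<in> set (hits h D ys) \<longleftrightarrow> D' = D \<and> y \<in> set ys \<and> mulM h y \<in> set D"
  by (induction ys) auto

lemma in_set_witD: "(D, y) \<in> set (witD F h) \<longleftrightarrow> D \<in> set F \<and> y \<in> set D \<and> mulM h y \<in> set D"
  by (induction F) (auto simp: in_set_hits)

lemma in_set_wit:
  "(D, y) \<in> set (wit F h) \<longleftrightarrow> (D = [] \<and> y = h \<and> h \<in> set CM) \<or> (D = [] \<and> y = idM \<and> traceM h = Zero)
      \<or> (D \<in> set F \<and> y \<in> set D \<and> mulM h y \<in> set D)"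
  by (auto simp: wit_def in_set_witD)

lemma is_single_iff: "is_single xs \<longleftrightarrow> (\<exists>x. xs = [x])"
  by (cases xs rule: is_single.cases) auto

lemma (in group) conj_set_minus_one:
  assumes D: "D \<subseteq> carrier G" and x: "x \<in> carrier G"
  shows "conj_set G (D - {\<one>}) x = conj_set G D x - {\<one>}"
proof -
  have "conj_by G x \<one> = \<one>" using x by (simp add: conj_by_def)
  moreover have "conj_by G x y \<noteq> conj_by G x \<one>" if "y \<in> D" "y \<noteq> \<one>" for y
    using inj_onD[OF inj_on_conj_by[OF x], of y \<one>] that D by auto
  ultimately show ?thesis
    unfolding conj_set_def by auto
qed

definition family :: "'a::field \<Rightarrow> m8 list list \<Rightarrow> ('a^2^2) set set" where
  "family z F = (\<lambda>D. valM z ` set D) ` set F"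

context f8_field
begin

sublocale geo: coset_geometry "SL2 :: ('a^2^2) monoid" sylows
  by (rule coset_geometry_sylows)

lemma add_self_right [simp]: "x + y + y = (x::'a)"
  by (simp add: add.assoc)

abbreviation "g \<equiv> g_mat z"
abbreviation "C \<equiv> C_grp z"

lemma g_closed [simp]: "g \<in> carrier SL2"
  using det_g valM_det valM_g by (metis carrier_SL2)

lemma valM_closed: "detM m = Z0 \<Longrightarrow> valM z m \<in> carrier SL2"
  by simp

lemma valM_surj_carrier: "h \<in> carrier SL2 \<Longrightarrow> \<exists>m. detM m = Z0 \<and> h = valM z m"
  using surj_valM by (metis carrier_SL2 valM_det)

lemma valM_pow: "valM z ((mulM gM ^^ n) idM) = g [^]\<^bsub>SL2\<^esub> n"
proof (induction n)
  case (Suc n)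
  then show ?case
    using SL2.nat_pow_Suc2[OF g_closed, of n] by (simp add: valM_mul valM_g)
qed simp

text \<open>By g^9 = 1 the order is at most 9, and a smaller one would make the list
  \<open>CM\<close> of the powers with exponents below 9 repeat its entry at index 0.\<close>

lemma ord_g: "SL2.ord g = 9"
proof -
  have 9: "g [^]\<^bsub>SL2\<^esub> (9::nat) = \<one>\<^bsub>SL2\<^esub>"
    using gM_pow_9 valM_pow[of 9] by (simp add: eval_nat_numeral)
  have "SL2.ord g dvd 9" using SL2.pow_eq_id[OF g_closed] 9 by blast
  then have le: "SL2.ord g \<le> 9" "SL2.ord g > 0" by (auto dest: dvd_imp_le intro: Nat.gr0I)
  have "\<not> SL2.ord g < 9"
  proof
    assume lt: "SL2.ord g < 9"
    have "valM z (CM ! SL2.ord g) = valM z (CM ! 0)"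
      using lt SL2.pow_ord_eq_1[OF g_closed] by (simp add: CM_def valM_pow)
    then have "CM ! SL2.ord g = CM ! 0" by simp
    then have "SL2.ord g = 0"
      using lt base_list_CM by (subst (asm) nth_eq_iff_index_eq) (auto simp: base_list_iff)
    then show False using le by simp
  qed
  then show ?thesis using le by simp
qed

lemma C_eq_powers: "C = (\<lambda>k::nat. g [^]\<^bsub>SL2\<^esub> k) ` {..<9}"
  unfolding C_grp_def using SL2.generate_singleton_eq[OF g_closed] ord_g by simp

lemma C_iff: "x \<in> C \<longleftrightarrow> (\<exists>k::nat. x = g [^]\<^bsub>SL2\<^esub> k)"
  unfolding C_grp_def using SL2.generate_singleton_iff[OF g_closed] ord_g by simp

lemma C_eq: "C = valM z ` set CM"
  by (simp add: C_eq_powers CM_def image_image valM_pow lessThan_atLeast0)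

lemma C_subgroup: "subgroup C SL2"
  unfolding C_grp_def using SL2.generate_is_subgroup[of "{g}"] g_closed by simp

lemma C_sub: "C \<subseteq> carrier SL2"
  using C_subgroup subgroup.subset by blast

lemma inj_valM: "inj_on (valM z) A"
  by (simp add: inj_on_def)

lemma card_valM: "card (valM z ` A) = card A"
  using inj_valM by (rule card_image)

lemma card_C: "card C = 9"
  unfolding C_eq card_valM using base_list_CM distinct_card[of CM] by (simp add: base_list_iff)

lemma unipotent_sylow: "unipotent \<in> (sylows :: ('a^2^2) set set)"
  using sylowsI[of 1 1 0 0] SL2.conj_set_one[OF unipotent_sub] by (simp add: one_SL2)

lemma C_transitive: "P \<in> sylows \<Longrightarrow> \<exists>c\<in>C. P = conj_set SL2 unipotent c"
proof -
  assume "P \<in> sylows"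
  then obtain h where h: "h \<in> carrier SL2" "P = conj_set SL2 unipotent h" by (auto simp: sylows_def)
  obtain m where m: "detM m = Z0" "h = valM z m" using valM_surj_carrier h by blast
  then have "some_moves CM m" using CM_transitive by (simp only: every_sl8_iff)
  then obtain c where c: "c \<in> set CM" "fst (snd (snd (mulM m (adjM c)))) = Zero"
    by (auto simp: some_moves_def moves_to_def)
  have detc: "detM c = Z0" using c base_list_CM by (auto simp: base_list_iff)
  obtain a b d where e: "mulM m (adjM c) = (a, b, Zero, d)" using c(2) by (metis prod.collapse)
  have hc: "h \<otimes>\<^bsub>SL2\<^esub> inv\<^bsub>SL2\<^esub> (valM z c) = mat2 (val8 z a) (val8 z b) 0 (val8 z d)"
    using detc m by (simp flip: valM_mul add: e)
  then have "mat2 (val8 z a) (val8 z b) 0 (val8 z d) \<in> carrier SL2"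
    using SL2.m_closed[OF h(1) SL2.inv_closed[OF valM_closed[OF detc]]] by simp
  then have "conj_set SL2 unipotent (h \<otimes>\<^bsub>SL2\<^esub> inv\<^bsub>SL2\<^esub> (valM z c)) = unipotent"
    unfolding hc using conj_unipotent_eq_iff[of "val8 z a" "val8 z d" "val8 z b" 0] by simp
  then have "conj_set SL2 unipotent h = conj_set SL2 unipotent (valM z c)"
    using SL2.conj_set_eq_iff[OF unipotent_sub h(1) valM_closed[OF detc]] by blast
  then show ?thesis using h c C_eq by blast
qed

text \<open>Up to conjugation the pair consists of the upper and the lower unitriangular group,
  which meet only in the identity.\<close>

lemma sylows_inter:
  assumes "P \<in> sylows" "Q \<in> (sylows :: ('a^2^2) set set)" "P \<noteq> Q"
  shows "P \<inter> Q = {\<one>\<^bsub>SL2\<^esub>}"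
proof -
  obtain x where x: "x \<in> carrier SL2" "conj_set SL2 unipotent x = P" "conj_set SL2 unipotent (f_mat ** x) = Q"
    using ex_conj_pair assms by blast
  have 1: "\<one>\<^bsub>SL2\<^esub> \<in> P \<inter> Q"
    using geo.PP_subgroup assms subgroup.one_closed by blast
  have "h = \<one>\<^bsub>SL2\<^esub>" if h: "h \<in> P" "h \<in> Q" for h
  proof -
    obtain u where u: "u \<in> unipotent" "h = conj_by SL2 x u" using h x by (auto simp: conj_set_def)
    obtain v where v: "v \<in> unipotent" "h = conj_by SL2 (f_mat \<otimes>\<^bsub>SL2\<^esub> x) v" using h x by (auto simp: conj_set_def)
    have uv: "u \<in> carrier SL2" "v \<in> carrier SL2" using u v unipotent_sub by auto
    have "conj_by SL2 x u = conj_by SL2 x (conj_by SL2 f_mat v)"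
      using u(2) v(2) SL2.conj_by_conj_by[OF f_closed x(1) uv(2)] by simp
    then have "u = conj_by SL2 f_mat v"
      using SL2.inj_on_conj_by[OF x(1)] uv SL2.conj_by_closed[OF f_closed uv(2)] by (meson inj_onD)
    moreover obtain s t where "u = mat2 1 s 0 1" "v = mat2 1 t 0 1" using u v by (auto simp: unipotent_def)
    ultimately have "u = \<one>\<^bsub>SL2\<^esub>"
      using conj_unipotent[of 0 0 1 1 t] by (simp add: f_mat_def one_SL2)
    then show ?thesis using u x(1) by (simp add: conj_by_def del: mult_SL2 carrier_SL2)
  qed
  then show ?thesis using 1 by blast
qed

lemma card_sylow: "P \<in> sylows \<Longrightarrow> card (P :: ('a^2^2) set) = 8"
  unfolding sylows_def using SL2.card_conj_set[OF unipotent_sub] card_unipotent by auto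

lemma finite_SL2: "finite (carrier (SL2 :: ('a^2^2) monoid))"
proof -
  have "finite (UNIV :: m8 set)"
  proof -
    have "(UNIV :: f8 set) = set all8" by simp
    then have "finite (UNIV :: f8 set)" by (metis finite_set)
    then show ?thesis by (intro finite_Prod_UNIV)
  qed
  then have "finite (range (valM z))" by simp
  then show ?thesis by (rule rev_finite_subset) (use surj_valM in blast)
qed

text \<open>For nonzero d the entries b, c, d are free and determine a, which gives 8 * 8 * 7 = 448
  matrices; for d = 0 the entries a and nonzero c determine b, which gives 8 * 7 = 56.\<close>

lemma order_SL2: "order (SL2 :: ('a^2^2) monoid) = 504"
proof -
  let ?S = "UNIV \<times> UNIV \<times> (UNIV - {0}) :: ('a \<times> 'a \<times> 'a) set"
    and ?R = "UNIV \<times> (UNIV - {0}) :: ('a \<times> 'a) set"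
  let ?f = "\<lambda>(b, c, d). mat2 ((1 + b * c) / d) b c d" and ?k = "\<lambda>(a, c). mat2 a (1 / c) c (0::'a)"
  have "carrier (SL2 :: ('a^2^2) monoid) = ?f ` ?S \<union> ?k ` ?R"
  proof
    show "carrier (SL2 :: ('a^2^2) monoid) \<subseteq> ?f ` ?S \<union> ?k ` ?R"
    proof
      fix A :: "'a^2^2" assume A: "A \<in> carrier SL2"
      obtain a b c d where [simp]: "A = mat2 a b c d" by (rule mat2_cases)
      have det: "a * d + b * c = 1" using A by simp
      show "A \<in> ?f ` ?S \<union> ?k ` ?R"
      proof (cases "d = 0")
        case True
        then have "A = ?k (a, c)" "c \<noteq> 0" using det by (auto simp: eq_divide_eq)
        then show ?thesis by blast
      next
        case False
        have "a * d = 1 + b * c" using det by (metis add.commute add_self_left)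
        then have "A = ?f (b, c, d)" using False by (simp add: field_simps)
        then show ?thesis using False by blast
      qed
    qed
  qed (auto split: if_splits)
  moreover have "?f ` ?S \<inter> ?k ` ?R = {}" by auto
  moreover have "card (?f ` ?S) = 448" "card (?k ` ?R) = 56"
    by (subst card_image; auto simp: inj_on_def card_cartesian_product card card_Diff_singleton)+
  ultimately show ?thesis
    unfolding order_def by (simp add: card_Un_disjoint)
qed

lemma trace_square: "trace (A ** A) = (trace (A::'a^2^2))\<^sup>2"
proof -
  obtain a b c d where "A = mat2 a b c d" by (rule mat2_cases)
  moreover have "a * a + b * c + (c * b + d * d) = (a + d)\<^sup>2"
    unfolding power2_add by (simp add: power2_eq_square mult.commute add.commute add.left_commute)
  ultimately show ?thesis by simp
qed

text \<open>A 2-subgroup has trace 0 throughout, and for \<open>u \<noteq> 1\<close> unipotent \<open>trace y = trace (y u) = 0\<close>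
  forces \<open>y\<close> to be upper triangular.\<close>

lemma sylow_in_sylows:
  assumes "sylow_subgroup 2 SL2 (T :: ('a^2^2) set)"
  shows "T \<in> sylows"
proof -
  have T: "subgroup T SL2" using assms by (simp add: sylow_subgroup_def)
  have "multiplicity 2 (504::nat) = 3"
    by (rule multiplicity_eqI) simp_all
  then have card_T: "card T = 8" using assms by (simp add: sylow_subgroup_def order_SL2)
  have tr: "trace x = 0" if x: "x \<in> T" for x
  proof -
    interpret ST: group "SL2\<lparr>carrier := T\<rparr>" using T by (rule subgroup.subgroup_is_group) (rule group_SL2)
    have "x [^]\<^bsub>SL2\<lparr>carrier := T\<rparr>\<^esub> order (SL2\<lparr>carrier := T\<rparr>) = \<one>\<^bsub>SL2\<^esub>"
      using ST.pow_order_eq_1[of x] x by simp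
    then have "x [^]\<^bsub>SL2\<^esub> (8::nat) = \<one>\<^bsub>SL2\<^esub>"
      using card_T SL2.nat_pow_consistent[of x 8 T] by (simp add: order_def)
    moreover have "x [^]\<^bsub>SL2\<^esub> (8::nat) = ((x ** x) ** (x ** x)) ** ((x ** x) ** (x ** x))"
      using x T subgroup.subset by (auto simp: eval_nat_numeral matrix_mul_assoc SL2_def)
    \<comment> \<open>By \<open>trace_square\<close> the trace of x^8 is the eighth power of the
      trace of x, whereas the identity has trace 1 + 1 = 0.\<close>
    ultimately have "((trace x)\<^sup>2)\<^sup>2 = 0 \<or> (((trace x)\<^sup>2)\<^sup>2)\<^sup>2 = 0"
      using trace_square by (metis add_self one_SL2 trace_mat2)
    then show ?thesis by auto
  qed
  have T_sub: "T \<subseteq> carrier SL2" using T subgroup.subset by blast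
  have "\<exists>x\<in>T. x \<noteq> \<one>\<^bsub>SL2\<^esub>"
  proof (rule ccontr)
    assume "\<not> ?thesis"
    then have "card T \<le> card {\<one>\<^bsub>SL2\<^esub> :: 'a^2^2}" by (intro card_mono) auto
    then show False using card_T by simp
  qed
  then obtain x where x: "x \<in> T" "x \<noteq> \<one>\<^bsub>SL2\<^esub>" by blast
  then have "x \<in> \<Union>sylows" using tr T_sub unfolding Union_sylows by blast
  then obtain h u where h: "h \<in> carrier SL2" and u: "u \<in> unipotent" "x = conj_by SL2 h u"
    by (auto simp: sylows_def conj_set_def)
  obtain t where t: "u = mat2 1 t 0 1" using u by (auto simp: unipotent_def)
  have t0: "t \<noteq> 0"
    using x(2) u h t by (auto simp: conj_by_def one_SL2[symmetric] simp del: mult_SL2 carrier_SL2)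
  have "T \<subseteq> conj_set SL2 unipotent h"
  proof
    fix y assume y: "y \<in> T"
    then have yG: "y \<in> carrier SL2" and uG: "u \<in> carrier SL2" using T_sub u unipotent_sub by auto
    define w where "w = conj_by SL2 (inv\<^bsub>SL2\<^esub> h) y"
    have wG: "w \<in> carrier SL2" using yG h by (simp add: w_def del: carrier_SL2)
    have yw: "y = conj_by SL2 h w"
      using yG h by (simp add: w_def SL2.conj_by_conj_by del: carrier_SL2 mult_SL2)
    have "y \<otimes>\<^bsub>SL2\<^esub> x = conj_by SL2 h (w \<otimes>\<^bsub>SL2\<^esub> u)"
      unfolding yw u(2) by (rule SL2.conj_by_mult[OF h wG uG, symmetric])
    moreover have "y \<otimes>\<^bsub>SL2\<^esub> x \<in> T" by (rule subgroup.m_closed[OF T y x(1)])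
    ultimately have "trace (w \<otimes>\<^bsub>SL2\<^esub> u) = 0"
      using tr trace_conj_SL2[OF h SL2.m_closed[OF wG uG]] by metis
    moreover have "trace w = 0" using tr[OF y] trace_conj_SL2[OF h wG] yw by metis
    moreover obtain a b c d where w: "w = mat2 a b c d" by (rule mat2_cases)
    ultimately have ad: "a = d" "a = c * t + d" by (auto simp: t)
    then have "c * t + d = d" by metis
    then have "c = 0" "d = a" using t0 ad(1) by simp_all
    moreover have "a * d + b * c = 1" using wG w by simp
    ultimately have "w \<in> unipotent" by (simp add: w flip: power2_eq_square)
    then show "y \<in> conj_set SL2 unipotent h" using yw by (auto simp: conj_set_def)
  qed
  moreover have "card (conj_set SL2 unipotent h) = 8"
    using SL2.card_conj_set[OF unipotent_sub h] card_unipotent by simp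
  ultimately have "T = conj_set SL2 unipotent h"
    using card_T by (metis card_subset_eq card.infinite zero_neq_numeral)
  then show ?thesis using h by (auto simp: sylows_def)
qed

lemma conj_orbit_sylow:
  assumes "T \<in> (sylows :: ('a^2^2) set set)"
  shows "conj_set SL2 T ` carrier SL2 = sylows"
proof
  show "conj_set SL2 T ` carrier SL2 \<subseteq> sylows" using geo.PP_conj assms by blast
  show "sylows \<subseteq> conj_set SL2 T ` carrier SL2"
  proof
    fix P :: "('a^2^2) set" assume "P \<in> sylows"
    then obtain k where k: "k \<in> carrier SL2" "P = conj_set SL2 unipotent k" by (auto simp: sylows_def)
    obtain h where h: "h \<in> carrier SL2" "T = conj_set SL2 unipotent h" using assms by (auto simp: sylows_def)
    have "P = conj_set SL2 T (inv\<^bsub>SL2\<^esub> h \<otimes>\<^bsub>SL2\<^esub> k)"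
      unfolding h(2) k(2) using h(1) k(1) by (simp add: SL2.conj_set_conj_set[OF unipotent_sub] del: mult_SL2 carrier_SL2)
    moreover have "inv\<^bsub>SL2\<^esub> h \<otimes>\<^bsub>SL2\<^esub> k \<in> carrier SL2" using h k by (simp del: mult_SL2 carrier_SL2)
    ultimately show "P \<in> conj_set SL2 T ` carrier SL2" by blast
  qed
qed

text \<open>A factorisation h = x y^-1 is the same as x = h y, so y alone has to run through D; x
  and y are distinct because h is not 1.\<close>

lemma quotients_valM:
  assumes D: "\<forall>m\<in>set D. detM m = Z0" and m: "detM m = Z0" "m \<noteq> idM"
  shows "valM z m \<in> quotients (valM z ` set D) \<longleftrightarrow> (\<exists>y\<in>set D. mulM m y \<in> set D)"
proof
  assume "valM z m \<in> quotients (valM z ` set D)"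
  then obtain x y where xy: "x \<in> set D" "y \<in> set D" "valM z m = valM z x \<otimes>\<^bsub>SL2\<^esub> inv\<^bsub>SL2\<^esub> (valM z y)"
    by (auto simp: quotients_def)
  then have "valM z m \<otimes>\<^bsub>SL2\<^esub> valM z y = valM z x"
    unfolding xy(3) using valM_closed[of x] valM_closed[of y] D xy(1,2)
    by (simp add: SL2.m_assoc del: mult_SL2 carrier_SL2 valM_inv)
  then have "mulM m y = x" by (simp flip: valM_mul)
  then show "\<exists>y\<in>set D. mulM m y \<in> set D" using xy by blast
next
  assume "\<exists>y\<in>set D. mulM m y \<in> set D"
  then obtain y where y: "y \<in> set D" "mulM m y \<in> set D" by blast
  have *: "valM z (mulM m y) = valM z m \<otimes>\<^bsub>SL2\<^esub> valM z y" by (simp add: valM_mul)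
  have G: "valM z m \<in> carrier SL2" "valM z y \<in> carrier SL2" using y D m valM_closed by blast+
  have "valM z m = valM z (mulM m y) \<otimes>\<^bsub>SL2\<^esub> inv\<^bsub>SL2\<^esub> (valM z y)"
    unfolding * using G by (simp add: SL2.m_assoc del: mult_SL2 carrier_SL2)
  moreover have "mulM m y \<noteq> y"
  proof
    assume "mulM m y = y"
    then have "valM z m \<otimes>\<^bsub>SL2\<^esub> valM z y = valM z y" using * by simp
    then have "valM z m = valM z idM" using SL2.r_cancel_one[OF G(2,1)] by simp
    then have "m = idM" by (simp only: valM_eq)
    then show False using m by simp
  qed
  then have "valM z (mulM m y) \<noteq> valM z y" by simp
  ultimately show "valM z m \<in> quotients (valM z ` set D)"
    unfolding quotients_def using y by blast
qed

text \<open>Existence of a witness for each nontrivial h gives the covering, and its uniqueness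
  gives disjointness of the parts, injectivity of \<open>quotients\<close> on the family and
  condition (Q).\<close>

lemma affine_family:
  assumes F: "every base_list F" and part: "partM F" and T: "sylow_subgroup 2 SL2 T"
  shows "affine_SL28_unital C T (family z F)"
proof -
  have base_list: "idM \<in> set D" "distinct D" "length D = 9" "\<forall>m\<in>set D. detM m = Z0" if "D \<in> set F" for D
    using F that by (auto simp: base_list_iff)
  have sub: "valM z ` set D \<subseteq> carrier SL2" if "D \<in> set F" for D
    using base_list(4)[OF that] valM_closed by blast
  have T': "T \<in> sylows" using T by (rule sylow_in_sylows)
  have wit: "\<exists>w. wit F m = [w]" if "detM m = Z0" "m \<noteq> idM" for m
  proof -
    have "part1 F m" using part that(1) by (simp only: partM_def every_sl8_iff)
    then show ?thesis using that(2) by (simp only: part1_def is_single_iff if_False)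
  qed
  have uniq: "w = w'" if "detM m = Z0" "m \<noteq> idM" "w \<in> set (wit F m)" "w' \<in> set (wit F m)" for m w w'
    using wit[OF that(1,2)] that by auto
  define parts where "parts = {C - {\<one>\<^bsub>SL2\<^esub>}} \<union> {conj_set SL2 (T - {\<one>\<^bsub>SL2\<^esub>}) h | h. h \<in> carrier SL2} \<union> quotients ` family z F"
  note conj_minus = SL2.conj_set_minus_one[OF geo.PP_sub[OF T']]
  have parts_eq: "parts = {C - {\<one>\<^bsub>SL2\<^esub>}} \<union> (\<lambda>P. P - {\<one>\<^bsub>SL2\<^esub>}) ` sylows \<union> quotients ` family z F"
  proof -
    have "{conj_set SL2 (T - {\<one>\<^bsub>SL2\<^esub>}) h | h. h \<in> carrier SL2} = (\<lambda>P. P - {\<one>\<^bsub>SL2\<^esub>}) ` (conj_set SL2 T ` carrier SL2)"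
      unfolding image_image Setcompr_eq_image using conj_minus by (intro image_cong) (auto simp del: carrier_SL2)
    then show ?thesis unfolding parts_def conj_orbit_sylow[OF T'] by simp
  qed
  have parts_iff: "p \<in> parts \<longleftrightarrow> p = C - {\<one>\<^bsub>SL2\<^esub>} \<or> (\<exists>P\<in>sylows. p = P - {\<one>\<^bsub>SL2\<^esub>})
      \<or> (\<exists>D\<in>set F. p = quotients (valM z ` set D))" for p
    unfolding parts_eq family_def by auto
  have inC: "valM z m \<in> C \<longleftrightarrow> m \<in> set CM" for m
    unfolding C_eq by (simp add: inj_image_mem_iff[OF inj_valM])
  have inP: "valM z m \<in> \<Union>sylows \<longleftrightarrow> traceM m = Zero" if "detM m = Z0" for m
    unfolding Union_sylows using that by simp
  have quot_sub: "quotients (valM z ` set D) \<subseteq> carrier SL2 - {\<one>\<^bsub>SL2\<^esub>}" if D: "D \<in> set F" for D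
  proof
    fix q assume "q \<in> quotients (valM z ` set D)"
    then obtain x y where xy: "x \<in> valM z ` set D" "y \<in> valM z ` set D" "x \<noteq> y" "q = x \<otimes>\<^bsub>SL2\<^esub> inv\<^bsub>SL2\<^esub> y"
      by (auto simp: quotients_def)
    then have G: "x \<in> carrier SL2" "y \<in> carrier SL2" using sub[OF D] by blast+
    then have "q \<in> carrier SL2" using xy(4) by (simp del: mult_SL2 carrier_SL2)
    moreover have "q \<noteq> \<one>\<^bsub>SL2\<^esub>"
      using xy(3,4) G by (metis SL2.inv_equality SL2.inv_inv SL2.inv_closed)
    ultimately show "q \<in> carrier SL2 - {\<one>\<^bsub>SL2\<^esub>}" by blast
  qed
  have quot_wit: "\<exists>y. (D, y) \<in> set (wit F m)"
    if "D \<in> set F" "detM m = Z0" "valM z m \<in> quotients (valM z ` set D)" for D m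
  proof -
    have "valM z m \<noteq> \<one>\<^bsub>SL2\<^esub>" using quot_sub[OF that(1)] that(3) by blast
    then have "m \<noteq> idM" by auto
    then show ?thesis
      using quotients_valM[OF base_list(4)[OF that(1)] that(2)] that by (auto simp: in_set_wit)
  qed
  have nonempty: "D \<noteq> []" if "D \<in> set F" for D using base_list[OF that] by auto
  have part_sub: "p \<subseteq> carrier SL2 - {\<one>\<^bsub>SL2\<^esub>}" if "p \<in> parts" for p
    using that quot_sub C_sub geo.PP_sub unfolding parts_iff by (elim disjE bexE) blast+
  have dest_part: "(p = C - {\<one>\<^bsub>SL2\<^esub>} \<and> ([], m) \<in> set (wit F m)) \<or>
      ((\<exists>P\<in>sylows. p = P - {\<one>\<^bsub>SL2\<^esub>}) \<and> ([], idM) \<in> set (wit F m)) \<or>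
      (\<exists>D\<in>set F. \<exists>y. p = quotients (valM z ` set D) \<and> (D, y) \<in> set (wit F m))"
    if p: "p \<in> parts" and m: "detM m = Z0" "valM z m \<in> p" for p m
  proof -
    consider "p = C - {\<one>\<^bsub>SL2\<^esub>}" | P where "P \<in> sylows" "p = P - {\<one>\<^bsub>SL2\<^esub>}"
      | D where "D \<in> set F" "p = quotients (valM z ` set D)"
      using p unfolding parts_iff by blast
    then show ?thesis
    proof cases
      case 1
      then show ?thesis using inC m by (auto simp: in_set_wit)
    next
      case 2
      then have "valM z m \<in> \<Union>sylows" using m by blast
      then show ?thesis using 2 inP m by (auto simp: in_set_wit)
    next
      case 3
      then have "\<exists>y. (D, y) \<in> set (wit F m)" using quot_wit[OF 3(1) m(1)] m(2) by simp
      then show ?thesis using 3 by metis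
    qed
  qed
  have "partition_on (carrier SL2 - {\<one>\<^bsub>SL2\<^esub>}) parts"
  proof (rule partition_onI)
    show "\<Union>parts = carrier SL2 - {\<one>\<^bsub>SL2\<^esub>}"
    proof
      show "\<Union>parts \<subseteq> carrier SL2 - {\<one>\<^bsub>SL2\<^esub>}" using part_sub by blast
      show "carrier SL2 - {\<one>\<^bsub>SL2\<^esub>} \<subseteq> \<Union>parts"
      proof
        fix h :: "'a^2^2" assume h: "h \<in> carrier SL2 - {\<one>\<^bsub>SL2\<^esub>}"
        then obtain m where m: "detM m = Z0" "h = valM z m" using valM_surj_carrier by blast
        then have "m \<noteq> idM" using h by auto
        then obtain D y where "(D, y) \<in> set (wit F m)" using wit[OF m(1)] by (metis list.set_intros(1) surj_pair)
        then consider "m \<in> set CM" | "traceM m = Zero" | "D \<in> set F" "y \<in> set D" "mulM m y \<in> set D"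
          unfolding in_set_wit by blast
        then have "h \<in> C \<or> h \<in> \<Union>sylows \<or> (\<exists>D\<in>set F. h \<in> quotients (valM z ` set D))"
        proof cases
          case 3
          then have "h \<in> quotients (valM z ` set D)"
            unfolding m(2) quotients_valM[OF base_list(4)[OF 3(1)] m(1) \<open>m \<noteq> idM\<close>] by blast
          then show ?thesis using 3(1) by blast
        next
          case 1
          then show ?thesis unfolding m(2) inC by simp
        next
          case 2
          then show ?thesis unfolding m(2) inP[OF m(1)] by simp
        qed
        then show "h \<in> \<Union>parts"
        proof (elim disjE UnionE bexE)
          assume "h \<in> C"
          then show ?thesis using h by (intro UnionI[of "C - {\<one>\<^bsub>SL2\<^esub>}"]) (auto simp only: parts_iff)
        next
          fix P assume "h \<in> P" "P \<in> sylows"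
          then show ?thesis using h by (intro UnionI[of "P - {\<one>\<^bsub>SL2\<^esub>}"]) (auto simp only: parts_iff)
        next
          fix D assume "D \<in> set F" "h \<in> quotients (valM z ` set D)"
          then show ?thesis by (intro UnionI[of "quotients (valM z ` set D)"]) (auto simp only: parts_iff)
        qed
      qed
    qed
  next
    fix p q assume p: "p \<in> parts" and q: "q \<in> parts" and ne: "p \<noteq> q"
    show "disjnt p q"
    proof (rule ccontr)
      assume "\<not> disjnt p q"
      then obtain h where h: "h \<in> p" "h \<in> q" by (auto simp: disjnt_def)
      then have hG: "h \<in> carrier SL2" "h \<noteq> \<one>\<^bsub>SL2\<^esub>" using part_sub[OF p] by auto
      then obtain m where m: "detM m = Z0" "h = valM z m" using valM_surj_carrier by blast
      then have mid: "m \<noteq> idM" using hG by auto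
      note u = uniq[OF m(1) mid]
      \<comment> \<open>All Sylow parts share the witness for trace 0, so witnesses cannot separate
        two of them; their disjointness comes from \<open>sylows_inter\<close>.\<close>
      have P: "P = Q" if "P \<in> sylows" "Q \<in> sylows" "h \<in> P" "h \<in> Q" for P Q
        using sylows_inter that hG by blast
      show False
        using dest_part[OF p m(1) h(1)[unfolded m(2)]] dest_part[OF q m(1) h(2)[unfolded m(2)]]
      proof (elim disjE conjE bexE exE)
        fix P Q assume "P \<in> sylows" "p = P - {\<one>\<^bsub>SL2\<^esub>}" "Q \<in> sylows" "q = Q - {\<one>\<^bsub>SL2\<^esub>}"
        then show False using P h ne by auto
      qed (use ne mid u nonempty in blast)+
    qed
  next
    show "{} \<notin> parts"
    proof
      assume "{} \<in> parts"
      then consider "C \<subseteq> {\<one>\<^bsub>SL2\<^esub>}" | P :: "('a^2^2) set" where "P \<in> sylows" "P \<subseteq> {\<one>\<^bsub>SL2\<^esub>}"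
        | D where "D \<in> set F" "quotients (valM z ` set D) = {}"
        unfolding parts_iff by blast
      then show False
      proof cases
        case 1
        then have "card C \<le> card {\<one>\<^bsub>SL2\<^esub> :: 'a^2^2}" by (intro card_mono) auto
        then show False using card_C by simp
      next
        case 2
        then have "card P \<le> card {\<one>\<^bsub>SL2\<^esub> :: 'a^2^2}" by (intro card_mono) auto
        then show False using card_sylow[OF 2(1)] by simp
      next
        case 3
        have "\<exists>x\<in>set D. x \<noteq> idM"
        proof (rule ccontr)
          assume "\<not> ?thesis"
          then have "card (set D) \<le> card {idM}" by (intro card_mono) auto
          then show False using base_list(2,3)[OF 3(1)] distinct_card[of D] by simp
        qed
        then obtain x where "x \<in> set D" "x \<noteq> idM" by blast
        then have "valM z x \<in> valM z ` set D" "valM z idM \<in> valM z ` set D" "valM z x \<noteq> valM z idM"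
          using base_list(1)[OF 3(1)] by (simp_all only: valM_eq imageI not_False_eq_True)
        then have "valM z x \<otimes>\<^bsub>SL2\<^esub> inv\<^bsub>SL2\<^esub> (valM z idM) \<in> quotients (valM z ` set D)"
          unfolding quotients_def by blast
        then show False using 3 by blast
      qed
    qed
  qed
  moreover have "inj_on quotients (family z F)"
  proof (rule inj_onI)
    fix A B assume "A \<in> family z F" "B \<in> family z F" and eq: "quotients A = quotients B"
    then obtain D D' where D: "D \<in> set F" "A = valM z ` set D" "D' \<in> set F" "B = valM z ` set D'"
      by (auto simp: family_def)
    have "quotients A \<noteq> {}"
    proof
      have "quotients A \<in> parts" using D(1,2) unfolding parts_iff by blast
      moreover assume "quotients A = {}"
      ultimately show False
        using \<open>partition_on (carrier SL2 - {\<one>\<^bsub>SL2\<^esub>}) parts\<close> by (auto simp: partition_on_def)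
    qed
    then obtain h where h: "h \<in> quotients A" by blast
    then have hG: "h \<in> carrier SL2" "h \<noteq> \<one>\<^bsub>SL2\<^esub>" using quot_sub D by blast+
    then obtain m where m: "detM m = Z0" "h = valM z m" using valM_surj_carrier by blast
    then have mid: "m \<noteq> idM" using hG by auto
    \<comment> \<open>A common quotient has a witness from either list, and uniqueness of the
      witness identifies the lists.\<close>
    obtain y y' where "(D, y) \<in> set (wit F m)" "(D', y') \<in> set (wit F m)"
      using quot_wit D m h eq by metis
    then have "D = D'" using uniq[OF m(1) mid] by blast
    then show "A = B" using D by simp
  qed
  moreover have "inj_on (\<lambda>(x, y). x \<otimes>\<^bsub>SL2\<^esub> inv\<^bsub>SL2\<^esub> y) {(x, y). x \<in> A \<and> y \<in> A \<and> x \<noteq> y}" if A: "A \<in> family z F" for A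
  proof -
    obtain D where D: "D \<in> set F" "A = valM z ` set D" using A by (auto simp: family_def)
    have "x = x' \<and> y = y'"
      if xy: "x \<in> A" "y \<in> A" "x \<noteq> y" "x' \<in> A" "y' \<in> A"
        and eq: "x \<otimes>\<^bsub>SL2\<^esub> inv\<^bsub>SL2\<^esub> y = x' \<otimes>\<^bsub>SL2\<^esub> inv\<^bsub>SL2\<^esub> y'" for x y x' y'
    proof -
      define h where "h = x \<otimes>\<^bsub>SL2\<^esub> inv\<^bsub>SL2\<^esub> y"
      have G: "x \<in> carrier SL2" "y \<in> carrier SL2" "x' \<in> carrier SL2" "y' \<in> carrier SL2"
        using xy D sub[OF D(1)] by blast+
      have "h \<in> quotients A" unfolding quotients_def h_def using xy by blast
      then have hG: "h \<in> carrier SL2" "h \<noteq> \<one>\<^bsub>SL2\<^esub>" using quot_sub D by blast+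
      then obtain m where m: "detM m = Z0" "h = valM z m" using valM_surj_carrier by blast
      then have mid: "m \<noteq> idM" using hG by auto
      have hx: "h \<otimes>\<^bsub>SL2\<^esub> y = x" "h \<otimes>\<^bsub>SL2\<^esub> y' = x'"
        unfolding h_def using G eq by (metis SL2.inv_solve_right SL2.m_closed SL2.inv_closed)+
      obtain v v' where v: "v \<in> set D" "y = valM z v" "v' \<in> set D" "y' = valM z v'"
        using xy D by auto
      have "valM z (mulM m v) = x" "valM z (mulM m v') = x'"
        using hx unfolding m(2) v(2,4) by (simp_all add: valM_mul)
      then have "valM z (mulM m v) \<in> valM z ` set D" "valM z (mulM m v') \<in> valM z ` set D"
        using xy(1,4) D(2) by simp_all
      then have "mulM m v \<in> set D" "mulM m v' \<in> set D"
        by (simp_all only: inj_image_mem_iff[OF inj_valM])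
      \<comment> \<open>Equal quotients are two factorisations of one h within the same D; their
        right factors are recorded as witnesses and must agree.\<close>
      then have "(D, v) \<in> set (wit F m)" "(D, v') \<in> set (wit F m)"
        using v D by (auto simp: in_set_wit)
      then have "v = v'" using uniq[OF m(1) mid] by blast
      then show ?thesis using hx v by simp
    qed
    then show ?thesis unfolding inj_on_def by auto
  qed
  moreover have "A \<subseteq> carrier SL2 \<and> \<one>\<^bsub>SL2\<^esub> \<in> A \<and> card A = 9" if A: "A \<in> family z F" for A
  proof -
    obtain D where D: "D \<in> set F" "A = valM z ` set D" using A by (auto simp: family_def)
    have "\<one>\<^bsub>SL2\<^esub> \<in> A" using D base_list(1)[OF D(1)] valM_one by (metis imageI)
    then show ?thesis
      using sub[OF D(1)] D(2) base_list(2,3)[OF D(1)] distinct_card[of D] by (simp add: card_valM)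
  qed
  ultimately show ?thesis
    unfolding affine_SL28_unital_def parts_def
    using card C_subgroup card_C T by blast
qed

end

section \<open>Automorphisms of affine unitals\<close>

lemma carrier_BijGroup [simp]: "carrier (BijGroup S) = Bij S"
  by (simp add: BijGroup_def)

lemma BijGroup_mult_apply:
  "\<alpha> \<in> Bij S \<Longrightarrow> \<beta> \<in> Bij S \<Longrightarrow> x \<in> S \<Longrightarrow> (\<alpha> \<otimes>\<^bsub>BijGroup S\<^esub> \<beta>) x = \<alpha> (\<beta> x)"
  by (simp add: BijGroup_def compose_def)

lemma BijGroup_one_apply: "x \<in> S \<Longrightarrow> \<one>\<^bsub>BijGroup S\<^esub> x = x"
  by (simp add: BijGroup_def)

lemma Bij_eqI: "\<alpha> \<in> Bij S \<Longrightarrow> \<beta> \<in> Bij S \<Longrightarrow> (\<And>x. x \<in> S \<Longrightarrow> \<alpha> x = \<beta> x) \<Longrightarrow> \<alpha> = \<beta>"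
  by (auto simp: Bij_def intro: extensionalityI)

lemma Bij_apply: "\<alpha> \<in> Bij S \<Longrightarrow> x \<in> S \<Longrightarrow> \<alpha> x \<in> S"
  by (auto simp: Bij_def bij_betw_def)

lemma BijGroup_mult_image:
  "\<alpha> \<in> Bij S \<Longrightarrow> \<beta> \<in> Bij S \<Longrightarrow> A \<subseteq> S \<Longrightarrow> (\<alpha> \<otimes>\<^bsub>BijGroup S\<^esub> \<beta>) ` A = \<alpha> ` \<beta> ` A"
  unfolding image_image by (rule image_cong) (auto simp: BijGroup_mult_apply)

lemma Aut_group_carrier:
  "carrier (Aut_group U) = {\<alpha> \<in> Bij (points U). (`) \<alpha> ` blocks U = blocks U}"
  by (simp add: Aut_group_def)

lemma Aut_group_eq: "Aut_group U = BijGroup (points U)\<lparr>carrier := carrier (Aut_group U)\<rparr>"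
  by (simp add: Aut_group_def)

text \<open>Mapping blocks to blocks suffices: on a finite set of blocks the induced injective map
  is onto.\<close>

lemma Aut_groupI:
  assumes "\<alpha> \<in> Bij (points U)" "finite (points U)" "blocks U \<subseteq> Pow (points U)"
    and "\<And>B. B \<in> blocks U \<Longrightarrow> \<alpha> ` B \<in> blocks U"
  shows "\<alpha> \<in> carrier (Aut_group U)"
proof -
  have "inj_on \<alpha> (points U)" using assms(1) by (simp add: Bij_def bij_betw_def)
  then have "inj_on ((`) \<alpha>) (blocks U)"
    using assms(3) by (meson inj_on_image_Pow inj_on_subset)
  moreover have "finite (blocks U)"
    using assms(2,3) by (meson finite_Pow_iff rev_finite_subset)
  ultimately have "(`) \<alpha> ` blocks U = blocks U"
    using assms(4) by (intro endo_inj_surj) auto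
  then show ?thesis using assms(1) by (simp add: Aut_group_carrier)
qed

lemma Aut_group_subgroup:
  assumes "blocks U \<subseteq> Pow (points U)"
  shows "subgroup (carrier (Aut_group U)) (BijGroup (points U))"
proof -
  interpret B: group "BijGroup (points U)" by (rule group_BijGroup)
  have mult: "(`) (\<alpha> \<otimes>\<^bsub>BijGroup (points U)\<^esub> \<beta>) ` blocks U = (`) \<alpha> ` (`) \<beta> ` blocks U"
    if "\<alpha> \<in> Bij (points U)" "\<beta> \<in> Bij (points U)" for \<alpha> \<beta>
    unfolding image_image[of "(`) \<alpha>" "(`) \<beta>"]
  proof (rule image_cong[OF refl])
    fix A assume "A \<in> blocks U"
    then have "A \<subseteq> points U" using assms by blast
    with that show "(\<alpha> \<otimes>\<^bsub>BijGroup (points U)\<^esub> \<beta>) ` A = \<alpha> ` \<beta> ` A" by (rule BijGroup_mult_image)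
  qed
  have one: "(`) \<one>\<^bsub>BijGroup (points U)\<^esub> ` blocks U = blocks U"
  proof -
    have "\<one>\<^bsub>BijGroup (points U)\<^esub> ` A = A" if "A \<in> blocks U" for A
      using that assms BijGroup_one_apply[of _ "points U"] by (force simp: image_iff)
    then show ?thesis by simp
  qed
  show ?thesis
  proof (rule B.subgroupI)
    show "carrier (Aut_group U) \<subseteq> carrier (BijGroup (points U))"
      by (auto simp: Aut_group_carrier)
    show "carrier (Aut_group U) \<noteq> {}"
      using one B.one_closed by (auto simp: Aut_group_carrier)
  next
    fix \<alpha> assume \<alpha>: "\<alpha> \<in> carrier (Aut_group U)"
    then have \<alpha>B: "\<alpha> \<in> Bij (points U)" by (simp add: Aut_group_carrier)
    then have inv: "inv\<^bsub>BijGroup (points U)\<^esub> \<alpha> \<in> Bij (points U)"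
      using B.inv_closed by simp
    have "(`) (inv\<^bsub>BijGroup (points U)\<^esub> \<alpha>) ` blocks U = (`) (inv\<^bsub>BijGroup (points U)\<^esub> \<alpha>) ` (`) \<alpha> ` blocks U"
      using \<alpha> by (simp add: Aut_group_carrier)
    also have "\<dots> = blocks U"
      using mult[OF inv \<alpha>B] one \<alpha>B by simp
    finally show "inv\<^bsub>BijGroup (points U)\<^esub> \<alpha> \<in> carrier (Aut_group U)"
      using inv by (simp add: Aut_group_carrier)
  next
    fix \<alpha> \<beta> assume "\<alpha> \<in> carrier (Aut_group U)" "\<beta> \<in> carrier (Aut_group U)"
    then show "\<alpha> \<otimes>\<^bsub>BijGroup (points U)\<^esub> \<beta> \<in> carrier (Aut_group U)"
      using mult[of \<alpha> \<beta>] B.m_closed[of \<alpha> \<beta>] by (simp add: Aut_group_carrier)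
  qed
qed

context group
begin

lemma r_coset_image: "K #> x = (\<lambda>k. k \<otimes> x) ` K"
  by (auto simp: r_coset_def)

lemma card_r_coset: "K \<subseteq> carrier G \<Longrightarrow> x \<in> carrier G \<Longrightarrow> card (K #> x) = card K"
  unfolding r_coset_image by (intro card_image inj_onI) (use right_cancel in blast)

lemma image_r_coset:
  assumes "\<alpha> \<in> hom G G" "K \<subseteq> carrier G" "x \<in> carrier G"
  shows "\<alpha> ` (K #> x) = \<alpha> ` K #> \<alpha> x"
  unfolding r_coset_image image_image using assms by (intro image_cong) (auto simp: hom_def)

end

lemma quotients_image:
  assumes "\<And>k l. k \<in> K \<Longrightarrow> l \<in> K \<Longrightarrow>
      f k \<otimes>\<^bsub>SL2\<^esub> inv\<^bsub>SL2\<^esub> (f l) = h (k \<otimes>\<^bsub>SL2\<^esub> inv\<^bsub>SL2\<^esub> l)"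
    and "\<And>k l. k \<in> K \<Longrightarrow> l \<in> K \<Longrightarrow> f k = f l \<longleftrightarrow> k = l"
  shows "quotients (f ` K) = h ` quotients K"
proof
  show "quotients (f ` K) \<subseteq> h ` quotients K"
  proof
    fix q assume "q \<in> quotients (f ` K)"
    then obtain k l where kl: "k \<in> K" "l \<in> K" "f k \<noteq> f l" "q = f k \<otimes>\<^bsub>SL2\<^esub> inv\<^bsub>SL2\<^esub> (f l)"
      unfolding quotients_def by blast
    then have "q = h (k \<otimes>\<^bsub>SL2\<^esub> inv\<^bsub>SL2\<^esub> l)" "k \<noteq> l" using assms(1) by auto
    then show "q \<in> h ` quotients K" using kl unfolding quotients_def by blast
  qed
  show "h ` quotients K \<subseteq> quotients (f ` K)"
  proof
    fix q assume "q \<in> h ` quotients K"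
    then obtain k l where kl: "k \<in> K" "l \<in> K" "k \<noteq> l" "q = h (k \<otimes>\<^bsub>SL2\<^esub> inv\<^bsub>SL2\<^esub> l)"
      unfolding quotients_def by blast
    then have "q = f k \<otimes>\<^bsub>SL2\<^esub> inv\<^bsub>SL2\<^esub> (f l)" "f k \<noteq> f l" using assms by auto
    then show "q \<in> quotients (f ` K)" using kl unfolding quotients_def by blast
  qed
qed

text \<open>The factor x cancels in (k x)(l x)^-1. The set of quotients is thus an invariant of the
  class of right translates and tells to which base a block belongs.\<close>

lemma quotients_r_coset:
  assumes K: "K \<subseteq> carrier SL2" and x: "x \<in> carrier SL2"
  shows "quotients (K #>\<^bsub>SL2\<^esub> x) = quotients K"
proof -
  have q: "(k \<otimes>\<^bsub>SL2\<^esub> x) \<otimes>\<^bsub>SL2\<^esub> inv\<^bsub>SL2\<^esub> (l \<otimes>\<^bsub>SL2\<^esub> x) = k \<otimes>\<^bsub>SL2\<^esub> inv\<^bsub>SL2\<^esub> l"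
    and e: "k \<otimes>\<^bsub>SL2\<^esub> x = l \<otimes>\<^bsub>SL2\<^esub> x \<longleftrightarrow> k = l" if "k \<in> K" "l \<in> K" for k l
  proof -
    have kl: "k \<in> carrier SL2" "l \<in> carrier SL2" using that K by auto
    show "(k \<otimes>\<^bsub>SL2\<^esub> x) \<otimes>\<^bsub>SL2\<^esub> inv\<^bsub>SL2\<^esub> (l \<otimes>\<^bsub>SL2\<^esub> x) = k \<otimes>\<^bsub>SL2\<^esub> inv\<^bsub>SL2\<^esub> l"
      using kl x by (simp add: SL2.inv_mult_group SL2.m_assoc del: mult_SL2 carrier_SL2)
    show "k \<otimes>\<^bsub>SL2\<^esub> x = l \<otimes>\<^bsub>SL2\<^esub> x \<longleftrightarrow> k = l"
      using SL2.right_cancel[OF x kl] .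
  qed
  have "quotients ((\<lambda>k. k \<otimes>\<^bsub>SL2\<^esub> x) ` K) = id ` quotients K"
    by (rule quotients_image) (simp_all only: q e id_apply)
  then show ?thesis unfolding SL2.r_coset_image by simp
qed

lemma quotients_subgroup:
  assumes "subgroup K SL2" shows "quotients K = K - {\<one>\<^bsub>SL2\<^esub>}"
proof
  interpret K: subgroup K SL2 by fact
  show "quotients K \<subseteq> K - {\<one>\<^bsub>SL2\<^esub>}"
  proof
    fix q assume "q \<in> quotients K"
    then obtain x y where xy: "x \<in> K" "y \<in> K" "x \<noteq> y" "q = x \<otimes>\<^bsub>SL2\<^esub> inv\<^bsub>SL2\<^esub> y" by (auto simp: quotients_def)
    then have "q \<in> K" by blast
    moreover have "q \<noteq> \<one>\<^bsub>SL2\<^esub>"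
      using xy K.mem_carrier by (metis SL2.inv_equality SL2.inv_inv SL2.inv_closed)
    ultimately show "q \<in> K - {\<one>\<^bsub>SL2\<^esub>}" by blast
  qed
  show "K - {\<one>\<^bsub>SL2\<^esub>} \<subseteq> quotients K"
  proof
    fix q assume q: "q \<in> K - {\<one>\<^bsub>SL2\<^esub>}"
    then have "q = q \<otimes>\<^bsub>SL2\<^esub> inv\<^bsub>SL2\<^esub> \<one>\<^bsub>SL2\<^esub>"
      using K.mem_carrier by (simp del: mult_SL2)
    then show "q \<in> quotients K" unfolding quotients_def using q K.one_closed by blast
  qed
qed

lemma card_quotients:
  assumes "finite D" "inj_on (\<lambda>(x, y). x \<otimes>\<^bsub>SL2\<^esub> inv\<^bsub>SL2\<^esub> y) {(x, y). x \<in> D \<and> y \<in> D \<and> x \<noteq> y}"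
  shows "card (quotients D) = card D * card D - card D"
proof -
  let ?P = "{(x, y). x \<in> D \<and> y \<in> D \<and> x \<noteq> y}"
  have "quotients D = (\<lambda>(x, y). x \<otimes>\<^bsub>SL2\<^esub> inv\<^bsub>SL2\<^esub> y) ` ?P"
    by (auto simp: quotients_def)
  then have "card (quotients D) = card ?P" using assms(2) by (simp add: card_image)
  also have "?P = D \<times> D - (\<lambda>x. (x, x)) ` D" by auto
  also have "card \<dots> = card D * card D - card D"
  proof (subst card_Diff_subset)
    have "card ((\<lambda>x. (x, x)) ` D) = card D" by (rule card_image) (simp add: inj_on_def)
    then show "card (D \<times> D) - card ((\<lambda>x. (x, x)) ` D) = card D * card D - card D"
      by (simp add: card_cartesian_product)
  qed (use assms(1) in auto)
  finally show ?thesis .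
qed

section \<open>Blocks as right translates of base blocks\<close>

context f8_field
begin

text \<open>Representatives through 1 of all blocks up to right translation. The conjugates of T
  appear as \<open>sylows\<close>, so this set no longer refers to T.\<close>

definition bases :: "('a^2^2) set set \<Rightarrow> ('a^2^2) set set" where
  "bases \<D> = insert C (sylows \<union> \<D>)"

lemma unital_points [simp]: "points (unital S T \<D>) = carrier SL2"
  by (simp add: unital_def)

lemma unital_blocks:
  assumes "T \<in> sylows"
  shows "blocks (unital C T \<D>) = {K #>\<^bsub>SL2\<^esub> x | K x. K \<in> bases \<D> \<and> x \<in> carrier SL2}"
proof -
  have "{conj_set SL2 T h #>\<^bsub>SL2\<^esub> x | h x. h \<in> carrier SL2 \<and> x \<in> carrier SL2} =
      {P #>\<^bsub>SL2\<^esub> x | P x. P \<in> conj_set SL2 T ` carrier SL2 \<and> x \<in> carrier SL2}"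
    by blast
  then show ?thesis
    unfolding conj_orbit_sylow[OF assms] unital_def bases_def by auto
qed

end

locale f8_unital = f8_field +
  fixes T :: "('a^2^2) set" and \<D> :: "('a^2^2) set set"
  assumes affine: "affine_SL28_unital C T \<D>"
begin

abbreviation "U \<equiv> unital C T \<D>"

lemma T_sylow: "T \<in> sylows"
  using affine sylow_in_sylows by (simp add: affine_SL28_unital_def)

lemmas blocks_eq = unital_blocks[OF T_sylow, of \<D>]

lemma D_props:
  assumes "D \<in> \<D>"
  shows "D \<subseteq> carrier SL2" "\<one>\<^bsub>SL2\<^esub> \<in> D" "card D = 9" "card (quotients D) = 72"
proof -
  show "D \<subseteq> carrier SL2" "\<one>\<^bsub>SL2\<^esub> \<in> D" and c: "card D = 9"
    using affine assms unfolding affine_SL28_unital_def by blast+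
  then have "finite D" using card.infinite by fastforce
  moreover have "inj_on (\<lambda>(x, y). x \<otimes>\<^bsub>SL2\<^esub> inv\<^bsub>SL2\<^esub> y) {(x, y). x \<in> D \<and> y \<in> D \<and> x \<noteq> y}"
    using affine assms unfolding affine_SL28_unital_def by blast
  ultimately show "card (quotients D) = 72"
    using card_quotients c by force
qed

lemma bases_sub: "K \<in> bases \<D> \<Longrightarrow> K \<subseteq> carrier SL2"
  using C_sub geo.PP_sub D_props unfolding bases_def by blast

lemma blocksI: "K \<in> bases \<D> \<Longrightarrow> x \<in> carrier SL2 \<Longrightarrow> K #>\<^bsub>SL2\<^esub> x \<in> blocks U"
  unfolding blocks_eq by blast

lemma blocksE:
  assumes "B \<in> blocks U"
  obtains K x where "K \<in> bases \<D>" "x \<in> carrier SL2" "B = K #>\<^bsub>SL2\<^esub> x"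
  using assms unfolding blocks_eq by blast

lemma blocks_sub: "blocks U \<subseteq> Pow (points U)"
proof
  fix B assume "B \<in> blocks U"
  then obtain K x where "K \<in> bases \<D>" "x \<in> carrier SL2" "B = K #>\<^bsub>SL2\<^esub> x" by (rule blocksE)
  then show "B \<in> Pow (points U)"
    using SL2.r_coset_subset_G[OF bases_sub] unfolding unital_points by blast
qed

lemma block_shift:
  assumes "B \<in> blocks U" "y \<in> carrier SL2"
  shows "B #>\<^bsub>SL2\<^esub> y \<in> blocks U"
proof -
  obtain K x where K: "K \<in> bases \<D>" "x \<in> carrier SL2" "B = K #>\<^bsub>SL2\<^esub> x" using assms(1) by (rule blocksE)
  then have "B #>\<^bsub>SL2\<^esub> y = K #>\<^bsub>SL2\<^esub> (x \<otimes>\<^bsub>SL2\<^esub> y)"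
    using SL2.coset_mult_assoc[OF bases_sub[OF K(1)] K(2) assms(2)] by simp
  then show ?thesis using blocksI[OF K(1) SL2.m_closed[OF K(2) assms(2)]] by simp
qed

text \<open>For a subgroup the quotients are its nontrivial elements. Hence the quotients of C, of
  the Sylow subgroups and of the members of the family are exactly the parts in (P), and parts with
  a common element coincide.\<close>

lemma bases_quotients_disjoint:
  assumes "K \<in> bases \<D>" "K' \<in> bases \<D>" "q \<in> quotients K" "q \<in> quotients K'"
  shows "quotients K = quotients K'"
proof -
  let ?P = "{C - {\<one>\<^bsub>SL2\<^esub>}} \<union> {conj_set SL2 (T - {\<one>\<^bsub>SL2\<^esub>}) h | h. h \<in> carrier SL2} \<union> quotients ` \<D>"
  have disj: "disjoint ?P"
    using affine unfolding affine_SL28_unital_def partition_on_def by blast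
  have mem: "quotients K \<in> ?P" if K: "K \<in> bases \<D>" for K
  proof -
    consider "K = C" | "K \<in> sylows" | "K \<in> \<D>" using K by (auto simp: bases_def)
    then show ?thesis
    proof cases
      case 2
      then obtain h where h: "h \<in> carrier SL2" "K = conj_set SL2 T h"
        using conj_orbit_sylow[OF T_sylow] by blast
      have "quotients K = K - {\<one>\<^bsub>SL2\<^esub>}" using quotients_subgroup geo.PP_subgroup[OF 2] by blast
      also have "\<dots> = conj_set SL2 (T - {\<one>\<^bsub>SL2\<^esub>}) h"
        using SL2.conj_set_minus_one[OF geo.PP_sub[OF T_sylow] h(1)] h(2) by simp
      finally show ?thesis using h(1) by blast
    qed (use quotients_subgroup[OF C_subgroup] in auto)
  qed
  show ?thesis
    using disjointD[OF disj mem[OF assms(1)] mem[OF assms(2)]] assms(3,4) by blast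
qed

text \<open>A right translate of a member of the family has 72 quotients, while a subgroup of order
  9 has only its 8 nontrivial elements. A coset of C that contains 1 is C.\<close>

lemma block_subgroup:
  assumes B: "B \<in> blocks U" "subgroup B SL2" "card B = 9"
  shows "B = C"
proof -
  obtain K x where K: "K \<in> bases \<D>" "x \<in> carrier SL2" "B = K #>\<^bsub>SL2\<^esub> x" using B by (elim blocksE)
  have "card K = 9" using B K SL2.card_r_coset[OF bases_sub[OF K(1)] K(2)] by simp
  then consider "K = C" | "K \<in> \<D>" using K card_sylow by (auto simp: bases_def)
  then show ?thesis
  proof cases
    case 1
    have "\<one>\<^bsub>SL2\<^esub> \<in> C #>\<^bsub>SL2\<^esub> x" using B K 1 subgroup.one_closed by blast
    then have "C #>\<^bsub>SL2\<^esub> x = C #>\<^bsub>SL2\<^esub> \<one>\<^bsub>SL2\<^esub>"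
      using SL2.repr_independence[OF _ K(2) C_subgroup] by blast
    then show ?thesis using K 1 SL2.coset_mult_one[OF C_sub] by simp
  next
    case 2
    have "quotients B = quotients K" unfolding K(3) by (rule quotients_r_coset[OF bases_sub[OF K(1)] K(2)])
    then have "card (B - {\<one>\<^bsub>SL2\<^esub>}) = 72" using D_props(4)[OF 2] quotients_subgroup[OF B(2)] by simp
    moreover have "card (B - {\<one>\<^bsub>SL2\<^esub>}) \<le> 9" using B(3) card_Diff1_le[of B] by simp
    ultimately show ?thesis by simp
  qed
qed

lemma short_blocks: "{B \<in> blocks U. card B = 8} = geo.lines"
proof -
  have "card (K #>\<^bsub>SL2\<^esub> x) = 8 \<longleftrightarrow> K \<in> sylows" if "K \<in> bases \<D>" "x \<in> carrier SL2" for K x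
    using SL2.card_r_coset[OF bases_sub[OF that(1)] that(2)] that(1) card_C card_sylow D_props(3)
    by (auto simp: bases_def)
  then show ?thesis unfolding blocks_eq geo.lines_def bases_def by blast
qed

lemma C_comm: "x \<in> C \<Longrightarrow> y \<in> C \<Longrightarrow> x \<otimes>\<^bsub>SL2\<^esub> y = y \<otimes>\<^bsub>SL2\<^esub> x"
  unfolding C_iff using SL2.nat_pow_mult[OF g_closed] by (metis add.commute)

lemma stabilizer_hom:
  assumes \<alpha>: "\<alpha> \<in> carrier (Aut_group U)" and one: "\<alpha> \<one>\<^bsub>SL2\<^esub> = \<one>\<^bsub>SL2\<^esub>"
  shows "\<alpha> \<in> auto SL2" "\<alpha> ` C = C" "P \<in> sylows \<Longrightarrow> \<alpha> ` P \<in> sylows"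
proof -
  have Bij: "\<alpha> \<in> Bij (carrier SL2)" and im: "(`) \<alpha> ` blocks U = blocks U"
    using \<alpha> by (auto simp: Aut_group_carrier)
  then have bij: "bij_betw \<alpha> (carrier SL2) (carrier SL2)" by (simp add: Bij_def)
  then have inj: "inj_on \<alpha> (carrier SL2)" by (simp add: bij_betw_def)
  have closed: "\<alpha> x \<in> carrier SL2" if "x \<in> carrier SL2" for x using Bij_apply[OF Bij that] .
  have card_im: "card (\<alpha> ` B) = card B" if "B \<subseteq> carrier SL2" for B
    using inj that by (meson card_image inj_on_subset)
  have lines: "(`) \<alpha> ` geo.lines = geo.lines"
  proof -
    have "card (\<alpha> ` B) = card B" if "B \<in> blocks U" for B
      using card_im blocks_sub that by auto
    then have "(`) \<alpha> ` {B \<in> blocks U. card B = 8} = {B \<in> (`) \<alpha> ` blocks U. card B = 8}"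
      by auto
    then show ?thesis unfolding im short_blocks .
  qed
  show "\<alpha> ` P \<in> sylows" if P: "P \<in> sylows" for P
  proof -
    have "\<alpha> ` P \<in> geo.lines" using lines geo.PP_line[OF P] by blast
    moreover have "\<one>\<^bsub>SL2\<^esub> \<in> \<alpha> ` P"
      using one subgroup.one_closed[OF geo.PP_subgroup[OF P]] by (metis image_eqI)
    ultimately show ?thesis using geo.line_through_one by blast
  qed
  note dich = geo.line_automorphism[OF bij lines one]
  have C_block: "C \<in> blocks U"
    using blocksI[of C "\<one>\<^bsub>SL2\<^esub>"] SL2.coset_mult_one[OF C_sub] by (simp add: bases_def one_SL2)
  \<comment> \<open>On the commutative C automorphisms and anti-automorphisms satisfy the same
    equation, so the image of C is a subgroup in either case.\<close>
  have hom_C: "\<alpha> (x \<otimes>\<^bsub>SL2\<^esub> y) = \<alpha> x \<otimes>\<^bsub>SL2\<^esub> \<alpha> y" if "x \<in> C" "y \<in> C" for x y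
  proof -
    have xy: "x \<in> carrier SL2" "y \<in> carrier SL2" using that C_sub by blast+
    show ?thesis
      using dich
    proof
      assume "\<forall>x\<in>carrier SL2. \<forall>y\<in>carrier SL2. \<alpha> (x \<otimes>\<^bsub>SL2\<^esub> y) = \<alpha> y \<otimes>\<^bsub>SL2\<^esub> \<alpha> x"
      then have "\<alpha> (y \<otimes>\<^bsub>SL2\<^esub> x) = \<alpha> x \<otimes>\<^bsub>SL2\<^esub> \<alpha> y" using xy by blast
      then show ?thesis unfolding C_comm[OF that] .
    qed (use xy in blast)
  qed
  interpret C: subgroup C SL2 by (rule C_subgroup)
  have "subgroup (\<alpha> ` C) SL2"
  proof (rule SL2.subgroupI)
    show "\<alpha> ` C \<subseteq> carrier SL2" using closed C_sub by blast
    show "\<alpha> ` C \<noteq> {}" using C.one_closed by blast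
  next
    fix x assume "x \<in> \<alpha> ` C"
    then obtain c where c: "c \<in> C" "x = \<alpha> c" by blast
    have "\<alpha> (inv\<^bsub>SL2\<^esub> c) \<otimes>\<^bsub>SL2\<^esub> x = \<one>\<^bsub>SL2\<^esub>"
      unfolding c(2) hom_C[OF C.m_inv_closed[OF c(1)] c(1), symmetric]
      using SL2.l_inv[OF C.mem_carrier[OF c(1)]] one by simp
    then have "inv\<^bsub>SL2\<^esub> x = \<alpha> (inv\<^bsub>SL2\<^esub> c)"
      using SL2.inv_equality closed c C.mem_carrier C.m_inv_closed by blast
    then show "inv\<^bsub>SL2\<^esub> x \<in> \<alpha> ` C" using C.m_inv_closed[OF c(1)] by blast
  next
    fix x y assume "x \<in> \<alpha> ` C" "y \<in> \<alpha> ` C"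
    then obtain c d where cd: "c \<in> C" "d \<in> C" "x = \<alpha> c" "y = \<alpha> d" by blast
    then have "x \<otimes>\<^bsub>SL2\<^esub> y = \<alpha> (c \<otimes>\<^bsub>SL2\<^esub> d)" using hom_C[OF cd(1,2)] by (simp del: mult_SL2)
    then show "x \<otimes>\<^bsub>SL2\<^esub> y \<in> \<alpha> ` C" using C.m_closed[OF cd(1,2)] by blast
  qed
  moreover have "\<alpha> ` C \<in> blocks U" using im C_block by blast
  moreover have "card (\<alpha> ` C) = 9" using card_im[OF C_sub] card_C by simp
  ultimately show \<alpha>C: "\<alpha> ` C = C" using block_subgroup by blast
  have "\<forall>x\<in>carrier SL2. \<forall>y\<in>carrier SL2. \<alpha> (x \<otimes>\<^bsub>SL2\<^esub> y) = \<alpha> x \<otimes>\<^bsub>SL2\<^esub> \<alpha> y"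
  proof (rule ccontr)
    assume "\<not> ?thesis"
    then have anti: "\<alpha> (x \<otimes>\<^bsub>SL2\<^esub> y) = \<alpha> y \<otimes>\<^bsub>SL2\<^esub> \<alpha> x" if "x \<in> carrier SL2" "y \<in> carrier SL2" for x y
      using dich that by blast
    define u where "u = mat2 1 z 0 1"
    have u: "u \<in> carrier SL2" by (simp add: u_def)
    \<comment> \<open>An anti-automorphism fixing C as a set maps the block C x to u^-1 C, and right
      translation by u makes the conjugate of C by u a block. Being a subgroup of order 9 it would
      equal C, against \<open>CM_not_normal\<close>.\<close>
    obtain x where x: "x \<in> carrier SL2" "\<alpha> x = inv\<^bsub>SL2\<^esub> u"
      using bij SL2.inv_closed[OF u] by (metis bij_betw_imp_surj_on imageE)
    have "\<alpha> ` (C #>\<^bsub>SL2\<^esub> x) = (\<lambda>c. inv\<^bsub>SL2\<^esub> u \<otimes>\<^bsub>SL2\<^esub> c) ` C"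
    proof -
      have "\<alpha> ` (C #>\<^bsub>SL2\<^esub> x) = (\<lambda>c. inv\<^bsub>SL2\<^esub> u \<otimes>\<^bsub>SL2\<^esub> \<alpha> c) ` C"
        unfolding SL2.r_coset_image image_image
        using anti x C.mem_carrier by (intro image_cong) auto
      also have "\<dots> = (\<lambda>c. inv\<^bsub>SL2\<^esub> u \<otimes>\<^bsub>SL2\<^esub> c) ` (\<alpha> ` C)" by (simp add: image_image)
      finally show ?thesis unfolding \<alpha>C .
    qed
    then have "\<alpha> ` (C #>\<^bsub>SL2\<^esub> x) #>\<^bsub>SL2\<^esub> u = conj_set SL2 C u"
      by (simp add: SL2.r_coset_image image_image conj_set_def conj_by_def)
    moreover have "\<alpha> ` (C #>\<^bsub>SL2\<^esub> x) \<in> blocks U"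
      using im block_shift[OF C_block x(1)] by blast
    ultimately have "conj_set SL2 C u \<in> blocks U" using block_shift u by metis
    then have "conj_set SL2 C u = C"
      using block_subgroup SL2.subgroup_conj_set[OF C_subgroup u] SL2.card_conj_set[OF C_sub u] card_C by simp
    moreover have "g \<in> C" using C_iff[of g] by (metis SL2.nat_pow_eone g_closed)
    ultimately have "conj_by SL2 u g \<in> C" unfolding conj_set_def by blast
    moreover have "u = valM z (Z0, Z1, Zero, Z0)" by (simp add: u_def)
    ultimately have "valM z (conjM (Z0, Z1, Zero, Z0) gM) \<in> C"
      using valM_conj[of "(Z0, Z1, Zero, Z0)" gM] valM_g by simp
    then show False using CM_not_normal unfolding C_eq by (simp add: inj_image_mem_iff[OF inj_valM])
  qed
  then show "\<alpha> \<in> auto SL2" using Bij closed by (auto simp: auto_def hom_def)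
qed

end

lemma (in group) conj_map_auto: "x \<in> carrier G \<Longrightarrow> conj_map G x \<in> auto G"
proof -
  assume x: "x \<in> carrier G"
  have "bij_betw (conj_map G x) (carrier G) (carrier G)"
    unfolding conj_map_def using bij_betw_conj_by[OF x] by (simp add: bij_betw_def inj_on_def)
  then show ?thesis
    using x by (simp add: auto_def Bij_def conj_map_def hom_def conj_by_mult)
qed

lemma (in group) conj_map_apply: "x \<in> carrier G \<Longrightarrow> conj_map G y x = conj_by G y x"
  by (simp add: conj_map_def)

lemma (in group) auto_apply:
  assumes "\<alpha> \<in> auto G"
  shows "x \<in> carrier G \<Longrightarrow> \<alpha> x \<in> carrier G"
    and "x \<in> carrier G \<Longrightarrow> y \<in> carrier G \<Longrightarrow> \<alpha> (x \<otimes> y) = \<alpha> x \<otimes> \<alpha> y"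
    and "\<alpha> \<one> = \<one>"
    and "x \<in> carrier G \<Longrightarrow> \<alpha> (x [^] (n::nat)) = \<alpha> x [^] n"
    and "inj_on \<alpha> (carrier G)"
proof -
  have "\<alpha> \<in> hom G G" using assms by (simp add: auto_def)
  then interpret \<alpha>: group_hom G G \<alpha> by unfold_locales
  show "x \<in> carrier G \<Longrightarrow> \<alpha> x \<in> carrier G"
    "x \<in> carrier G \<Longrightarrow> y \<in> carrier G \<Longrightarrow> \<alpha> (x \<otimes> y) = \<alpha> x \<otimes> \<alpha> y" "\<alpha> \<one> = \<one>"
    "x \<in> carrier G \<Longrightarrow> \<alpha> (x [^] (n::nat)) = \<alpha> x [^] n"
    by (simp_all add: \<alpha>.hom_nat_pow)
  show "inj_on \<alpha> (carrier G)" using assms by (simp add: auto_def Bij_def bij_betw_def)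
qed

section \<open>Conjugation by g, conjugation by f and Frobenius as permutations\<close>

context f8_field
begin

abbreviation "BG \<equiv> BijGroup (carrier (SL2 :: ('a^2^2) monoid))"

sublocale B: group BG
  by (rule group_BijGroup)

abbreviation "\<gamma> \<equiv> conj_map SL2 g"
abbreviation "\<tau> \<equiv> conj_map SL2 (f_mat :: 'a^2^2)"
abbreviation "\<phi> \<equiv> frob_map :: 'a^2^2 \<Rightarrow> 'a^2^2"

text \<open>Preservation of \<open>sylows\<close> is part of the definition, since
  \<open>automorphism_fixing_regular\<close> asks for it. It is checked for conjugations and
  Frobenius, and the geometry provides it for stabilizers.\<close>

definition sylow_autos :: "('a^2^2 \<Rightarrow> 'a^2^2) set" where
  "sylow_autos = {\<kappa> \<in> auto SL2. \<forall>P\<in>sylows. \<kappa> ` P \<in> sylows}"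

lemma auto_Bij: "\<alpha> \<in> auto SL2 \<Longrightarrow> \<alpha> \<in> Bij (carrier (SL2 :: ('a^2^2) monoid))"
  by (simp add: auto_def)

lemma sylow_autos_Bij: "\<alpha> \<in> sylow_autos \<Longrightarrow> \<alpha> \<in> Bij (carrier SL2)"
  by (simp add: sylow_autos_def auto_def)

lemma sylow_autos_mult:
  assumes "\<alpha> \<in> sylow_autos" "\<beta> \<in> sylow_autos"
  shows "\<alpha> \<otimes>\<^bsub>BG\<^esub> \<beta> \<in> sylow_autos"
proof -
  have "\<alpha> \<otimes>\<^bsub>BG\<^esub> \<beta> \<in> auto SL2"
    by (rule subgroup.m_closed[OF SL2.subgroup_auto]) (use assms in \<open>auto simp: sylow_autos_def\<close>)
  moreover have "(\<alpha> \<otimes>\<^bsub>BG\<^esub> \<beta>) ` P \<in> sylows" if P: "P \<in> sylows" for P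
    using BijGroup_mult_image[OF sylow_autos_Bij sylow_autos_Bij geo.PP_sub[OF P]] assms P
    by (simp add: sylow_autos_def)
  ultimately show ?thesis by (simp add: sylow_autos_def)
qed

lemma sylow_autos_pow: "\<alpha> \<in> sylow_autos \<Longrightarrow> \<alpha> [^]\<^bsub>BG\<^esub> (n::nat) \<in> sylow_autos"
proof (induction n)
  case 0
  have "\<one>\<^bsub>BG\<^esub> \<in> auto SL2" using subgroup.one_closed[OF SL2.subgroup_auto] .
  moreover have "\<one>\<^bsub>BG\<^esub> ` P = P" if "P \<in> sylows" for P
  proof -
    have "\<one>\<^bsub>BG\<^esub> ` P = (\<lambda>x. x) ` P"
    proof (rule image_cong[OF refl])
      fix x assume "x \<in> P"
      then have "x \<in> carrier SL2" using geo.PP_sub[OF that] by blast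
      then show "\<one>\<^bsub>BG\<^esub> x = x" by (rule BijGroup_one_apply)
    qed
    then show ?thesis by simp
  qed
  ultimately show ?case by (simp add: sylow_autos_def)
qed (simp add: sylow_autos_mult)

lemma conj_map_sylow_autos: "x \<in> carrier SL2 \<Longrightarrow> conj_map SL2 x \<in> sylow_autos"
proof -
  assume x: "x \<in> carrier SL2"
  have "conj_map SL2 x ` P = conj_set SL2 P x" if "P \<in> sylows" for P
    unfolding conj_set_def conj_map_def using geo.PP_sub[OF that] by (intro image_cong) (auto simp del: carrier_SL2)
  then show ?thesis using SL2.conj_map_auto[OF x] geo.PP_conj x by (simp add: sylow_autos_def)
qed

lemma frob_mat_mult: "frob_mat (A ** B) = frob_mat A ** frob_mat (B :: 'a^2^2)"
proof -
  obtain a b c d where A: "A = mat2 a b c d" by (rule mat2_cases)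
  obtain a' b' c' d' where B: "B = mat2 a' b' c' d'" by (rule mat2_cases)
  show ?thesis by (simp add: A B power2_add power_mult_distrib)
qed

lemma frob_mat_closed: "A \<in> carrier SL2 \<Longrightarrow> frob_mat (A :: 'a^2^2) \<in> carrier SL2"
proof -
  assume A: "A \<in> carrier SL2"
  obtain a b c d where "A = mat2 a b c d" by (rule mat2_cases)
  then show ?thesis using A by (simp flip: power_mult_distrib power2_add)
qed

lemma frob_mat_inj: "frob_mat A = frob_mat (B :: 'a^2^2) \<longleftrightarrow> A = B"
proof -
  obtain a b c d where A: "A = mat2 a b c d" by (rule mat2_cases)
  obtain a' b' c' d' where B: "B = mat2 a' b' c' d'" by (rule mat2_cases)
  show ?thesis by (simp add: A B)
qed

lemma frob_apply: "x \<in> carrier SL2 \<Longrightarrow> \<phi> x = frob_mat x"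
  by (simp add: frob_map_def)

lemma frob_auto: "\<phi> \<in> auto SL2"
proof -
  have inj: "inj_on \<phi> (carrier SL2)"
    by (auto simp: inj_on_def frob_map_def frob_mat_inj)
  moreover have "\<phi> ` carrier SL2 \<subseteq> carrier SL2"
    using frob_mat_closed by (auto simp: frob_apply simp del: carrier_SL2)
  ultimately have "\<phi> ` carrier SL2 = carrier SL2"
    using endo_inj_surj[OF finite_SL2] by blast
  then show ?thesis
    using inj frob_mat_closed SL2.m_closed
    by (simp add: auto_def Bij_def bij_betw_def hom_def frob_map_def frob_mat_mult det_mul)
qed

text \<open>Frobenius squares the parameter of a unipotent matrix, so it maps the conjugate by h
  into the conjugate by the image of h; equal cardinalities give equality.\<close>

lemma frob_sylow_autos: "\<phi> \<in> sylow_autos"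
proof -
  have "\<phi> ` P \<in> sylows" if P: "P \<in> sylows" for P
  proof -
    obtain h where h: "h \<in> carrier SL2" "P = conj_set SL2 unipotent h" using P by (auto simp: sylows_def)
    interpret \<phi>: group_hom SL2 SL2 \<phi>
      using frob_auto group_SL2 by (simp add: group_hom_def group_hom_axioms_def auto_def)
    have sub: "\<phi> ` P \<subseteq> conj_set SL2 unipotent (\<phi> h)"
    proof
      fix y assume "y \<in> \<phi> ` P"
      then obtain t where y: "y = \<phi> (conj_by SL2 h (mat2 1 t 0 1))"
        unfolding h(2) conj_set_def unipotent_def by blast
      have u: "mat2 1 t 0 1 \<in> carrier SL2" by simp
      have "y = conj_by SL2 (\<phi> h) (\<phi> (mat2 1 t 0 1))"
        unfolding y conj_by_def using h(1) u by (simp del: mult_SL2 carrier_SL2 inv_SL2)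
      also have "\<phi> (mat2 1 t 0 1) = mat2 1 (t\<^sup>2) 0 1" using frob_apply[OF u] by simp
      finally show "y \<in> conj_set SL2 unipotent (\<phi> h)" by (simp add: conj_set_def)
    qed
    have \<phi>h: "\<phi> h \<in> carrier SL2" using h(1) SL2.auto_apply(1)[OF frob_auto] by blast
    have c1: "card (\<phi> ` P) = 8"
      using card_sylow[OF P] card_image[OF inj_on_subset[OF SL2.auto_apply(5)[OF frob_auto] geo.PP_sub[OF P]]]
      by simp
    have c2: "card (conj_set SL2 unipotent (\<phi> h)) = 8"
      using SL2.card_conj_set[OF unipotent_sub \<phi>h] card_unipotent by simp
    have fin: "finite (conj_set SL2 unipotent (\<phi> h))"
      by (rule finite_subset[OF SL2.conj_set_closed[OF unipotent_sub \<phi>h] finite_SL2])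
    have "\<phi> ` P = conj_set SL2 unipotent (\<phi> h)"
      by (rule card_subset_eq[OF fin sub]) (simp only: c1 c2)
    then show ?thesis unfolding sylows_def using \<phi>h by (rule image_eqI)
  qed
  then show ?thesis using frob_auto by (simp add: sylow_autos_def)
qed

lemma g_pow_eq: "g [^]\<^bsub>SL2\<^esub> (i::nat) = g [^]\<^bsub>SL2\<^esub> j \<longleftrightarrow> i mod 9 = j mod 9"
  using SL2.pow_eq_iff_mod[OF g_closed] ord_g by simp

text \<open>Composition of maps multiplies the conjugating elements in the opposite order, which
  makes no difference for powers of a single element.\<close>

lemma conj_map_pow: "conj_map SL2 (g [^]\<^bsub>SL2\<^esub> (n::nat)) = \<gamma> [^]\<^bsub>BG\<^esub> n"
proof (induction n)
  case 0
  have "conj_map SL2 (\<one>\<^bsub>SL2\<^esub> :: 'a^2^2) = \<one>\<^bsub>BG\<^esub>"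
    by (auto simp: conj_map_def BijGroup_def fun_eq_iff simp del: carrier_SL2)
  then show ?case by simp
next
  case (Suc n)
  have G: "g [^]\<^bsub>SL2\<^esub> n \<in> carrier SL2" "g [^]\<^bsub>SL2\<^esub> Suc n \<in> carrier SL2"
    using SL2.nat_pow_closed[OF g_closed] by blast+
  have \<gamma>: "\<gamma> \<in> Bij (carrier SL2)" "\<gamma> [^]\<^bsub>BG\<^esub> n \<in> Bij (carrier SL2)"
    using sylow_autos_Bij sylow_autos_pow conj_map_sylow_autos[OF g_closed] by blast+
  have pow: "(\<gamma> [^]\<^bsub>BG\<^esub> n) y = conj_by SL2 (g [^]\<^bsub>SL2\<^esub> n) y" if "y \<in> carrier SL2" for y
    unfolding Suc[symmetric] using that by (simp add: conj_map_def)
  show ?case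
  proof (rule Bij_eqI)
    show "conj_map SL2 (g [^]\<^bsub>SL2\<^esub> Suc n) \<in> Bij (carrier SL2)"
      using sylow_autos_Bij conj_map_sylow_autos[OF G(2)] by blast
    show "\<gamma> [^]\<^bsub>BG\<^esub> Suc n \<in> Bij (carrier SL2)" 
      using sylow_autos_Bij sylow_autos_pow conj_map_sylow_autos[OF g_closed] by blast
  next
    fix x :: "'a^2^2" assume x: "x \<in> carrier SL2"
    have "(\<gamma> [^]\<^bsub>BG\<^esub> Suc n) x = (\<gamma> [^]\<^bsub>BG\<^esub> n) (\<gamma> x)"
      using BijGroup_mult_apply[OF \<gamma>(2,1) x] by simp
    also have "\<dots> = conj_by SL2 (g [^]\<^bsub>SL2\<^esub> n) (conj_by SL2 g x)"
      using x pow[OF SL2.conj_by_closed[OF g_closed x]] by (simp add: conj_map_def)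
    also have "\<dots> = conj_by SL2 (g \<otimes>\<^bsub>SL2\<^esub> g [^]\<^bsub>SL2\<^esub> n) x"
      using SL2.conj_by_conj_by[OF g_closed G(1) x] .
    also have "g \<otimes>\<^bsub>SL2\<^esub> g [^]\<^bsub>SL2\<^esub> n = g [^]\<^bsub>SL2\<^esub> Suc n"
      using SL2.nat_pow_Suc2[OF g_closed] by simp
    finally show "conj_map SL2 (g [^]\<^bsub>SL2\<^esub> Suc n) x = (\<gamma> [^]\<^bsub>BG\<^esub> Suc n) x"
      unfolding SL2.conj_map_apply[OF x] by (rule sym)
  qed
qed

lemma \<gamma>_pow_apply: "x \<in> carrier SL2 \<Longrightarrow> (\<gamma> [^]\<^bsub>BG\<^esub> (n::nat)) x = conj_by SL2 (g [^]\<^bsub>SL2\<^esub> n) x"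
  unfolding conj_map_pow[symmetric] by (simp add: conj_map_def)

lemma \<phi>_g: "\<phi> g = g [^]\<^bsub>SL2\<^esub> (7::nat)"
proof -
  have "\<phi> g = frob_mat (valM z gM)" using frob_apply[OF g_closed] valM_g by simp
  also have "\<dots> = g [^]\<^bsub>SL2\<^esub> (7::nat)" unfolding valM_frob[symmetric] frobM_gM valM_pow ..
  finally show ?thesis .
qed

lemma \<tau>_g: "\<tau> g = g [^]\<^bsub>SL2\<^esub> (8::nat)"
proof -
  have "\<tau> g = conj_by SL2 (valM z fM) (valM z gM)"
    using g_closed by (simp add: conj_map_def valM_f valM_g)
  also have "\<dots> = g [^]\<^bsub>SL2\<^esub> (8::nat)"
    unfolding valM_conj[OF det_f, symmetric] conjM_fM_gM valM_pow ..
  finally show ?thesis .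
qed

lemma \<tau>_\<tau>: "\<tau> \<otimes>\<^bsub>BG\<^esub> \<tau> = \<one>\<^bsub>BG\<^esub>"
proof (rule Bij_eqI)
  have \<tau>: "\<tau> \<in> Bij (carrier SL2)" using sylow_autos_Bij conj_map_sylow_autos[OF f_closed] by blast
  then show "\<tau> \<otimes>\<^bsub>BG\<^esub> \<tau> \<in> Bij (carrier SL2)" using B.m_closed by simp
  show "\<one>\<^bsub>BG\<^esub> \<in> Bij (carrier SL2)" using B.one_closed by simp
  fix x :: "'a^2^2" assume x: "x \<in> carrier SL2"
  have ff: "f_mat \<otimes>\<^bsub>SL2\<^esub> f_mat = (\<one>\<^bsub>SL2\<^esub> :: 'a^2^2)" by (simp add: f_mat_def one_SL2)
  have "(\<tau> \<otimes>\<^bsub>BG\<^esub> \<tau>) x = conj_by SL2 (f_mat \<otimes>\<^bsub>SL2\<^esub> f_mat) x"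
    unfolding BijGroup_mult_apply[OF \<tau> \<tau> x] SL2.conj_by_conj_by[OF f_closed f_closed x, symmetric]
    using x SL2.conj_by_closed[OF f_closed x] by (simp add: conj_map_def)
  then show "(\<tau> \<otimes>\<^bsub>BG\<^esub> \<tau>) x = \<one>\<^bsub>BG\<^esub> x"
    unfolding ff using SL2.conj_by_one[OF x] BijGroup_one_apply[OF x] by simp
qed

lemma g_ne: "\<not> 9 dvd n \<Longrightarrow> g [^]\<^bsub>SL2\<^esub> (n::nat) \<noteq> \<one>\<^bsub>SL2\<^esub>"
  using g_pow_eq[of n 0] by (simp add: mod_eq_0_iff_dvd)

lemma \<gamma>_Bij: "\<gamma> \<in> carrier BG" and \<tau>_Bij: "\<tau> \<in> carrier BG" and \<phi>_Bij: "\<phi> \<in> carrier BG"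
  using sylow_autos_Bij conj_map_sylow_autos[OF g_closed] conj_map_sylow_autos[OF f_closed] frob_sylow_autos
  by auto

text \<open>The order divides 9. It does not divide 3, since otherwise g^3 would centralize, and in
  particular normalize, the upper unitriangular group.\<close>

lemma ord_\<gamma>: "B.ord \<gamma> = 9"
proof -
  have 9: "\<gamma> [^]\<^bsub>BG\<^esub> (9::nat) = \<one>\<^bsub>BG\<^esub>"
    using conj_map_pow[of 9] conj_map_pow[of 0] g_pow_eq[of 9 0] by simp
  have "\<gamma> [^]\<^bsub>BG\<^esub> (3::nat) \<noteq> \<one>\<^bsub>BG\<^esub>"
  proof
    assume one: "\<gamma> [^]\<^bsub>BG\<^esub> (3::nat) = \<one>\<^bsub>BG\<^esub>"
    obtain a b c d where e: "(mulM gM ^^ 3) idM = (a, b, c, d)" by (metis prod.collapse)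
    then have c: "c \<noteq> Zero" using gM_pow_3 by simp
    have g3: "g [^]\<^bsub>SL2\<^esub> (3::nat) = mat2 (val8 z a) (val8 z b) (val8 z c) (val8 z d)"
      using valM_pow[of 3] e by simp
    have "conj_by SL2 (g [^]\<^bsub>SL2\<^esub> (3::nat)) u = u" if "u \<in> unipotent" for u
      using \<gamma>_pow_apply[of u 3] BijGroup_one_apply[of u] that unipotent_sub one by auto
    then have "conj_set SL2 unipotent (g [^]\<^bsub>SL2\<^esub> (3::nat)) = unipotent"
      by (simp add: conj_set_def)
    moreover have "g [^]\<^bsub>SL2\<^esub> (3::nat) \<in> carrier SL2" using SL2.nat_pow_closed[OF g_closed] .
    ultimately show False
      unfolding g3 using conj_unipotent_eq_iff[of "val8 z a" "val8 z d" "val8 z b" "val8 z c"] c by simp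
  qed
  then have "\<not> B.ord \<gamma> dvd 3" using B.pow_eq_id[OF \<gamma>_Bij] by blast
  moreover have "B.ord \<gamma> dvd 3 ^ 2" using B.pow_eq_id[OF \<gamma>_Bij] 9 by simp
  moreover have "prime (3::nat)" by simp
  ultimately obtain i where i: "i \<le> 2" "B.ord \<gamma> = 3 ^ i"
    using divides_primepow_nat by blast
  with \<open>\<not> B.ord \<gamma> dvd 3\<close> have "i \<noteq> 0" "i \<noteq> 1"
    by (metis one_dvd power_0, metis dvd_refl power_one_right)
  then have "i = 2" using i(1) by simp
  then show ?thesis using i by simp
qed

lemma \<phi>_pow_g: "(\<phi> [^]\<^bsub>BG\<^esub> (j::nat)) g = g [^]\<^bsub>SL2\<^esub> (7 ^ j :: nat)"
proof (induction j)
  case 0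
  then show ?case using BijGroup_one_apply[OF g_closed] SL2.nat_pow_eone[OF g_closed] by simp
next
  case (Suc j)
  have \<phi>j: "\<phi> [^]\<^bsub>BG\<^esub> j \<in> sylow_autos" using sylow_autos_pow frob_sylow_autos by blast
  have "(\<phi> [^]\<^bsub>BG\<^esub> Suc j) g = (\<phi> [^]\<^bsub>BG\<^esub> j) (\<phi> g)"
    using BijGroup_mult_apply[OF sylow_autos_Bij[OF \<phi>j] sylow_autos_Bij[OF frob_sylow_autos] g_closed] by simp
  also have "\<dots> = ((\<phi> [^]\<^bsub>BG\<^esub> j) g) [^]\<^bsub>SL2\<^esub> (7::nat)"
    unfolding \<phi>_g using SL2.auto_apply(4)[OF _ g_closed] \<phi>j by (simp add: sylow_autos_def)
  also have "\<dots> = g [^]\<^bsub>SL2\<^esub> (7 ^ Suc j :: nat)"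
    unfolding Suc SL2.nat_pow_pow[OF g_closed] by (simp add: mult.commute)
  finally show ?case .
qed

lemma frobM_cube: "frobM (frobM (frobM m)) = m"
proof -
  have "mul8 (mul8 (mul8 c c) (mul8 c c)) (mul8 (mul8 c c) (mul8 c c)) = c" for c
    by (cases c) simp_all
  then show ?thesis by (cases m) simp
qed

lemma ord_\<phi>: "B.ord \<phi> = 3"
proof -
  have b: "\<phi> \<in> Bij (carrier SL2)" using \<phi>_Bij by simp
  have b2: "\<phi> \<otimes>\<^bsub>BG\<^esub> \<phi> \<in> Bij (carrier SL2)" using B.m_closed \<phi>_Bij by simp
  have "(\<phi> \<otimes>\<^bsub>BG\<^esub> \<phi>) \<otimes>\<^bsub>BG\<^esub> \<phi> = \<one>\<^bsub>BG\<^esub>"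
  proof (rule Bij_eqI)
    show "(\<phi> \<otimes>\<^bsub>BG\<^esub> \<phi>) \<otimes>\<^bsub>BG\<^esub> \<phi> \<in> Bij (carrier SL2)" using B.m_closed b b2 by simp
    show "\<one>\<^bsub>BG\<^esub> \<in> Bij (carrier SL2)" using B.one_closed by simp
    fix x :: "'a^2^2" assume x: "x \<in> carrier SL2"
    obtain m where m: "x = valM z m" using surj_valM by blast
    have x1: "frob_mat x \<in> carrier SL2" and x2: "frob_mat (frob_mat x) \<in> carrier SL2"
      using frob_mat_closed x by blast+
    have "((\<phi> \<otimes>\<^bsub>BG\<^esub> \<phi>) \<otimes>\<^bsub>BG\<^esub> \<phi>) x = frob_mat (frob_mat (frob_mat x))"
      using BijGroup_mult_apply[OF b2 b x] BijGroup_mult_apply[OF b b x1] frob_apply x x1 x2 by simp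
    also have "\<dots> = x" unfolding m valM_frob[symmetric] frobM_cube ..
    finally show "((\<phi> \<otimes>\<^bsub>BG\<^esub> \<phi>) \<otimes>\<^bsub>BG\<^esub> \<phi>) x = \<one>\<^bsub>BG\<^esub> x"
      using BijGroup_one_apply[OF x] by simp
  qed
  then have "\<phi> [^]\<^bsub>BG\<^esub> (3::nat) = \<one>\<^bsub>BG\<^esub>"
    using \<phi>_Bij by (simp add: numeral_3_eq_3)
  then have "B.ord \<phi> dvd 3" using B.pow_eq_id[OF \<phi>_Bij] by blast
  moreover have "B.ord \<phi> \<noteq> 1"
  proof
    assume "B.ord \<phi> = 1"
    then have "\<phi> g = g" using B.ord_eq_1[OF \<phi>_Bij] BijGroup_one_apply[OF g_closed] by simp
    then have "g [^]\<^bsub>SL2\<^esub> (7::nat) = g [^]\<^bsub>SL2\<^esub> (1::nat)"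
      using \<phi>_g SL2.nat_pow_eone[OF g_closed] by simp
    then show False using g_pow_eq[of 7 1] by simp
  qed
  moreover have "prime (3::nat)" by simp
  ultimately show ?thesis by (auto simp: prime_nat_iff)
qed

text \<open>An automorphism turns conjugation by g into conjugation by the image of g, here g^7.
  This is the metacyclic relation with r = 7.\<close>

lemma \<phi>_\<gamma>: "\<phi> \<otimes>\<^bsub>BG\<^esub> \<gamma> = \<gamma> [^]\<^bsub>BG\<^esub> (7::nat) \<otimes>\<^bsub>BG\<^esub> \<phi>"
proof (rule Bij_eqI)
  have b: "\<phi> \<in> Bij (carrier SL2)" "\<gamma> \<in> Bij (carrier SL2)" using \<phi>_Bij \<gamma>_Bij by auto
  have b7: "\<gamma> [^]\<^bsub>BG\<^esub> (7::nat) \<in> Bij (carrier SL2)" using B.nat_pow_closed[OF \<gamma>_Bij] by simp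
  show "\<phi> \<otimes>\<^bsub>BG\<^esub> \<gamma> \<in> Bij (carrier SL2)" using B.m_closed b by simp
  show "\<gamma> [^]\<^bsub>BG\<^esub> (7::nat) \<otimes>\<^bsub>BG\<^esub> \<phi> \<in> Bij (carrier SL2)" using B.m_closed b b7 by simp
  fix x :: "'a^2^2" assume x: "x \<in> carrier SL2"
  interpret \<phi>: group_hom SL2 SL2 \<phi>
    using frob_auto group_SL2 by (simp add: group_hom_def group_hom_axioms_def auto_def)
  have "(\<phi> \<otimes>\<^bsub>BG\<^esub> \<gamma>) x = \<phi> (conj_by SL2 g x)"
    unfolding BijGroup_mult_apply[OF b x] using x by (simp add: conj_map_def)
  also have "\<dots> = conj_by SL2 (\<phi> g) (\<phi> x)"
    unfolding conj_by_def using x g_closed by (simp del: mult_SL2 carrier_SL2)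
  also have "\<dots> = (\<gamma> [^]\<^bsub>BG\<^esub> (7::nat)) (\<phi> x)"
    unfolding \<phi>_g using \<gamma>_pow_apply \<phi>.hom_closed[OF x] by simp
  also have "\<dots> = (\<gamma> [^]\<^bsub>BG\<^esub> (7::nat) \<otimes>\<^bsub>BG\<^esub> \<phi>) x"
    unfolding BijGroup_mult_apply[OF b7 b(1) x] ..
  finally show "(\<phi> \<otimes>\<^bsub>BG\<^esub> \<gamma>) x = (\<gamma> [^]\<^bsub>BG\<^esub> (7::nat) \<otimes>\<^bsub>BG\<^esub> \<phi>) x" .
qed

text \<open>A power of \<gamma> fixes g, whereas the j-th power of Frobenius sends g to g^(7^j). For
  j below 3 these agree modulo 9 only if j = 0.\<close>

lemma Gamma_inter_L: "generate BG {\<gamma>} \<inter> generate BG {\<phi>} = {\<one>\<^bsub>BG\<^esub>}"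
proof
  show "{\<one>\<^bsub>BG\<^esub>} \<subseteq> generate BG {\<gamma>} \<inter> generate BG {\<phi>}" by (auto intro: generate.one)
  show "generate BG {\<gamma>} \<inter> generate BG {\<phi>} \<subseteq> {\<one>\<^bsub>BG\<^esub>}"
  proof
    fix x assume x: "x \<in> generate BG {\<gamma>} \<inter> generate BG {\<phi>}"
    obtain i :: nat where i: "x = \<gamma> [^]\<^bsub>BG\<^esub> i"
      using x B.generate_singleton_iff[OF \<gamma>_Bij] ord_\<gamma> by auto
    obtain j :: nat where j: "j < 3" "x = \<phi> [^]\<^bsub>BG\<^esub> j"
      using x B.generate_singleton_eq[OF \<phi>_Bij] ord_\<phi> by auto
    have gi: "g [^]\<^bsub>SL2\<^esub> i \<in> carrier SL2" using SL2.nat_pow_closed[OF g_closed] .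
    have "g [^]\<^bsub>SL2\<^esub> i \<otimes>\<^bsub>SL2\<^esub> g = g \<otimes>\<^bsub>SL2\<^esub> g [^]\<^bsub>SL2\<^esub> i"
      using SL2.nat_pow_Suc2[OF g_closed, of i] by simp
    then have "conj_by SL2 (g [^]\<^bsub>SL2\<^esub> i) g = g"
      unfolding conj_by_def using gi g_closed SL2.m_assoc SL2.inv_l_cancel by (metis SL2.inv_closed)
    then have "g [^]\<^bsub>SL2\<^esub> (7 ^ j :: nat) = g [^]\<^bsub>SL2\<^esub> (1::nat)"
      using i j \<gamma>_pow_apply[OF g_closed, of i] \<phi>_pow_g[of j] SL2.nat_pow_eone[OF g_closed] by simp
    then have "7 ^ j mod 9 = (1::nat)" using g_pow_eq[of "7 ^ j" 1] by simp
    moreover have "j = 0 \<or> j = 1 \<or> j = 2" using j(1) by linarith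
    ultimately have "j = 0" by (elim disjE) simp_all
    then show "x \<in> {\<one>\<^bsub>BG\<^esub>}" using j by simp
  qed
qed

definition K_grp :: "('a^2^2 \<Rightarrow> 'a^2^2) set" where
  "K_grp = Gamma_grp z <#>\<^bsub>BG\<^esub> L_grp"

lemma ord_pos: "B.ord \<gamma> > 0" "B.ord \<phi> > 0"
  by (simp_all add: ord_\<gamma> ord_\<phi>)

lemma K_grp_iff: "\<alpha> \<in> K_grp \<longleftrightarrow> (\<exists>(i::nat) (j::nat). \<alpha> = \<gamma> [^]\<^bsub>BG\<^esub> i \<otimes>\<^bsub>BG\<^esub> \<phi> [^]\<^bsub>BG\<^esub> j)"
  unfolding K_grp_def Gamma_grp_def L_grp_def
  by (rule B.metacyclic_iff[OF \<gamma>_Bij \<phi>_Bij ord_pos \<phi>_\<gamma> Gamma_inter_L])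

lemma K_grp_subgroup: "subgroup K_grp BG"
  unfolding K_grp_def Gamma_grp_def L_grp_def
  by (rule B.metacyclic_subgroup[OF \<gamma>_Bij \<phi>_Bij ord_pos \<phi>_\<gamma> Gamma_inter_L])

lemma K_grp_semidirect: "internal_semidirect (BG\<lparr>carrier := K_grp\<rparr>) (Gamma_grp z) L_grp"
  unfolding K_grp_def Gamma_grp_def L_grp_def
  by (rule B.metacyclic_internal_semidirect[OF \<gamma>_Bij \<phi>_Bij ord_pos \<phi>_\<gamma> Gamma_inter_L])

lemma K_grp_iso:
  "\<exists>\<theta>\<in>hom (integer_mod_group 3) (AutoGroup (integer_mod_group 9)).
     BG\<lparr>carrier := K_grp\<rparr> \<cong> semidirect_product (integer_mod_group 9) (integer_mod_group 3) \<theta>"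
  using B.metacyclic_iso[OF \<gamma>_Bij \<phi>_Bij ord_pos \<phi>_\<gamma> Gamma_inter_L]
  unfolding K_grp_def Gamma_grp_def L_grp_def ord_\<gamma> ord_\<phi> .

lemma Gamma_iso: "BG\<lparr>carrier := Gamma_grp z\<rparr> \<cong> integer_mod_group 9"
  using B.generate_singleton_iso[OF \<gamma>_Bij ord_pos(1)] unfolding Gamma_grp_def ord_\<gamma> .

lemma L_iso: "BG\<lparr>carrier := L_grp\<rparr> \<cong> integer_mod_group 3"
  using B.generate_singleton_iso[OF \<phi>_Bij ord_pos(2)] unfolding L_grp_def ord_\<phi> .

lemma K_grp_sylow_autos: "\<alpha> \<in> K_grp \<Longrightarrow> \<alpha> \<in> sylow_autos"
  using sylow_autos_mult sylow_autos_pow frob_sylow_autos conj_map_sylow_autos[OF g_closed]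
  unfolding K_grp_iff by metis

end

section \<open>Right translations, and automorphisms that preserve C\<close>

context f8_field
begin

abbreviation "\<rho> \<equiv> right_mult_map (SL2 :: ('a^2^2) monoid)"

lemma \<rho>_apply: "x \<in> carrier SL2 \<Longrightarrow> \<rho> h x = x \<otimes>\<^bsub>SL2\<^esub> h"
  by (simp add: right_mult_map_def)

lemma \<rho>_Bij: "h \<in> carrier SL2 \<Longrightarrow> \<rho> h \<in> Bij (carrier SL2)"
proof -
  assume h: "h \<in> carrier SL2"
  have "bij_betw (\<rho> h) (carrier SL2) (carrier SL2)"
    by (rule bij_betw_byWitness[where f' = "\<rho> (inv\<^bsub>SL2\<^esub> h)"])
      (use h in \<open>auto simp: \<rho>_apply SL2.m_assoc simp del: mult_SL2 carrier_SL2\<close>)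
  then show ?thesis by (simp add: Bij_def right_mult_map_def)
qed

text \<open>Composition applies the right-hand map first, hence the reversed product.\<close>

lemma \<rho>_mult: "h \<in> carrier SL2 \<Longrightarrow> k \<in> carrier SL2 \<Longrightarrow> \<rho> h \<otimes>\<^bsub>BG\<^esub> \<rho> k = \<rho> (k \<otimes>\<^bsub>SL2\<^esub> h)"
proof -
  assume h: "h \<in> carrier SL2" and k: "k \<in> carrier SL2"
  have kh: "k \<otimes>\<^bsub>SL2\<^esub> h \<in> carrier SL2" using SL2.m_closed[OF k h] .
  show ?thesis
  proof (rule Bij_eqI)
    show "\<rho> h \<otimes>\<^bsub>BG\<^esub> \<rho> k \<in> Bij (carrier SL2)" using B.m_closed \<rho>_Bij h k by simp
    show "\<rho> (k \<otimes>\<^bsub>SL2\<^esub> h) \<in> Bij (carrier SL2)" by (rule \<rho>_Bij[OF kh])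
    fix x :: "'a^2^2" assume x: "x \<in> carrier SL2"
    show "(\<rho> h \<otimes>\<^bsub>BG\<^esub> \<rho> k) x = \<rho> (k \<otimes>\<^bsub>SL2\<^esub> h) x"
      unfolding BijGroup_mult_apply[OF \<rho>_Bij[OF h] \<rho>_Bij[OF k] x] \<rho>_apply[OF x]
        \<rho>_apply[OF SL2.m_closed[OF x k]] by (rule SL2.m_assoc[OF x k h])
  qed
qed

lemma \<rho>_one: "\<rho> \<one>\<^bsub>SL2\<^esub> = \<one>\<^bsub>BG\<^esub>"
proof (rule Bij_eqI)
  show "\<rho> \<one>\<^bsub>SL2\<^esub> \<in> Bij (carrier SL2)" by (rule \<rho>_Bij[OF SL2.one_closed])
  show "\<one>\<^bsub>BG\<^esub> \<in> Bij (carrier SL2)" using B.one_closed by simp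
  show "\<rho> \<one>\<^bsub>SL2\<^esub> x = \<one>\<^bsub>BG\<^esub> x" if "x \<in> carrier SL2" for x :: "'a^2^2"
    unfolding \<rho>_apply[OF that] BijGroup_one_apply[OF that] by (rule SL2.r_one[OF that])
qed

lemma R_subgroup: "subgroup R_grp BG"
proof (rule B.subgroupI)
  show "R_grp \<subseteq> carrier BG" using \<rho>_Bij by (auto simp: R_grp_def)
  show "R_grp \<noteq> ({} :: ('a^2^2 \<Rightarrow> 'a^2^2) set)" using SL2.one_closed unfolding R_grp_def by blast
next
  fix \<alpha> :: "'a^2^2 \<Rightarrow> 'a^2^2" assume "\<alpha> \<in> R_grp"
  then obtain h where h: "h \<in> carrier SL2" "\<alpha> = \<rho> h" by (auto simp: R_grp_def)
  have h': "inv\<^bsub>SL2\<^esub> h \<in> carrier SL2" using SL2.inv_closed[OF h(1)] .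
  have "\<rho> (inv\<^bsub>SL2\<^esub> h) \<otimes>\<^bsub>BG\<^esub> \<alpha> = \<one>\<^bsub>BG\<^esub>"
    unfolding h(2) \<rho>_mult[OF h' h(1)] SL2.r_inv[OF h(1)] by (rule \<rho>_one)
  then have "inv\<^bsub>BG\<^esub> \<alpha> = \<rho> (inv\<^bsub>SL2\<^esub> h)"
    using B.inv_equality \<rho>_Bij[OF h'] \<rho>_Bij[OF h(1)] h(2) by simp
  then show "inv\<^bsub>BG\<^esub> \<alpha> \<in> R_grp" using h' unfolding R_grp_def by blast
next
  fix \<alpha> \<beta> :: "'a^2^2 \<Rightarrow> 'a^2^2" assume "\<alpha> \<in> R_grp" "\<beta> \<in> R_grp"
  then obtain h k where "h \<in> carrier SL2" "\<alpha> = \<rho> h" "k \<in> carrier SL2" "\<beta> = \<rho> k"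
    unfolding R_grp_def by blast
  then show "\<alpha> \<otimes>\<^bsub>BG\<^esub> \<beta> \<in> R_grp"
    using \<rho>_mult SL2.m_closed unfolding R_grp_def by blast
qed

text \<open>Group automorphisms normalize the right translations; this is the source of the
  normality of R in the full automorphism groups.\<close>

lemma auto_\<rho>:
  assumes \<alpha>: "\<alpha> \<in> auto SL2" and h: "h \<in> carrier SL2"
  shows "\<alpha> \<otimes>\<^bsub>BG\<^esub> \<rho> h = \<rho> (\<alpha> h) \<otimes>\<^bsub>BG\<^esub> \<alpha>"
proof (rule Bij_eqI)
  note \<alpha>B = auto_Bij[OF \<alpha>] and \<alpha>h = SL2.auto_apply(1)[OF \<alpha> h]
  show "\<alpha> \<otimes>\<^bsub>BG\<^esub> \<rho> h \<in> Bij (carrier SL2)" using B.m_closed \<rho>_Bij[OF h] \<alpha>B by simp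
  show "\<rho> (\<alpha> h) \<otimes>\<^bsub>BG\<^esub> \<alpha> \<in> Bij (carrier SL2)" using B.m_closed \<rho>_Bij[OF \<alpha>h] \<alpha>B by simp
  fix x :: "'a^2^2" assume x: "x \<in> carrier SL2"
  show "(\<alpha> \<otimes>\<^bsub>BG\<^esub> \<rho> h) x = (\<rho> (\<alpha> h) \<otimes>\<^bsub>BG\<^esub> \<alpha>) x"
    unfolding BijGroup_mult_apply[OF \<alpha>B \<rho>_Bij[OF h] x] BijGroup_mult_apply[OF \<rho>_Bij[OF \<alpha>h] \<alpha>B x]
      \<rho>_apply[OF x] \<rho>_apply[OF SL2.auto_apply(1)[OF \<alpha> x]] by (rule SL2.auto_apply(2)[OF \<alpha> x h])
qed

text \<open>The automorphism sends g to some g^k with k a unit modulo 9. A product \<kappa> of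
  \<tau> or the identity with a power of Frobenius realizes the inverse exponent, so that
  \<alpha>\<kappa> fixes C pointwise and \<open>automorphism_fixing_regular\<close> makes it a power
  of \<gamma>. Solving for \<alpha> leaves \<tau>, its own inverse, on the right.\<close>

lemma stabilizer_split:
  assumes \<alpha>: "\<alpha> \<in> sylow_autos" and C: "\<alpha> ` C = C"
  shows "\<alpha> \<in> K_grp \<or> (\<exists>k\<in>K_grp. \<alpha> = k \<otimes>\<^bsub>BG\<^esub> \<tau>)"
proof -
  have \<alpha>_auto: "\<alpha> \<in> auto SL2" using \<alpha> by (simp add: sylow_autos_def)
  note \<alpha>B = sylow_autos_Bij[OF \<alpha>]
  have gC: "g \<in> C" using C_iff[of g] SL2.nat_pow_eone[OF g_closed] by metis
  then obtain k :: nat where k: "\<alpha> g = g [^]\<^bsub>SL2\<^esub> k" using C C_iff by blast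
  have \<alpha>_pow: "\<alpha> (g [^]\<^bsub>SL2\<^esub> (m::nat)) = g [^]\<^bsub>SL2\<^esub> (k * m)" for m
    unfolding SL2.auto_apply(4)[OF \<alpha>_auto g_closed] k by (rule SL2.nat_pow_pow[OF g_closed])
  \<comment> \<open>If 3 divided k, then g^3 would be mapped to g^(3 k) = 1, against
    injectivity.\<close>
  have "\<not> 3 dvd k"
  proof
    assume "3 dvd k"
    then have "9 dvd k * 3" by (auto elim!: dvdE)
    then have "\<alpha> (g [^]\<^bsub>SL2\<^esub> (3::nat)) = g [^]\<^bsub>SL2\<^esub> (0::nat)"
      unfolding \<alpha>_pow g_pow_eq by (simp add: mod_eq_0_iff_dvd)
    then have "\<alpha> (g [^]\<^bsub>SL2\<^esub> (3::nat)) = \<alpha> \<one>\<^bsub>SL2\<^esub>"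
      using SL2.auto_apply(3)[OF \<alpha>_auto] by simp
    then have "g [^]\<^bsub>SL2\<^esub> (3::nat) = \<one>\<^bsub>SL2\<^esub>"
      using inj_onD[OF SL2.auto_apply(5)[OF \<alpha>_auto]] SL2.nat_pow_closed[OF g_closed] SL2.one_closed by blast
    then show False using g_ne[of 3] by simp
  qed
  then have k9: "k mod 9 = 1 \<or> k mod 9 = 2 \<or> k mod 9 = 4 \<or> k mod 9 = 5 \<or> k mod 9 = 7 \<or> k mod 9 = 8"
    by presburger
  have main: "\<exists>n::nat. \<alpha> = \<gamma> [^]\<^bsub>BG\<^esub> n \<otimes>\<^bsub>BG\<^esub> inv\<^bsub>BG\<^esub> \<kappa>"
    if \<kappa>: "\<kappa> \<in> sylow_autos" "\<kappa> g = g [^]\<^bsub>SL2\<^esub> (m::nat)" "(k * m) mod 9 = 1" for \<kappa> m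
  proof -
    define \<beta> where "\<beta> = \<alpha> \<otimes>\<^bsub>BG\<^esub> \<kappa>"
    have \<beta>: "\<beta> \<in> sylow_autos" unfolding \<beta>_def by (rule sylow_autos_mult[OF \<alpha> \<kappa>(1)])
    then have \<beta>_auto: "\<beta> \<in> auto SL2" by (simp add: sylow_autos_def)
    have "\<beta> g = g [^]\<^bsub>SL2\<^esub> (k * m)"
      unfolding \<beta>_def BijGroup_mult_apply[OF \<alpha>B sylow_autos_Bij[OF \<kappa>(1)] g_closed] \<kappa>(2) \<alpha>_pow ..
    also have "\<dots> = g" using g_pow_eq[of "k * m" 1] \<kappa>(3) SL2.nat_pow_eone[OF g_closed] by simp
    finally have \<beta>g: "\<beta> g = g" .
    have \<beta>C: "\<beta> c = c" if "c \<in> C" for c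
      using that SL2.auto_apply(4)[OF \<beta>_auto g_closed] \<beta>g unfolding C_iff by metis
    have "\<exists>c\<in>C. \<forall>x\<in>carrier SL2. \<beta> x = conj_by SL2 c x"
    proof (rule geo.automorphism_fixing_regular)
      show "bij_betw \<beta> (carrier SL2) (carrier SL2)" using sylow_autos_Bij[OF \<beta>] by (simp add: Bij_def)
      show "\<beta> (x \<otimes>\<^bsub>SL2\<^esub> y) = \<beta> x \<otimes>\<^bsub>SL2\<^esub> \<beta> y" if "x \<in> carrier SL2" "y \<in> carrier SL2" for x y
        using SL2.auto_apply(2)[OF \<beta>_auto that] .
      show "\<beta> ` P \<in> sylows" if "P \<in> sylows" for P using \<beta> that by (simp add: sylow_autos_def)
      show "c \<otimes>\<^bsub>SL2\<^esub> d = d \<otimes>\<^bsub>SL2\<^esub> c" if "c \<in> C" "d \<in> C" for c d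
        using that SL2.nat_pow_mult[OF g_closed] unfolding C_iff by (metis add.commute)
    qed (use C_sub \<beta>C unipotent_sylow C_transitive in auto)
    then obtain n :: nat where n: "\<And>x. x \<in> carrier SL2 \<Longrightarrow> \<beta> x = conj_by SL2 (g [^]\<^bsub>SL2\<^esub> n) x"
      unfolding Bex_def C_iff by blast
    have "\<beta> = \<gamma> [^]\<^bsub>BG\<^esub> n"
    proof (rule Bij_eqI)
      show "\<gamma> [^]\<^bsub>BG\<^esub> n \<in> Bij (carrier SL2)"
        using B.nat_pow_closed[OF \<gamma>_Bij] by simp
    qed (use sylow_autos_Bij[OF \<beta>] n \<gamma>_pow_apply in simp_all)
    then have "\<alpha> = \<gamma> [^]\<^bsub>BG\<^esub> n \<otimes>\<^bsub>BG\<^esub> inv\<^bsub>BG\<^esub> \<kappa>"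
      using B.inv_solve_right[of \<alpha> "\<gamma> [^]\<^bsub>BG\<^esub> n" \<kappa>] \<alpha>B sylow_autos_Bij[OF \<kappa>(1)] B.nat_pow_closed[OF \<gamma>_Bij]
      unfolding \<beta>_def by simp
    then show ?thesis by blast
  qed
  have inL: "\<gamma> [^]\<^bsub>BG\<^esub> (n::nat) \<otimes>\<^bsub>BG\<^esub> inv\<^bsub>BG\<^esub> (\<phi> [^]\<^bsub>BG\<^esub> (j::nat)) \<in> K_grp" for n j
  proof -
    interpret K: subgroup K_grp BG by (rule K_grp_subgroup)
    have "\<phi> [^]\<^bsub>BG\<^esub> j = \<gamma> [^]\<^bsub>BG\<^esub> (0::nat) \<otimes>\<^bsub>BG\<^esub> \<phi> [^]\<^bsub>BG\<^esub> j"
      using B.nat_pow_closed[OF \<phi>_Bij, of j] B.l_one by simp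
    then have 1: "\<phi> [^]\<^bsub>BG\<^esub> j \<in> K_grp" unfolding K_grp_iff by blast
    have "\<gamma> [^]\<^bsub>BG\<^esub> n = \<gamma> [^]\<^bsub>BG\<^esub> n \<otimes>\<^bsub>BG\<^esub> \<phi> [^]\<^bsub>BG\<^esub> (0::nat)"
      using B.nat_pow_closed[OF \<gamma>_Bij, of n] B.r_one by simp
    then have 2: "\<gamma> [^]\<^bsub>BG\<^esub> n \<in> K_grp" unfolding K_grp_iff by blast
    show ?thesis using K.m_closed[OF 2 K.m_inv_closed[OF 1]] .
  qed
  have \<phi>j: "\<phi> [^]\<^bsub>BG\<^esub> (j::nat) \<in> sylow_autos" for j
    using sylow_autos_pow frob_sylow_autos by blast
  have \<tau>: "\<tau> \<in> sylow_autos" by (rule conj_map_sylow_autos[OF f_closed])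
  \<comment> \<open>The powers of 7 modulo 9 are 1, 7, 4, and multiplication by 8 gives the
    remaining units 8, 2, 5; every unit k therefore has its inverse in one of the two lists.\<close>
  have "(\<exists>j::nat. (k * 7 ^ j) mod 9 = 1) \<or> (\<exists>j::nat. (k * (8 * 7 ^ j)) mod 9 = 1)"
  proof -
    have red: "(k * m) mod 9 = ((k mod 9) * m) mod 9" for m :: nat by (simp add: mod_mult_left_eq)
    from k9 show ?thesis
    proof (elim disjE)
      assume "k mod 9 = 1" then show ?thesis using red[of "7 ^ 0"] by (intro disjI1 exI[of _ 0]) simp
    next
      assume "k mod 9 = 4" then show ?thesis using red[of "7 ^ 1"] by (intro disjI1 exI[of _ 1]) simp
    next
      assume "k mod 9 = 7" then show ?thesis using red[of "7 ^ 2"] by (intro disjI1 exI[of _ 2]) simp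
    next
      assume "k mod 9 = 8" then show ?thesis using red[of "8 * 7 ^ 0"] by (intro disjI2 exI[of _ 0]) simp
    next
      assume "k mod 9 = 5" then show ?thesis using red[of "8 * 7 ^ 1"] by (intro disjI2 exI[of _ 1]) simp
    next
      assume "k mod 9 = 2" then show ?thesis using red[of "8 * 7 ^ 2"] by (intro disjI2 exI[of _ 2]) simp
    qed
  qed
  then show ?thesis
  proof (elim disjE exE)
    fix j :: nat assume "(k * 7 ^ j) mod 9 = 1"
    then show ?thesis using main[OF \<phi>j \<phi>_pow_g] inL by blast
  next
    fix j :: nat assume j: "(k * (8 * 7 ^ j)) mod 9 = 1"
    let ?\<kappa> = "\<tau> \<otimes>\<^bsub>BG\<^esub> \<phi> [^]\<^bsub>BG\<^esub> j"
    have G: "\<phi> [^]\<^bsub>BG\<^esub> j \<in> carrier BG" using B.nat_pow_closed[OF \<phi>_Bij] .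
    have "?\<kappa> g = g [^]\<^bsub>SL2\<^esub> (8 * 7 ^ j :: nat)"
      unfolding BijGroup_mult_apply[OF sylow_autos_Bij[OF \<tau>] sylow_autos_Bij[OF \<phi>j] g_closed] \<phi>_pow_g
      using SL2.auto_apply(4)[OF _ g_closed, of \<tau>] \<tau> \<tau>_g SL2.nat_pow_pow[OF g_closed, of 8]
      by (simp add: sylow_autos_def)
    from main[OF sylow_autos_mult[OF \<tau> \<phi>j] this j] obtain n :: nat
      where n: "\<alpha> = \<gamma> [^]\<^bsub>BG\<^esub> n \<otimes>\<^bsub>BG\<^esub> inv\<^bsub>BG\<^esub> ?\<kappa>" by blast
    have "inv\<^bsub>BG\<^esub> \<tau> = \<tau>" using B.inv_equality[OF \<tau>_\<tau> \<tau>_Bij \<tau>_Bij] .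
    then have "inv\<^bsub>BG\<^esub> ?\<kappa> = inv\<^bsub>BG\<^esub> (\<phi> [^]\<^bsub>BG\<^esub> j) \<otimes>\<^bsub>BG\<^esub> \<tau>"
      using B.inv_mult_group[OF \<tau>_Bij G] by simp
    then have "\<alpha> = (\<gamma> [^]\<^bsub>BG\<^esub> n \<otimes>\<^bsub>BG\<^esub> inv\<^bsub>BG\<^esub> (\<phi> [^]\<^bsub>BG\<^esub> j)) \<otimes>\<^bsub>BG\<^esub> \<tau>"
      using n B.m_assoc[OF B.nat_pow_closed[OF \<gamma>_Bij, of n] B.inv_closed[OF G] \<tau>_Bij] by simp
    then show ?thesis using inL by blast
  qed
qed

end

section \<open>The full automorphism group of an affine unital\<close>

context f8_unital
begin

lemma Aut_subgroup: "subgroup (carrier (Aut_group U)) BG"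
  using Aut_group_subgroup[OF blocks_sub] by simp

lemma \<rho>_Aut: "h \<in> carrier SL2 \<Longrightarrow> \<rho> h \<in> carrier (Aut_group U)"
proof (rule Aut_groupI)
  assume h: "h \<in> carrier SL2"
  then show "\<rho> h \<in> Bij (points U)" using \<rho>_Bij by simp
  show "finite (points U)" using finite_SL2 by simp
  show "blocks U \<subseteq> Pow (points U)" by (rule blocks_sub)
  fix X assume X: "X \<in> blocks U"
  have "\<rho> h ` X = X #>\<^bsub>SL2\<^esub> h"
    unfolding SL2.r_coset_image
  proof (rule image_cong[OF refl])
    fix x assume "x \<in> X"
    then have "x \<in> carrier SL2" using blocks_sub X unfolding unital_points by blast
    then show "\<rho> h x = x \<otimes>\<^bsub>SL2\<^esub> h" by (rule \<rho>_apply)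
  qed
  then show "\<rho> h ` X \<in> blocks U" using block_shift[OF X h] by simp
qed

text \<open>A group automorphism maps K x to the image of K translated by the image of x, so base
  blocks decide. Sylow subgroups are covered by \<open>sylow_autos\<close>, and C by its own
  hypothesis.\<close>

lemma auto_Aut:
  assumes \<alpha>: "\<alpha> \<in> sylow_autos" and C: "\<alpha> ` C = C"
    and D: "\<forall>D\<in>\<D>. \<exists>D'\<in>\<D>. \<exists>y\<in>carrier SL2. \<alpha> ` D = D' #>\<^bsub>SL2\<^esub> y"
  shows "\<alpha> \<in> carrier (Aut_group U)"
proof (rule Aut_groupI)
  have \<alpha>_auto: "\<alpha> \<in> auto SL2" using \<alpha> by (simp add: sylow_autos_def)
  show "\<alpha> \<in> Bij (points U)" using sylow_autos_Bij[OF \<alpha>] by simp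
  show "finite (points U)" using finite_SL2 by simp
  show "blocks U \<subseteq> Pow (points U)" by (rule blocks_sub)
  fix X assume "X \<in> blocks U"
  then obtain K x where K: "K \<in> bases \<D>" "x \<in> carrier SL2" "X = K #>\<^bsub>SL2\<^esub> x" by (rule blocksE)
  have one: "K' = K' #>\<^bsub>SL2\<^esub> \<one>\<^bsub>SL2\<^esub>" if "K' \<in> bases \<D>" for K'
    using SL2.coset_mult_one[OF bases_sub[OF that]] by simp
  have "\<exists>K'\<in>bases \<D>. \<exists>y\<in>carrier SL2. \<alpha> ` K = K' #>\<^bsub>SL2\<^esub> y"
  proof -
    consider "K = C" | "K \<in> sylows" | "K \<in> \<D>" using K(1) by (auto simp: bases_def)
    then show ?thesis
    proof cases
      case 1
      then have "\<alpha> ` K = K" using C by simp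
      then show ?thesis using one[OF K(1)] K(1) SL2.one_closed by metis
    next
      case 2
      then have "\<alpha> ` K \<in> bases \<D>" using \<alpha> by (simp add: bases_def sylow_autos_def)
      then show ?thesis using one SL2.one_closed by blast
    next
      case 3
      then show ?thesis using D unfolding bases_def by blast
    qed
  qed
  then obtain K' y where K': "K' \<in> bases \<D>" "y \<in> carrier SL2" "\<alpha> ` K = K' #>\<^bsub>SL2\<^esub> y" by blast
  have \<alpha>x: "\<alpha> x \<in> carrier SL2" using SL2.auto_apply(1)[OF \<alpha>_auto K(2)] .
  have "\<alpha> \<in> hom SL2 SL2" using \<alpha>_auto by (simp add: auto_def)
  then have "\<alpha> ` X = \<alpha> ` K #>\<^bsub>SL2\<^esub> \<alpha> x"
    unfolding K(3) by (rule SL2.image_r_coset[OF _ bases_sub[OF K(1)] K(2)])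
  then show "\<alpha> ` X \<in> blocks U"
    unfolding K'(3) using block_shift[OF blocksI[OF K'(1,2)] \<alpha>x] by simp
qed

text \<open>Right translations act transitively on the points; with h the image of 1, the
  translation by h^-1 brings the automorphism into the stabilizer of 1.\<close>

lemma Aut_factor:
  assumes "\<alpha> \<in> carrier (Aut_group U)"
  shows "\<exists>h\<in>carrier SL2. \<exists>\<sigma>\<in>carrier (Aut_group U). \<sigma> \<one>\<^bsub>SL2\<^esub> = \<one>\<^bsub>SL2\<^esub> \<and> \<alpha> = \<rho> h \<otimes>\<^bsub>BG\<^esub> \<sigma>"
proof -
  interpret A: subgroup "carrier (Aut_group U)" BG by (rule Aut_subgroup)
  have \<alpha>: "\<alpha> \<in> Bij (carrier SL2)" using A.mem_carrier[OF assms] by simp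
  define h where "h = \<alpha> \<one>\<^bsub>SL2\<^esub>"
  have h: "h \<in> carrier SL2" unfolding h_def by (rule Bij_apply[OF \<alpha> SL2.one_closed])
  have h': "inv\<^bsub>SL2\<^esub> h \<in> carrier SL2" by (rule SL2.inv_closed[OF h])
  let ?\<sigma> = "\<rho> (inv\<^bsub>SL2\<^esub> h) \<otimes>\<^bsub>BG\<^esub> \<alpha>"
  have "?\<sigma> \<in> carrier (Aut_group U)" using A.m_closed[OF \<rho>_Aut[OF h'] assms] .
  moreover have "?\<sigma> \<one>\<^bsub>SL2\<^esub> = \<one>\<^bsub>SL2\<^esub>"
    unfolding BijGroup_mult_apply[OF \<rho>_Bij[OF h'] \<alpha> SL2.one_closed] h_def[symmetric] \<rho>_apply[OF h]
    by (rule SL2.r_inv[OF h])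
  moreover have "\<rho> h \<otimes>\<^bsub>BG\<^esub> ?\<sigma> = \<alpha>"
  proof -
    have G: "\<rho> h \<in> carrier BG" "\<rho> (inv\<^bsub>SL2\<^esub> h) \<in> carrier BG" "\<alpha> \<in> carrier BG"
      using \<rho>_Bij h h' \<alpha> by auto
    have "\<rho> h \<otimes>\<^bsub>BG\<^esub> ?\<sigma> = (\<rho> h \<otimes>\<^bsub>BG\<^esub> \<rho> (inv\<^bsub>SL2\<^esub> h)) \<otimes>\<^bsub>BG\<^esub> \<alpha>"
      using B.m_assoc[OF G] by simp
    also have "\<dots> = \<alpha>"
      unfolding \<rho>_mult[OF h h'] SL2.l_inv[OF h] \<rho>_one by (rule B.l_one[OF G(3)])
    finally show ?thesis .
  qed
  ultimately show ?thesis using h by metis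
qed

lemma stabilizer_cases:
  assumes "\<sigma> \<in> carrier (Aut_group U)" "\<sigma> \<one>\<^bsub>SL2\<^esub> = \<one>\<^bsub>SL2\<^esub>"
  shows "\<sigma> \<in> K_grp \<or> (\<exists>k\<in>K_grp. \<sigma> = k \<otimes>\<^bsub>BG\<^esub> \<tau>)"
  using stabilizer_split stabilizer_hom[OF assms] by (simp add: sylow_autos_def)

lemma point_stabilizer_carrier:
  "carrier (point_stabilizer U p) = {\<alpha> \<in> carrier (Aut_group U). \<alpha> p = p}"
  by (simp add: point_stabilizer_def stabilizer_def)

lemma point_stabilizer_eq:
  "point_stabilizer U p = BG\<lparr>carrier := carrier (point_stabilizer U p)\<rparr>"
  by (simp add: point_stabilizer_def Aut_group_def)

text \<open>The stabilizer of the identity lies between \<open>K\<close> and \<open>K \<union> K\<tau>\<close>, so it is decided by \<open>\<tau>\<close>.\<close>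

context
  assumes K: "K_grp \<subseteq> carrier (Aut_group U)" and \<tau>: "\<tau> \<notin> carrier (Aut_group U)"
begin

lemma stabilizer_eq_K: "carrier (point_stabilizer U \<one>\<^bsub>SL2\<^esub>) = K_grp"
proof
  interpret A: subgroup "carrier (Aut_group U)" BG by (rule Aut_subgroup)
  show "K_grp \<subseteq> carrier (point_stabilizer U \<one>\<^bsub>SL2\<^esub>)"
    using K K_grp_sylow_autos SL2.auto_apply(3) unfolding point_stabilizer_carrier sylow_autos_def by blast
  show "carrier (point_stabilizer U \<one>\<^bsub>SL2\<^esub>) \<subseteq> K_grp"
  proof
    fix \<sigma> assume "\<sigma> \<in> carrier (point_stabilizer U \<one>\<^bsub>SL2\<^esub>)"
    then have \<sigma>: "\<sigma> \<in> carrier (Aut_group U)" "\<sigma> \<one>\<^bsub>SL2\<^esub> = \<one>\<^bsub>SL2\<^esub>" by (auto simp: point_stabilizer_carrier)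
    show "\<sigma> \<in> K_grp"
    proof (rule ccontr)
      assume "\<sigma> \<notin> K_grp"
      then obtain k where k: "k \<in> K_grp" "\<sigma> = k \<otimes>\<^bsub>BG\<^esub> \<tau>" using stabilizer_cases[OF \<sigma>] by blast
      have kA: "k \<in> carrier (Aut_group U)" using k K by blast
      have "inv\<^bsub>BG\<^esub> k \<otimes>\<^bsub>BG\<^esub> \<sigma> = \<tau>"
        unfolding k(2) by (rule B.inv_l_cancel[OF A.mem_carrier[OF kA] \<tau>_Bij])
      then show False using A.m_closed[OF A.m_inv_closed[OF kA] \<sigma>(1)] \<tau> by simp
    qed
  qed
qed

lemma Aut_eq: "carrier (Aut_group U) = R_grp <#>\<^bsub>BG\<^esub> K_grp"
proof
  interpret A: subgroup "carrier (Aut_group U)" BG by (rule Aut_subgroup)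
  show "carrier (Aut_group U) \<subseteq> R_grp <#>\<^bsub>BG\<^esub> K_grp"
  proof
    fix \<alpha> assume "\<alpha> \<in> carrier (Aut_group U)"
    then obtain h \<sigma> where *: "h \<in> carrier SL2" "\<sigma> \<in> carrier (Aut_group U)" "\<sigma> \<one>\<^bsub>SL2\<^esub> = \<one>\<^bsub>SL2\<^esub>" "\<alpha> = \<rho> h \<otimes>\<^bsub>BG\<^esub> \<sigma>"
      using Aut_factor by blast
    then have "\<sigma> \<in> K_grp" using stabilizer_eq_K by (auto simp: point_stabilizer_carrier)
    then show "\<alpha> \<in> R_grp <#>\<^bsub>BG\<^esub> K_grp"
      using * unfolding set_mult_def R_grp_def by blast
  qed
  show "R_grp <#>\<^bsub>BG\<^esub> K_grp \<subseteq> carrier (Aut_group U)"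
    using A.m_closed K \<rho>_Aut unfolding set_mult_def R_grp_def by blast
qed

lemma Aut_semidirect: "internal_semidirect (Aut_group U) R_grp K_grp"
proof -
  let ?A = "carrier (Aut_group U)"
  have AU: "Aut_group U = BG\<lparr>carrier := ?A\<rparr>" using Aut_group_eq[of U] by simp
  interpret A: subgroup ?A BG by (rule Aut_subgroup)
  interpret AG: group "BG\<lparr>carrier := ?A\<rparr>" by (rule A.subgroup_is_group[OF B.is_group])
  have R_sub: "R_grp \<subseteq> ?A" using \<rho>_Aut unfolding R_grp_def by blast
  have "R_grp \<lhd> BG\<lparr>carrier := ?A\<rparr>"
  proof (rule AG.normal_invI)
    show "subgroup R_grp (BG\<lparr>carrier := ?A\<rparr>)"
      by (rule B.subgroup_incl[OF R_subgroup Aut_subgroup R_sub])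
  next
    fix \<alpha> r :: "'a^2^2 \<Rightarrow> 'a^2^2" assume "\<alpha> \<in> carrier (BG\<lparr>carrier := ?A\<rparr>)" and r: "r \<in> R_grp"
    then have \<alpha>: "\<alpha> \<in> ?A" by simp
    then obtain h \<sigma> where *: "h \<in> carrier SL2" "\<sigma> \<in> ?A" "\<sigma> \<one>\<^bsub>SL2\<^esub> = \<one>\<^bsub>SL2\<^esub>" "\<alpha> = \<rho> h \<otimes>\<^bsub>BG\<^esub> \<sigma>"
      using Aut_factor by blast
    have \<sigma>: "\<sigma> \<in> auto SL2" using stabilizer_hom(1)[OF *(2,3)] .
    obtain y where y: "y \<in> carrier SL2" "r = \<rho> y" using r by (auto simp: R_grp_def)
    have \<sigma>y: "\<sigma> y \<in> carrier SL2" by (rule SL2.auto_apply(1)[OF \<sigma> y(1)])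
    have G: "\<rho> h \<in> carrier BG" "\<sigma> \<in> carrier BG" "\<rho> y \<in> carrier BG" "\<rho> (\<sigma> y) \<in> carrier BG"
      using \<rho>_Bij[OF *(1)] \<rho>_Bij[OF y(1)] \<rho>_Bij[OF \<sigma>y] auto_Bij[OF \<sigma>] by auto
    \<comment> \<open>By \<open>auto_\<rho>\<close> the stabilizing factor \<sigma> moves to the
      right of the translation and cancels in the conjugate, which leaves only translations.\<close>
    have "\<alpha> \<otimes>\<^bsub>BG\<^esub> r = (\<rho> h \<otimes>\<^bsub>BG\<^esub> \<rho> (\<sigma> y)) \<otimes>\<^bsub>BG\<^esub> \<sigma>"
      unfolding *(4) y(2) using G auto_\<rho>[OF \<sigma> y(1)] by (simp add: B.m_assoc del: carrier_BijGroup)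
    then have "\<alpha> \<otimes>\<^bsub>BG\<^esub> r \<otimes>\<^bsub>BG\<^esub> inv\<^bsub>BG\<^esub> \<alpha> = \<rho> h \<otimes>\<^bsub>BG\<^esub> \<rho> (\<sigma> y) \<otimes>\<^bsub>BG\<^esub> inv\<^bsub>BG\<^esub> (\<rho> h)"
      unfolding *(4) using G by (simp add: B.m_assoc B.inv_mult_group del: carrier_BijGroup)
    moreover have "\<rho> h \<otimes>\<^bsub>BG\<^esub> \<rho> (\<sigma> y) \<otimes>\<^bsub>BG\<^esub> inv\<^bsub>BG\<^esub> (\<rho> h) \<in> R_grp"
    proof -
      have "\<rho> h \<in> R_grp" "\<rho> (\<sigma> y) \<in> R_grp"
        unfolding R_grp_def using *(1) \<sigma>y by (simp_all only: imageI)
      then show ?thesis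
        by (intro subgroup.m_closed[OF R_subgroup] subgroup.m_inv_closed[OF R_subgroup])
    qed
    ultimately show "\<alpha> \<otimes>\<^bsub>BG\<lparr>carrier := ?A\<rparr>\<^esub> r \<otimes>\<^bsub>BG\<lparr>carrier := ?A\<rparr>\<^esub> inv\<^bsub>BG\<lparr>carrier := ?A\<rparr>\<^esub> \<alpha> \<in> R_grp"
      using B.m_inv_consistent[OF Aut_subgroup \<alpha>] by simp
  qed
  moreover have "subgroup K_grp (BG\<lparr>carrier := ?A\<rparr>)"
    by (rule B.subgroup_incl[OF K_grp_subgroup Aut_subgroup K])
  moreover have "R_grp \<inter> K_grp = {\<one>\<^bsub>BG\<^esub>}"
  proof
    show "{\<one>\<^bsub>BG\<^esub>} \<subseteq> R_grp \<inter> K_grp"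
      using subgroup.one_closed[OF R_subgroup] subgroup.one_closed[OF K_grp_subgroup] by blast
    show "R_grp \<inter> K_grp \<subseteq> {\<one>\<^bsub>BG\<^esub>}"
    proof
      fix \<alpha> assume \<alpha>: "\<alpha> \<in> R_grp \<inter> K_grp"
      then obtain h where h: "h \<in> carrier SL2" "\<alpha> = \<rho> h" by (auto simp: R_grp_def)
      have "\<alpha> \<one>\<^bsub>SL2\<^esub> = \<one>\<^bsub>SL2\<^esub>"
        using \<alpha> K_grp_sylow_autos SL2.auto_apply(3) unfolding sylow_autos_def by blast
      then have "h = \<one>\<^bsub>SL2\<^esub>"
        using SL2.l_one[OF h(1)] unfolding h(2) \<rho>_apply[OF SL2.one_closed] by metis
      then show "\<alpha> \<in> {\<one>\<^bsub>BG\<^esub>}" using h(2) \<rho>_one by simp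
    qed
  qed
  moreover have "R_grp <#>\<^bsub>BG\<lparr>carrier := ?A\<rparr>\<^esub> K_grp = R_grp <#>\<^bsub>BG\<^esub> K_grp"
    unfolding set_mult_def by simp
  then have "R_grp <#>\<^bsub>BG\<lparr>carrier := ?A\<rparr>\<^esub> K_grp = carrier (BG\<lparr>carrier := ?A\<rparr>)"
    by (simp flip: Aut_eq)
  moreover have "\<one>\<^bsub>BG\<^esub> = \<one>\<^bsub>BG\<lparr>carrier := ?A\<rparr>\<^esub>" by simp
  ultimately have "internal_semidirect (BG\<lparr>carrier := ?A\<rparr>) R_grp K_grp"
    unfolding internal_semidirect_def by (intro conjI) (assumption | simp only:)+
  then show ?thesis by (subst AU)
qed

end

text \<open>Every automorphism is a translation times an element of K or of K followed on the right
  by \<tau>, so H and its coset by \<tau> exhaust the group. It is applied with the classical unital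
  as U and the automorphism group of OU as H.\<close>

lemma index_two:
  assumes H: "subgroup H BG" and HU: "H \<subseteq> carrier (Aut_group U)" and \<tau>U: "\<tau> \<in> carrier (Aut_group U)"
    and R: "R_grp \<subseteq> H" and K: "K_grp \<subseteq> H" and \<tau>H: "\<tau> \<notin> H"
  shows "subgroup_index (Aut_group U) H = 2"
proof -
  let ?A = "carrier (Aut_group U)"
  interpret A: subgroup ?A BG by (rule Aut_subgroup)
  interpret H: subgroup H BG by (rule H)
  have \<tau>B: "\<tau> \<in> carrier BG" by (rule \<tau>_Bij)
  have rc: "H #>\<^bsub>Aut_group U\<^esub> a = H #>\<^bsub>BG\<^esub> a" for a
    by (simp add: r_coset_def Aut_group_def)
  have cases: "a \<in> H \<or> (\<exists>h\<in>H. a = h \<otimes>\<^bsub>BG\<^esub> \<tau>)" if a: "a \<in> ?A" for a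
  proof -
    obtain h \<sigma> where *: "h \<in> carrier SL2" "\<sigma> \<in> ?A" "\<sigma> \<one>\<^bsub>SL2\<^esub> = \<one>\<^bsub>SL2\<^esub>" "a = \<rho> h \<otimes>\<^bsub>BG\<^esub> \<sigma>"
      using Aut_factor[OF a] by blast
    have \<rho>H: "\<rho> h \<in> H" using *(1) R unfolding R_grp_def by blast
    from stabilizer_cases[OF *(2,3)] show ?thesis
    proof
      assume "\<sigma> \<in> K_grp"
      then have "a \<in> H" unfolding *(4) using H.m_closed[OF \<rho>H] K by blast
      then show ?thesis ..
    next
      assume "\<exists>k\<in>K_grp. \<sigma> = k \<otimes>\<^bsub>BG\<^esub> \<tau>"
      then obtain k where k: "k \<in> H" "\<sigma> = k \<otimes>\<^bsub>BG\<^esub> \<tau>" using K by blast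
      have "a = (\<rho> h \<otimes>\<^bsub>BG\<^esub> k) \<otimes>\<^bsub>BG\<^esub> \<tau>"
        unfolding *(4) k(2) using B.m_assoc[OF H.mem_carrier[OF \<rho>H] H.mem_carrier[OF k(1)] \<tau>B] by simp
      then show ?thesis using H.m_closed[OF \<rho>H k(1)] by blast
    qed
  qed
  have "rcosets\<^bsub>Aut_group U\<^esub> H = {H #>\<^bsub>BG\<^esub> \<one>\<^bsub>BG\<^esub>, H #>\<^bsub>BG\<^esub> \<tau>}"
  proof
    show "rcosets\<^bsub>Aut_group U\<^esub> H \<subseteq> {H #>\<^bsub>BG\<^esub> \<one>\<^bsub>BG\<^esub>, H #>\<^bsub>BG\<^esub> \<tau>}"
    proof
      fix X assume "X \<in> rcosets\<^bsub>Aut_group U\<^esub> H"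
      then obtain a where a: "a \<in> ?A" "X = H #>\<^bsub>BG\<^esub> a" unfolding RCOSETS_def rc by blast
      from cases[OF a(1)] show "X \<in> {H #>\<^bsub>BG\<^esub> \<one>\<^bsub>BG\<^esub>, H #>\<^bsub>BG\<^esub> \<tau>}"
      proof
        assume "a \<in> H"
        then have "a \<in> H #>\<^bsub>BG\<^esub> \<one>\<^bsub>BG\<^esub>" using B.coset_mult_one[OF H.subset] by simp
        then show ?thesis using B.repr_independence[OF _ B.one_closed H] a(2) by blast
      next
        assume "\<exists>h\<in>H. a = h \<otimes>\<^bsub>BG\<^esub> \<tau>"
        then have "a \<in> H #>\<^bsub>BG\<^esub> \<tau>" unfolding r_coset_def by blast
        then show ?thesis using B.repr_independence[OF _ \<tau>B H] a(2) by blast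
      qed
    qed
    show "{H #>\<^bsub>BG\<^esub> \<one>\<^bsub>BG\<^esub>, H #>\<^bsub>BG\<^esub> \<tau>} \<subseteq> rcosets\<^bsub>Aut_group U\<^esub> H"
      using A.one_closed \<tau>U unfolding RCOSETS_def rc by blast
  qed
  moreover have "H #>\<^bsub>BG\<^esub> \<one>\<^bsub>BG\<^esub> \<noteq> H #>\<^bsub>BG\<^esub> \<tau>"
    using B.rcos_self[OF \<tau>B H] \<tau>H unfolding B.coset_mult_one[OF H.subset] by auto
  ultimately show ?thesis by (simp add: subgroup_index_def)
qed

end

section \<open>The unitals \<open>OU\<close> and \<open>PU\<close>\<close>

lemma base_list_families: "every base_list DfM" "every base_list DfM'" "every base_list HfM"
  by code_simp+

text \<open>The family lists conjugates by 1, g and g^2 only; the conjugate by g^3 has to be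
  recognized as a right translate of a member.\<close>

lemma closed_DfM: "closedM (conjM gM) DfM" "closedM frobM DfM"
  by code_simp+

lemma closed_DfM': "closedM (conjM gM) DfM'" "closedM frobM DfM'"
  by code_simp+

text \<open>Closure under conjugation by f is what sets the classical family apart from the other
  two.\<close>

lemma closed_HfM: "closedM (conjM gM) HfM" "closedM frobM HfM" "closedM (conjM fM) HfM"
  by code_simp+

lemma partM_DfM: "partM DfM"
  by code_simp

lemma partM_DfM': "partM DfM'"
  by code_simp

lemma partM_HfM: "partM HfM"
  by code_simp

definition quot8 :: "m8 list \<Rightarrow> m8 \<Rightarrow> m8 \<Rightarrow> bool" where
  "quot8 D m y = elem (mulM m y) D"

text \<open>Entry 8 is diagonal with entries z^2 and z^5. Conjugation by f inverts it, so the
  inverse of its image is the entry itself, a quotient of D1 with denominator 1. For entry 1 the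
  inverse of the image falls among the quotients of D2. A translate of a single base block cannot
  meet two different parts.\<close>

lemma D1_conj_f_quotients:
  "any (quot8 (map (conjM gM) D1M) (adjM (conjM fM (D1M ! 1)))) (map (conjM gM) D1M)"
  "any (quot8 D1M (adjM (conjM fM (D1M ! 8)))) D1M"
  by code_simp+

lemma D1_conj_f_nontrivial:
  "adjM (conjM fM (D1M ! 1)) \<noteq> idM" "adjM (conjM fM (D1M ! 8)) \<noteq> idM"
  "detM (adjM (conjM fM (D1M ! 1))) = Z0" "detM (adjM (conjM fM (D1M ! 8))) = Z0"
  by code_simp+

lemma D1_conj_g_neq: "\<not> elem (conjM gM (D1M ! 1)) D1M"
  by code_simp

lemma base_list_D1M: "base_list D1M" "base_list (map (conjM gM) D1M)"
  by code_simp+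

lemma mul8_commute: "mul8 x y = mul8 y x"
  by (cases x; cases y) simp_all

lemma detM_adjM: "detM (adjM m) = detM m"
  by (cases m) (simp add: mul8_commute)

lemma closedM_iff:
  "closedM h F \<longleftrightarrow> (\<forall>D\<in>set F. \<exists>D'\<in>set F. \<exists>y\<in>set D'. \<forall>d\<in>set D. mulM (h d) y \<in> set D')"
  by (simp add: closedM_def shift_mem_def shift_eq_def shift_to_def shift_in_def)

section \<open>From evaluated tables to automorphisms of the unitals\<close>

context f8_field
begin

text \<open>The table check only yields that the image of K, translated by y, is contained in
  another member. Both sets have nine elements, so they agree, and y^-1 translates back.\<close>

lemma closed_family:
  assumes F: "every base_list F" and closed: "closedM h F" and \<alpha>: "\<alpha> \<in> auto SL2"
    and h: "\<And>m. detM m = Z0 \<Longrightarrow> \<alpha> (valM z m) = valM z (h m)"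
  shows "\<forall>K\<in>family z F. \<exists>K'\<in>family z F. \<exists>y\<in>carrier SL2. \<alpha> ` K = K' #>\<^bsub>SL2\<^esub> y"
proof
  fix K assume "K \<in> family z F"
  then obtain D where D: "D \<in> set F" "K = valM z ` set D" by (auto simp: family_def)
  then obtain D' y where D': "D' \<in> set F" "y \<in> set D'" "\<forall>d\<in>set D. mulM (h d) y \<in> set D'"
    using closed unfolding closedM_iff by blast
  have base_list: "base_list D" "base_list D'" using F D(1) D'(1) by auto
  then have detD: "detM d = Z0" if "d \<in> set D" for d using that by (auto simp: base_list_iff)
  have KG: "K \<subseteq> carrier SL2" using detD valM_closed unfolding D(2) by blast
  have yG: "valM z y \<in> carrier SL2" using base_list(2) D'(2) valM_closed by (auto simp: base_list_iff simp del: carrier_SL2)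
  have \<alpha>K: "\<alpha> ` K \<subseteq> carrier SL2" using KG SL2.auto_apply(1)[OF \<alpha>] by blast
  have sub: "\<alpha> ` K #>\<^bsub>SL2\<^esub> valM z y \<subseteq> valM z ` set D'"
  proof
    fix x assume "x \<in> \<alpha> ` K #>\<^bsub>SL2\<^esub> valM z y"
    then obtain d where d: "d \<in> set D" "x = \<alpha> (valM z d) \<otimes>\<^bsub>SL2\<^esub> valM z y"
      unfolding SL2.r_coset_image D(2) by blast
    then have "x = valM z (mulM (h d) y)" using h[OF detD[OF d(1)]] by (simp add: valM_mul)
    then show "x \<in> valM z ` set D'" using D'(3) d(1) by blast
  qed
  have "card (\<alpha> ` K #>\<^bsub>SL2\<^esub> valM z y) = card K"
    using SL2.card_r_coset[OF \<alpha>K yG] card_image[OF inj_on_subset[OF SL2.auto_apply(5)[OF \<alpha>] KG]] by simp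
  also have "\<dots> = card (valM z ` set D')"
    unfolding D(2) card_valM using base_list distinct_card by (metis base_list_iff)
  finally have "\<alpha> ` K #>\<^bsub>SL2\<^esub> valM z y = valM z ` set D'"
    by (rule card_subset_eq[OF _ sub, rotated]) simp
  then have "\<alpha> ` K = valM z ` set D' #>\<^bsub>SL2\<^esub> inv\<^bsub>SL2\<^esub> (valM z y)"
    using SL2.coset_mult_assoc[OF \<alpha>K yG SL2.inv_closed[OF yG]] SL2.r_inv[OF yG] SL2.coset_mult_one[OF \<alpha>K] by simp
  moreover have "valM z ` set D' \<in> family z F" using D'(1) by (simp add: family_def)
  ultimately show "\<exists>K'\<in>family z F. \<exists>y\<in>carrier SL2. \<alpha> ` K = K' #>\<^bsub>SL2\<^esub> y"
    using SL2.inv_closed[OF yG] by blast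
qed

lemma auto_C:
  assumes \<alpha>: "\<alpha> \<in> auto SL2" and g: "\<alpha> g = g [^]\<^bsub>SL2\<^esub> (k::nat)"
  shows "\<alpha> ` C = C"
proof -
  have sub: "\<alpha> ` C \<subseteq> C"
  proof
    fix x assume "x \<in> \<alpha> ` C"
    then obtain n :: nat where "x = \<alpha> (g [^]\<^bsub>SL2\<^esub> n)" unfolding image_iff Bex_def C_iff by blast
    then have "x = g [^]\<^bsub>SL2\<^esub> (k * n)"
      using SL2.auto_apply(4)[OF \<alpha> g_closed] g SL2.nat_pow_pow[OF g_closed] by simp
    then show "x \<in> C" unfolding C_iff by blast
  qed
  have "finite C" using finite_subset[OF C_sub finite_SL2] .
  then show ?thesis
    by (rule endo_inj_surj[OF _ sub inj_on_subset[OF SL2.auto_apply(5)[OF \<alpha>] C_sub]])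
qed

lemma conj_map_valM:
  "detM x = Z0 \<Longrightarrow> detM m = Z0 \<Longrightarrow> conj_map SL2 (valM z x) (valM z m) = valM z (conjM x m)"
  using SL2.conj_map_apply[OF valM_closed] valM_conj by metis

lemma \<gamma>_valM: "detM m = Z0 \<Longrightarrow> \<gamma> (valM z m) = valM z (conjM gM m)"
  using conj_map_valM[OF det_g] valM_g by simp

lemma \<tau>_valM: "detM m = Z0 \<Longrightarrow> \<tau> (valM z m) = valM z (conjM fM m)"
  using conj_map_valM[OF det_f] valM_f by simp

lemma \<phi>_valM: "detM m = Z0 \<Longrightarrow> \<phi> (valM z m) = valM z (frobM m)"
  using frob_apply[OF valM_closed] valM_frob by metis

lemma \<gamma>_auto: "\<gamma> \<in> auto SL2" and \<tau>_auto: "\<tau> \<in> auto SL2"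
  using SL2.conj_map_auto[OF g_closed] SL2.conj_map_auto[OF f_closed] by auto

lemma \<gamma>_g: "\<gamma> g = g [^]\<^bsub>SL2\<^esub> (1::nat)"
  using g_closed SL2.conj_map_apply[OF g_closed] SL2.nat_pow_eone[OF g_closed]
  by (simp add: conj_by_def del: mult_SL2 carrier_SL2)

text \<open>Every element of K is a product of a power of \<gamma> and a power of Frobenius, so
  these two maps decide.\<close>

lemma K_grp_sub_Aut:
  assumes F: "every base_list F" "partM F" "closedM (conjM gM) F" "closedM frobM F"
    and T: "sylow_subgroup 2 SL2 T"
  shows "K_grp \<subseteq> carrier (Aut_group (unital C T (family z F)))"
proof -
  interpret U: f8_unital z T "family z F"
    by unfold_locales (rule affine_family[OF F(1,2) T])
  interpret A: subgroup "carrier (Aut_group (unital C T (family z F)))" BG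
    by (rule U.Aut_subgroup)
  have \<gamma>A: "\<gamma> \<in> carrier (Aut_group (unital C T (family z F)))"
    by (rule U.auto_Aut[OF conj_map_sylow_autos[OF g_closed] auto_C[OF \<gamma>_auto \<gamma>_g]
        closed_family[OF F(1,3) \<gamma>_auto \<gamma>_valM]])
  have \<phi>A: "\<phi> \<in> carrier (Aut_group (unital C T (family z F)))"
    by (rule U.auto_Aut[OF frob_sylow_autos auto_C[OF frob_auto \<phi>_g]
        closed_family[OF F(1,4) frob_auto \<phi>_valM]])
  have pow: "\<alpha> [^]\<^bsub>BG\<^esub> (n::nat) \<in> carrier (Aut_group (unital C T (family z F)))"
    if "\<alpha> \<in> carrier (Aut_group (unital C T (family z F)))" for \<alpha> n
    using that by (induction n) auto
  show ?thesis
    using A.m_closed[OF pow[OF \<gamma>A] pow[OF \<phi>A]] unfolding subset_iff K_grp_iff by blast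
qed

lemma \<tau>_Aut:
  assumes F: "every base_list F" "partM F" "closedM (conjM fM) F" and T: "sylow_subgroup 2 SL2 T"
  shows "\<tau> \<in> carrier (Aut_group (unital C T (family z F)))"
proof -
  interpret U: f8_unital z T "family z F"
    by unfold_locales (rule affine_family[OF F(1,2) T])
  show ?thesis
    by (rule U.auto_Aut[OF conj_map_sylow_autos[OF f_closed] auto_C[OF \<tau>_auto \<tau>_g]
        closed_family[OF F(1,3) \<tau>_auto \<tau>_valM]])
qed

text \<open>The set \<open>(D\<^sub>1\<^sup>f)\<^sup>*\<close> meets both \<open>D\<^sub>1\<^sup>*\<close> and \<open>D\<^sub>2\<^sup>*\<close>, so \<open>D\<^sub>1\<^sup>f\<close> is not a block.\<close>

lemma \<tau>_not_Aut:
  assumes aff: "affine_SL28_unital C T \<D>"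
    and D: "valM z ` set D1M \<in> \<D>" "valM z ` set (map (conjM gM) D1M) \<in> \<D>"
  shows "\<tau> \<notin> carrier (Aut_group (unital C T \<D>))"
proof
  assume \<tau>: "\<tau> \<in> carrier (Aut_group (unital C T \<D>))"
  interpret U: f8_unital z T \<D> by unfold_locales (rule aff)
  let ?D1 = "valM z ` set D1M" and ?D2 = "valM z ` set (map (conjM gM) D1M)"
  have bases: "?D1 \<in> bases \<D>" "?D2 \<in> bases \<D>" using D by (auto simp: bases_def)
  have det: "\<forall>m\<in>set D1M. detM m = Z0" "\<forall>m\<in>set (map (conjM gM) D1M). detM m = Z0"
    using base_list_D1M unfolding base_list_iff by blast+
  have "?D1 = ?D1 #>\<^bsub>SL2\<^esub> \<one>\<^bsub>SL2\<^esub>"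
    using SL2.coset_mult_one[OF U.bases_sub[OF bases(1)]] by simp
  then have "?D1 \<in> blocks U.U" using U.blocksI[OF bases(1) SL2.one_closed] by simp
  then have "\<tau> ` ?D1 \<in> blocks U.U" using \<tau> by (auto simp: Aut_group_carrier)
  then obtain K x where K: "K \<in> bases \<D>" "x \<in> carrier SL2" "\<tau> ` ?D1 = K #>\<^bsub>SL2\<^esub> x" by (rule U.blocksE)
  have quotK: "quotients K = quotients (\<tau> ` ?D1)"
    unfolding K(3) by (rule quotients_r_coset[OF U.bases_sub[OF K(1)] K(2), symmetric])
  \<comment> \<open>Both 1 and the conjugate of d by f lie in the image of D1, so the inverse of
    this conjugate is a quotient of two elements of the image.\<close>
  have mem: "valM z (adjM (conjM fM d)) \<in> quotients K"
    if d: "d \<in> set D1M" "adjM (conjM fM d) \<noteq> idM" "detM (adjM (conjM fM d)) = Z0" for d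
  proof -
    have detd: "detM d = Z0" using det(1) d(1) by blast
    have "idM \<in> set D1M" using base_list_D1M(1) by (simp add: base_list_iff)
    then have 1: "\<one>\<^bsub>SL2\<^esub> \<in> \<tau> ` ?D1"
      using SL2.auto_apply(3)[OF \<tau>_auto] valM_one by (metis imageI)
    have 2: "valM z (conjM fM d) \<in> \<tau> ` ?D1"
      using \<tau>_valM[OF detd] d(1) by (metis imageI)
    have det': "detM (conjM fM d) = Z0" using d(3) by (simp only: detM_adjM)
    have "valM z (adjM (conjM fM d)) = \<one>\<^bsub>SL2\<^esub> \<otimes>\<^bsub>SL2\<^esub> inv\<^bsub>SL2\<^esub> (valM z (conjM fM d))"
      unfolding valM_inv[OF det'] using SL2.l_one[OF valM_closed[OF d(3)]] by simp
    moreover have "\<one>\<^bsub>SL2\<^esub> \<noteq> valM z (conjM fM d)"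
    proof
      assume "\<one>\<^bsub>SL2\<^esub> = valM z (conjM fM d)"
      then have "conjM fM d = idM" using valM_one valM_eq by metis
      then show False using d(2) by (simp add: idM_def)
    qed
    ultimately have "valM z (adjM (conjM fM d)) \<in> quotients (\<tau> ` ?D1)"
      unfolding quotients_def using 1 2 by blast
    then show ?thesis unfolding quotK .
  qed
  have idx: "D1M ! 1 \<in> set D1M" "D1M ! 8 \<in> set D1M" by (simp_all add: D1M_def)
  have "valM z (adjM (conjM fM (D1M ! 8))) \<in> quotients ?D1"
    using D1_conj_f_quotients(2) unfolding quotients_valM[OF det(1) D1_conj_f_nontrivial(4,2)] any_iff quot8_def elem_iff .
  then have "quotients K = quotients ?D1"
    by (rule U.bases_quotients_disjoint[OF K(1) bases(1) mem[OF idx(2) D1_conj_f_nontrivial(2,4)]])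
  moreover have "valM z (adjM (conjM fM (D1M ! 1))) \<in> quotients ?D2"
    using D1_conj_f_quotients(1) unfolding quotients_valM[OF det(2) D1_conj_f_nontrivial(3,1)] any_iff quot8_def elem_iff .
  then have "quotients K = quotients ?D2"
    by (rule U.bases_quotients_disjoint[OF K(1) bases(2) mem[OF idx(1) D1_conj_f_nontrivial(1,3)]])
  \<comment> \<open>In an affine unital the set of quotients determines the member of the family.
    The equality fails because the conjugate of entry 1 by g is not in D1.\<close>
  ultimately have "?D1 = ?D2"
    using aff D unfolding affine_SL28_unital_def inj_on_def by metis
  then have "set D1M = set (map (conjM gM) D1M)"
    by (rule inj_image_eq_iff[OF inj_valM, THEN iffD1])
  moreover have "conjM gM (D1M ! 1) \<in> conjM gM ` set D1M" by (rule imageI[OF idx(1)])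
  ultimately have "conjM gM (D1M ! 1) \<in> set D1M" by (simp only: set_map)
  then show False using D1_conj_g_neq by simp
qed

lemma conj_set_valM:
  assumes "detM x = Z0"
  shows "conj_set SL2 (valM z ` set D) (valM z x) = valM z ` set (map (conjM x) D)"
  by (simp add: conj_set_def image_image valM_conj[OF assms])

lemma orbit3_family:
  "valM z ` set D = X \<Longrightarrow> family z (orbit3 D) = {X, conj_set SL2 X g, conj_set SL2 X (g [^]\<^bsub>SL2\<^esub> (2::nat))}"
proof -
  assume X: "valM z ` set D = X"
  have gg: "detM (mulM gM gM) = Z0" by code_simp
  have "g [^]\<^bsub>SL2\<^esub> (2::nat) = valM z (mulM gM gM)"
    using g_closed by (simp add: numeral_2_eq_2 valM_mul valM_g one_SL2 flip: mat_1_eq_mat2)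
  then show ?thesis
    unfolding X[symmetric] conj_set_valM[OF gg, symmetric] valM_g[symmetric] conj_set_valM[OF det_g]
    by (simp add: family_def orbit3_def conj_set_valM[OF gg])
qed

lemma family_append: "family z (F @ F') = family z F \<union> family z F'"
  by (auto simp: family_def)

lemma D_family_eq: "D_family z = family z DfM"
  unfolding DfM_def family_append orbit3_family[OF valM_sets(3)] orbit3_family[OF valM_sets(4)] D_family_def by auto

lemma D'_family_eq: "D'_family z = family z DfM'"
proof -
  have "valM z ` set (map (conjM fM) D4M) = D4' z"
    unfolding D4'_def valM_f[symmetric] valM_sets(4)[symmetric] by (rule conj_set_valM[OF det_f, symmetric])
  from orbit3_family[OF this] show ?thesis
    unfolding DfM'_def family_append orbit3_family[OF valM_sets(3)] D'_family_def by auto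
qed

lemma H_family_eq: "H_family z = family z HfM"
proof -
  have "valM z ` set (map frobM D) = frob_mat ` valM z ` set D" for D
    by (simp add: image_image valM_frob)
  moreover have "(frob_mat ^^ 2) ` X = frob_mat ` frob_mat ` X" for X :: "('a^2^2) set"
    by (simp add: numeral_2_eq_2 image_image)
  ultimately show ?thesis
    by (simp add: family_def HfM_def H_family_def valM_sets del: set_map map_map)
qed

end

theorem theorem3p4:
  fixes z :: "'a::field" and T :: "('a^2^2) set"
  assumes "CARD('a) = 8"
    and "z ^ 3 = z + 1"
    and "{x::'a. x \<noteq> 0} = range (\<lambda>k::nat. z ^ k)"
    and "sylow_subgroup 2 SL2 T"
  shows "affine_SL28_unital (C_grp z) T (D_family z) \<and>
    affine_SL28_unital (C_grp z) T (D'_family z) \<and>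
    point_stabilizer (OU z T) \<one>\<^bsub>SL2\<^esub> = point_stabilizer (PU z T) \<one>\<^bsub>SL2\<^esub> \<and>
    internal_semidirect (point_stabilizer (OU z T) \<one>\<^bsub>SL2\<^esub>) (Gamma_grp z) L_grp \<and>
    BijGroup (carrier SL2) \<lparr>carrier := Gamma_grp z\<rparr> \<cong> integer_mod_group 9 \<and>
    BijGroup (carrier SL2) \<lparr>carrier := (L_grp :: ('a^2^2 \<Rightarrow> 'a^2^2) set)\<rparr> \<cong> integer_mod_group 3 \<and>
    (\<exists>\<theta> \<in> hom (integer_mod_group 3) (AutoGroup (integer_mod_group 9)).
           point_stabilizer (OU z T) \<one>\<^bsub>SL2\<^esub>
             \<cong> semidirect_product (integer_mod_group 9) (integer_mod_group 3) \<theta>) \<and>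
    Aut_group (OU z T) = Aut_group (PU z T) \<and>
    internal_semidirect (Aut_group (OU z T)) R_grp
           (Gamma_grp z <#>\<^bsub>BijGroup (carrier SL2)\<^esub> L_grp) \<and>
    subgroup (carrier (Aut_group (OU z T))) (Aut_group (classical_unital z T)) \<and>
    subgroup_index (Aut_group (classical_unital z T)) (carrier (Aut_group (OU z T))) = 2"
proof -
  interpret f8_field z by unfold_locales (use assms in auto)
  note T = assms(4)
  interpret OU: f8_unital z T "family z DfM"
    by unfold_locales (rule affine_family[OF base_list_families(1) partM_DfM T])
  interpret PU: f8_unital z T "family z DfM'"
    by unfold_locales (rule affine_family[OF base_list_families(2) partM_DfM' T])
  \<comment> \<open>The conditions are also verified for the classical family, so that the bound on
    its stabilizer of 1 is available for the index.\<close>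
  interpret CU: f8_unital z T "family z HfM"
    by unfold_locales (rule affine_family[OF base_list_families(3) partM_HfM T])
  have OU_eq: "OU z T = OU.U" and PU_eq: "PU z T = PU.U" and CU_eq: "classical_unital z T = CU.U"
    by (simp_all add: OU_def PU_def classical_unital_def D_family_eq D'_family_eq H_family_eq)
  \<comment> \<open>Both new families begin with the orbit of D1, so one obstruction excludes
    conjugation by f for OU and for PU.\<close>
  have mem: "valM z ` set D1M \<in> family z (orbit3 D1M @ F)" "valM z ` set (map (conjM gM) D1M) \<in> family z (orbit3 D1M @ F)" for F
    unfolding family_def by (auto simp: orbit3_def simp del: set_map)
  have KO: "K_grp \<subseteq> carrier (Aut_group OU.U)" and KP: "K_grp \<subseteq> carrier (Aut_group PU.U)"
    and KC: "K_grp \<subseteq> carrier (Aut_group CU.U)"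
    using K_grp_sub_Aut[OF base_list_families(1) partM_DfM closed_DfM T]
      K_grp_sub_Aut[OF base_list_families(2) partM_DfM' closed_DfM' T]
      K_grp_sub_Aut[OF base_list_families(3) partM_HfM closed_HfM(1,2) T] by blast+
  have \<tau>O: "\<tau> \<notin> carrier (Aut_group OU.U)" and \<tau>P: "\<tau> \<notin> carrier (Aut_group PU.U)"
    using \<tau>_not_Aut[OF OU.affine] \<tau>_not_Aut[OF PU.affine] mem unfolding DfM_def DfM'_def by blast+
  have \<tau>C: "\<tau> \<in> carrier (Aut_group CU.U)"
    by (rule \<tau>_Aut[OF base_list_families(3) partM_HfM closed_HfM(3) T])
  have stab: "point_stabilizer OU.U \<one>\<^bsub>SL2\<^esub> = BG\<lparr>carrier := K_grp\<rparr>" "point_stabilizer PU.U \<one>\<^bsub>SL2\<^esub> = BG\<lparr>carrier := K_grp\<rparr>"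
    using OU.point_stabilizer_eq[of "\<one>\<^bsub>SL2\<^esub>"] PU.point_stabilizer_eq[of "\<one>\<^bsub>SL2\<^esub>"]
    unfolding OU.stabilizer_eq_K[OF KO \<tau>O] PU.stabilizer_eq_K[OF KP \<tau>P] by blast+
  have AO: "carrier (Aut_group OU.U) = R_grp <#>\<^bsub>BG\<^esub> K_grp" by (rule OU.Aut_eq[OF KO \<tau>O])
  have "Aut_group OU.U = Aut_group PU.U"
    using Aut_group_eq[of OU.U] Aut_group_eq[of PU.U] AO PU.Aut_eq[OF KP \<tau>P] by simp
  moreover have RC: "R_grp \<subseteq> carrier (Aut_group CU.U)" and RO: "R_grp \<subseteq> carrier (Aut_group OU.U)"
    using CU.\<rho>_Aut OU.\<rho>_Aut unfolding R_grp_def by blast+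
  have sub: "carrier (Aut_group OU.U) \<subseteq> carrier (Aut_group CU.U)"
    unfolding AO set_mult_def using subgroup.m_closed[OF CU.Aut_subgroup] RC KC by blast
  moreover have "subgroup (carrier (Aut_group OU.U)) (Aut_group CU.U)"
    using B.subgroup_incl[OF OU.Aut_subgroup CU.Aut_subgroup sub] Aut_group_eq[of CU.U] by simp
  moreover have "subgroup_index (Aut_group CU.U) (carrier (Aut_group OU.U)) = 2"
    by (rule CU.index_two[OF OU.Aut_subgroup sub \<tau>C RO KO \<tau>O])
  ultimately show ?thesis
    unfolding OU_eq PU_eq CU_eq D_family_eq D'_family_eq stab K_grp_def[symmetric]
    using OU.affine PU.affine K_grp_semidirect Gamma_iso L_iso K_grp_iso OU.Aut_semidirect[OF KO \<tau>O]
    by blast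
qed

end
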